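(* Let $n\ge 2$ and $e\ge 1$ be integers and let $S=\mathbb{C}[x_0,\dots,x_n]$. Let $H_j:\ell_j=0$, for $j=0,\dots,n$, be $n+1$ hyperplanes in $\mathbb{P}^n=\mathbb{P}^n(\mathbb{C})$, defined by linear forms $\ell_j\in S_1$, such that $H_0\cap H_1\cap\dots\cap H_n=\emptyset$ (equivalently, $\ell_0,\dots,\ell_n$ are linearly independent). Let $W:g=0$ be a smooth hypersurface of degree $e$ in $\mathbb{P}^n$, with $g\in S_e$. Let $V=W\cup H_0\cup H_1\cup\dots\cup H_n$ be the hypersurface in $\mathbb{P}^n$ defined by $f=g\,\ell_0\ell_1\cdots\ell_n=0$, and assume that $V$ is a normal crossing divisor. Then the minimal graded free resolution of the Jacobian algebra $M(f)$ over $S$ has the form $$0\to S(-e_{n+1})^{c_{n+1}}\to S(-e_n)^{c_n}\to\cdots\to S(-e_1)^{c_1}\to S(-e_0)^{c_0}\ (\to M(f)\to 0),$$ where $c_k=\binom{n+1}{k}$ for $0\le k\le n+1$, $e_0=0$, $e_1=e+n$, and $e_k=ke+n+1$ for $2\le k\le n+1$. In particular, $V$ is an $N$-syzygy hypersurface with exponents $d_1=\dots=d_N=e+1$, where $N=\binom{n+1}{2}$. Moreover, for any fixed collection of hyperplanes $H_0,\dots,H_n$ with $H_0\cap\dots\cap H_n=\emptyset$, there is a nonempty Zariski open subset of $S_e$ such that for every $g$ in it the hypersurface $W:g=0$ is smooth and $V=W\cup H_0\cup\dots\cup H_n$ is a normal crossing divisor.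
   Context: $S=\mathbb{C}[x_0,\dots,x_n]$ has its standard grading, $S_e$ is the vector space of homogeneous polynomials of degree $e$, and $S(-a)$ denotes $S$ with grading shifted by $S(-a)_m=S_{m-a}$. For a homogeneous polynomial $f\in S$ defining a reduced hypersurface $V:f=0$ in $\mathbb{P}^n$, let $f_j=\partial f/\partial x_j$ and let $J_f=(f_0,\dots,f_n)\subset S$ be its Jacobian ideal. The Jacobian (or Milnor) algebra is $M(f)=S/J_f$. The graded $S$-module of Jacobian syzygies is $$D_0(f)=\Big\{(a_0,\dots,a_n)\in S^{n+1} : \sum_{j=0}^n a_jf_j=0\Big\},$$ where a homogeneous syzygy has degree $d$ if all its components $a_j$ lie in $S_d$. The hypersurface $V:f=0$ is an $m$-syzygy hypersurface with exponents $(d_1,\dots,d_m)$, $d_1\le\dots\le d_m$, if $D_0(f)$ is minimally generated by $m$ homogeneous syzygies $\rho_1,\dots,\rho_m$ with $\deg\rho_j=d_j$. The divisor $V$ is a normal crossing divisor if at each point $p\in V$ there are local analytic coordinates $y_1,\dots,y_n$ of $\mathbb{P}^n$ centered at $p$ in which $V$ is defined by $y_1\cdots y_r=0$ for some $1\le r\le n$. *)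

theory Defs
  imports "HOL-Analysis.Analysis" "HOL-Library.Poly_Mapping" "HOL-Library.Function_Algebras"
begin

section \<open>Polynomials\<close>

text \<open>
  A polynomial over the complex numbers in variables indexed by \<open>'v\<close> is a finitely supported
  function from monomials to coefficients. The ring $S = C[x_0,\ldots,x_n]$ is the type
  \<open>'n option mpoly\<close> with \<open>CARD('n) = n\<close>: the \<open>n + 1\<close> variables are indexed by \<open>'n option\<close>, and
  local coordinates of the \<open>n\<close>-dimensional projective space take values in \<open>complex ^ 'n\<close>.
\<close>

type_synonym 'v mpoly = "('v \<Rightarrow>\<^sub>0 nat) \<Rightarrow>\<^sub>0 complex"

definition var :: "'v \<Rightarrow> 'v mpoly" where
  "var i = Poly_Mapping.single (Poly_Mapping.single i 1) 1"

definition eval_mpoly :: "'v mpoly \<Rightarrow> ('v \<Rightarrow> complex) \<Rightarrow> complex" where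
  "eval_mpoly p x = (\<Sum>m\<in>Poly_Mapping.keys p. Poly_Mapping.lookup p m *
     (\<Prod>i\<in>Poly_Mapping.keys m. x i ^ Poly_Mapping.lookup m i))"

text \<open>If \<open>i\<close> does not occur in \<open>m\<close>, the subtraction below is truncated, but then the
  coefficient is zero.\<close>

definition partial_deriv :: "'v \<Rightarrow> 'v mpoly \<Rightarrow> 'v mpoly" where
  "partial_deriv i p = (\<Sum>m\<in>Poly_Mapping.keys p.
     Poly_Mapping.single (m - Poly_Mapping.single i 1)
       (of_nat (Poly_Mapping.lookup m i) * Poly_Mapping.lookup p m))"

definition forms :: "nat \<Rightarrow> 'v mpoly set" where
  "forms d = {p. \<forall>m\<in>Poly_Mapping.keys p. (\<Sum>i\<in>Poly_Mapping.keys m. Poly_Mapping.lookup m i) = d}"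


section \<open>Ideals, Jacobian ideal and Jacobian syzygies\<close>

text \<open>Ideals and submodules generated by a set are instances of \<open>module.span\<close>. The locale is not
  interpreted for multiplication, as its simplification rules loop together with \<open>mult.assoc\<close>.\<close>

lemma module_mult: "module ((*) :: 'a::comm_ring_1 \<Rightarrow> 'a \<Rightarrow> 'a)"
  by (rule module.intro) (rule distrib_left distrib_right mult.assoc[symmetric] mult_1_left)+

definition fun_scale :: "'a::comm_ring_1 \<Rightarrow> ('b \<Rightarrow> 'a) \<Rightarrow> 'b \<Rightarrow> 'a" where
  "fun_scale s v = (\<lambda>i. s * v i)"

lemma module_fun_scale: "module (fun_scale :: 'a::comm_ring_1 \<Rightarrow> ('b \<Rightarrow> 'a) \<Rightarrow> 'b \<Rightarrow> 'a)"
  by (rule module.intro)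
    (simp_all add: fun_scale_def fun_eq_iff distrib_left distrib_right mult.assoc)

definition jacobian_ideal :: "'v mpoly \<Rightarrow> 'v mpoly set" where
  "jacobian_ideal f = module.span (*) (range (\<lambda>j. partial_deriv j f))"

definition irrelevant_ideal :: "'v mpoly set" where
  "irrelevant_ideal = module.span (*) (range var)"

definition jacobian_syzygies :: "'v::finite mpoly \<Rightarrow> ('v \<Rightarrow> 'v mpoly) set" where
  "jacobian_syzygies f = {a. (\<Sum>j\<in>UNIV. a j * partial_deriv j f) = 0}"

text \<open>The hypersurface \<open>f = 0\<close> is an \<open>m\<close>-syzygy hypersurface with exponents \<open>ds\<close>,
  where \<open>m = length ds\<close>.\<close>

definition syzygy_hypersurface :: "'v::finite mpoly \<Rightarrow> nat list \<Rightarrow> bool" where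
  "syzygy_hypersurface f ds \<longleftrightarrow> sorted ds \<and>
     (\<exists>\<rho>. (\<forall>k<length ds. \<forall>j. \<rho> k j \<in> forms (ds ! k)) \<and>
          module.span fun_scale (\<rho> ` {..<length ds}) = jacobian_syzygies f \<and>
          (\<forall>K. K \<subset> {..<length ds} \<longrightarrow> module.span fun_scale (\<rho> ` K) \<noteq> jacobian_syzygies f))"


section \<open>Minimal graded free resolutions of quotients of the polynomial ring\<close>

definition residue_class :: "'v mpoly set \<Rightarrow> 'v mpoly \<Rightarrow> 'v mpoly set" where
  "residue_class J p = {q. q - p \<in> J}"

definition quotient_algebra :: "'v mpoly set \<Rightarrow> 'v mpoly set set" where
  "quotient_algebra J = range (residue_class J)"

text \<open>The shift list \<open>[a\<^sub>0, \<dots>, a\<^sub>r]\<close> encodes the graded free module that is the direct sum of the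
  modules $S(-a_i)$. Its elements are functions on \<open>nat\<close> vanishing beyond the length of the
  list, and its component of degree \<open>d\<close> is the direct sum of the $S_{d-a_i}$.\<close>

definition free_mod :: "nat list \<Rightarrow> (nat \<Rightarrow> 'v mpoly) set" where
  "free_mod as = {v. \<forall>i\<ge>length as. v i = 0}"

definition free_mod_component :: "nat list \<Rightarrow> nat \<Rightarrow> (nat \<Rightarrow> 'v mpoly) set" where
  "free_mod_component as d = {v \<in> free_mod as.
     \<forall>i<length as. if as ! i \<le> d then v i \<in> forms (d - as ! i) else v i = 0}"

definition graded_hom ::
    "nat list \<Rightarrow> nat list \<Rightarrow> ((nat \<Rightarrow> 'v mpoly) \<Rightarrow> (nat \<Rightarrow> 'v mpoly)) \<Rightarrow> bool" where
  "graded_hom as bs \<phi> \<longleftrightarrow>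
     \<phi> ` free_mod as \<subseteq> free_mod bs \<and>
     (\<forall>v\<in>free_mod as. \<forall>w\<in>free_mod as. \<phi> (v + w) = \<phi> v + \<phi> w) \<and>
     (\<forall>s. \<forall>v\<in>free_mod as. \<phi> (fun_scale s v) = fun_scale s (\<phi> v)) \<and>
     (\<forall>d. \<phi> ` free_mod_component as d \<subseteq> free_mod_component bs d)"

text \<open>Graded homomorphisms of degree 0 from a graded free module to \<open>S / J\<close>, the module
  structure and the grading on \<open>S / J\<close> being those induced from \<open>S\<close>.\<close>

definition graded_hom_quotient ::
    "nat list \<Rightarrow> 'v mpoly set \<Rightarrow> ((nat \<Rightarrow> 'v mpoly) \<Rightarrow> 'v mpoly set) \<Rightarrow> bool" where
  "graded_hom_quotient as J \<epsilon> \<longleftrightarrow>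
     \<epsilon> ` free_mod as \<subseteq> quotient_algebra J \<and>
     (\<forall>v\<in>free_mod as. \<forall>w\<in>free_mod as. \<forall>p q.
        \<epsilon> v = residue_class J p \<and> \<epsilon> w = residue_class J q \<longrightarrow>
        \<epsilon> (v + w) = residue_class J (p + q)) \<and>
     (\<forall>s. \<forall>v\<in>free_mod as. \<forall>p.
        \<epsilon> v = residue_class J p \<longrightarrow> \<epsilon> (fun_scale s v) = residue_class J (s * p)) \<and>
     (\<forall>d. \<epsilon> ` free_mod_component as d \<subseteq> residue_class J ` forms d)"

text \<open>The \<open>k\<close>-th free module \<open>F\<^sub>k\<close> has shift list \<open>F k\<close>; the differential \<open>\<delta> k\<close> goes from
  \<open>F\<^sub>k\<^sub>+\<^sub>1\<close> to \<open>F\<^sub>k\<close>. A resolution of length \<open>L\<close> is one with \<open>F k = []\<close>, that is a zero module, for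
  all \<open>k > L\<close>; exactness at \<open>F\<^sub>L\<close> is then injectivity of the last map. Minimality means
  that each differential maps into the irrelevant ideal times its target.\<close>

definition minimal_graded_free_resolution ::
    "'v mpoly set \<Rightarrow> (nat \<Rightarrow> nat list) \<Rightarrow> ((nat \<Rightarrow> 'v mpoly) \<Rightarrow> 'v mpoly set) \<Rightarrow>
     (nat \<Rightarrow> (nat \<Rightarrow> 'v mpoly) \<Rightarrow> (nat \<Rightarrow> 'v mpoly)) \<Rightarrow> bool" where
  "minimal_graded_free_resolution J F \<epsilon> \<delta> \<longleftrightarrow>
     graded_hom_quotient (F 0) J \<epsilon> \<and>
     (\<forall>k. graded_hom (F (Suc k)) (F k) (\<delta> k)) \<and>
     \<epsilon> ` free_mod (F 0) = quotient_algebra J \<and>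
     {v \<in> free_mod (F 0). \<epsilon> v = residue_class J 0} = \<delta> 0 ` free_mod (F 1) \<and>
     (\<forall>k. {v \<in> free_mod (F (Suc k)). \<delta> k v = 0} = \<delta> (Suc k) ` free_mod (F (Suc (Suc k)))) \<and>
     (\<forall>k. \<forall>v\<in>free_mod (F (Suc k)). \<forall>i. \<delta> k v i \<in> irrelevant_ideal)"


section \<open>Hypersurfaces and normal crossing divisors\<close>

text \<open>Subsets of projective space are represented by their cones in the space of nonzero
  vectors of homogeneous coordinates.\<close>

definition hypersurface :: "'v::finite mpoly \<Rightarrow> (complex ^ 'v) set" where
  "hypersurface f = {x. x \<noteq> 0 \<and> eval_mpoly f (($) x) = 0}"

definition smooth_hypersurface :: "'v::finite mpoly \<Rightarrow> bool" where
  "smooth_hypersurface g \<longleftrightarrow>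
     (\<forall>x\<in>hypersurface g. \<exists>i. eval_mpoly (partial_deriv i g) (($) x) \<noteq> 0)"

definition holomorphic_fun :: "(complex ^ 'm::finite) set \<Rightarrow> (complex ^ 'm \<Rightarrow> complex) \<Rightarrow> bool" where
  "holomorphic_fun U h \<longleftrightarrow> open U \<and>
     (\<forall>x\<in>U. \<exists>h'. (h has_derivative h') (at x) \<and> (\<forall>c v. h' (c *s v) = c * h' v))"

definition holomorphic_map ::
    "(complex ^ 'm::finite) set \<Rightarrow> (complex ^ 'm \<Rightarrow> complex ^ 'k::finite) \<Rightarrow> bool" where
  "holomorphic_map U h \<longleftrightarrow> (\<forall>k. holomorphic_fun U (\<lambda>x. h x $ k))"

text \<open>An open cone \<open>U\<close> represents an open subset of projective space, and a holomorphic map \<open>Y\<close> on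
  that subset is a holomorphic map on \<open>U\<close> that is invariant under scaling. The map \<open>Y\<close> is a system
  of analytic coordinates if it is a biholomorphism from the subset onto an open subset of
  \<open>complex ^ 'n\<close>; its inverse is given by the map \<open>\<sigma>\<close> in terms of homogeneous coordinates.\<close>

definition analytic_coordinates ::
    "(complex ^ 'n::finite option) set \<Rightarrow> (complex ^ 'n option \<Rightarrow> complex ^ 'n) \<Rightarrow> bool" where
  "analytic_coordinates U Y \<longleftrightarrow>
     0 \<notin> U \<and> (\<forall>x\<in>U. \<forall>c. c \<noteq> 0 \<longrightarrow> c *s x \<in> U \<and> Y (c *s x) = Y x) \<and>
     holomorphic_map U Y \<and>
     (\<exists>\<sigma>. holomorphic_map (Y ` U) \<sigma> \<and> (\<forall>x\<in>U. \<exists>c. c \<noteq> 0 \<and> \<sigma> (Y x) = c *s x))"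

text \<open>A divisor is defined near \<open>p\<close> by a product of coordinates if its local equation equals that
  product up to a unit, i.e. a nowhere vanishing holomorphic function. On the cone \<open>U\<close>, the unit
  \<open>u\<close> also accounts for the passage between the form \<open>f\<close> and its dehomogenisations \<open>f / x\<^sub>i\<^sup>d\<close>. As
  the coordinates are unordered, the product is taken over a nonempty set of them.
  A polynomial \<open>f\<close> with a repeated nonconstant factor does not satisfy this definition.\<close>

definition normal_crossing_divisor :: "'n::finite option mpoly \<Rightarrow> bool" where
  "normal_crossing_divisor f \<longleftrightarrow>
     (\<forall>p\<in>hypersurface f. \<exists>U Y R u.
        p \<in> U \<and> analytic_coordinates U Y \<and> Y p = 0 \<and> R \<noteq> {} \<and>
        holomorphic_fun U u \<and> (\<forall>x\<in>U. u x \<noteq> 0) \<and>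
        (\<forall>x\<in>U. eval_mpoly f (($) x) = u x * (\<Prod>k\<in>R. Y x $ k)))"

text \<open>The affine space \<open>S\<^sub>e\<close> has the coefficients of the monomials as its coordinates, so polynomial
  functions on it are given by polynomials in variables indexed by monomials.\<close>

definition zariski_open_forms :: "nat \<Rightarrow> 'v mpoly set \<Rightarrow> bool" where
  "zariski_open_forms e G \<longleftrightarrow>
     (\<exists>P :: ('v \<Rightarrow>\<^sub>0 nat) mpoly set.
        G = {g \<in> forms e. \<exists>q\<in>P. eval_mpoly q (Poly_Mapping.lookup g) \<noteq> 0})"


section \<open>The shifts of the resolution\<close>

definition shift :: "nat \<Rightarrow> nat \<Rightarrow> nat \<Rightarrow> nat" where
  "shift n e k = (if k = 0 then 0 else if k = 1 then e + n else k * e + n + 1)"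

end

theory Submission
  imports "Jordan_Normal_Form.Char_Poly" Defs
begin

text \<open>
  Let \<open>D j\<close> be the derivation dual to the linear form \<open>l j\<close>, so that \<open>D j f\<close> is the product of
  \<open>h j = g + l j * D j g\<close> and of the \<open>l i\<close> with \<open>i \<noteq> j\<close>. By Euler's identity, the \<open>h j\<close> and the
  \<open>l j * D j g\<close> have the same common zeros, and \<open>V\<close> is a normal crossing divisor if and only if
  the origin is the only one. In this case the Nullstellensatz gives a power of every variable in the
  ideal of the \<open>h j\<close>, so that their Koszul complex is exact. A syzygy \<open>b\<close> of the \<open>D j f\<close> satisfies
  \<open>b j = l j * b' j\<close> for a syzygy \<open>b'\<close> of the \<open>h j\<close>, as the \<open>l j\<close> are prime; thus multiplying the
  last but one map of the Koszul complex by the \<open>l j\<close> gives the resolution of the Jacobian algebra.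
  That the origin is the only common zero is an open condition on \<open>g\<close>, which holds for the Fermat
  form in the \<open>l j\<close>.
\<close>

text \<open>The obstacle is that the partial derivatives of \<open>f\<close> vanish together
  wherever two components of \<open>V\<close> meet, so they are far from a regular sequence. In the
  coordinates \<open>l j\<close> the common factors split off explicitly, and what remains are the n
  + 1 forms \<open>h j\<close> of degree e. Their sum is (n + 1 + e) g, hence g vanishes at each of
  their common zeros, and so do all \<open>l j * D j g\<close>. At such a point other than the
  origin, dg is a combination of the \<open>l j\<close> vanishing there, which is the failure of
  transversality. The degrees of the entries explain the shifts: e + n for the \<open>D j f\<close>
  in the first map, e + 1 for the products \<open>l j * h i\<close> in the second one, and e for the
  Koszul entries \<open>h i\<close> in all later ones. The sums are e + n and then ke + n + 1.
  Exactness of the Koszul complex is obtained without a theory of depth: a regular sequence of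
  powers of the variables inside the ideal of the \<open>h j\<close> suffices, since contracting
  homotopies show that this ideal kills the homology.\<close>

no_notation Matrix.vec_index (infixl \<open>$\<close> 100)

section \<open>Polynomials\<close>

abbreviation lookup :: "('a \<Rightarrow>\<^sub>0 'b::zero) \<Rightarrow> 'a \<Rightarrow> 'b" where
  "lookup \<equiv> Poly_Mapping.lookup"

abbreviation keys :: "('a \<Rightarrow>\<^sub>0 'b::zero) \<Rightarrow> 'a set" where
  "keys \<equiv> Poly_Mapping.keys"

abbreviation single :: "'a \<Rightarrow> 'b \<Rightarrow> ('a \<Rightarrow>\<^sub>0 'b::zero)" where
  "single \<equiv> Poly_Mapping.single"

abbreviation Const :: "complex \<Rightarrow> 'v mpoly" where
  "Const \<equiv> single 0"

section \<open>Evaluation and substitution as ring homomorphisms\<close>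

definition mon :: "('v \<Rightarrow> 'a) \<Rightarrow> ('v \<Rightarrow>\<^sub>0 nat) \<Rightarrow> 'a::comm_ring_1" where
  "mon x m = (\<Prod>i\<in>keys m. x i ^ lookup m i)"

text \<open>The coefficient map is a parameter to cover two cases: with \<open>id\<close> this is
  evaluation at a point, with \<open>Const\<close> it is substitution of polynomials for the
  variables.\<close>

definition ev :: "(complex \<Rightarrow> 'a::comm_ring_1) \<Rightarrow> ('v \<Rightarrow> 'a) \<Rightarrow> 'v mpoly \<Rightarrow> 'a" where
  "ev \<kappa> x p = (\<Sum>m\<in>keys p. \<kappa> (lookup p m) * mon x m)"

lemma eval_mpoly_ev: "eval_mpoly p x = ev id x p"
  by (simp add: eval_mpoly_def ev_def mon_def)

lemma mon_superset:
  assumes "finite A" "keys m \<subseteq> A"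
  shows "mon x m = (\<Prod>i\<in>A. x i ^ lookup m i)"
  unfolding mon_def by (rule prod.mono_neutral_left) (use assms in \<open>auto simp: in_keys_iff\<close>)

lemma mon_0 [simp]: "mon x 0 = 1"
  by (simp add: mon_def)

lemma mon_add: "mon x (m + m') = mon x m * mon x m'"
proof -
  let ?A = "keys m \<union> keys m'"
  have "keys (m + m') \<subseteq> ?A" by (rule Poly_Mapping.keys_add)
  then show ?thesis
    by (simp add: mon_superset[of ?A] lookup_add power_add prod.distrib)
qed

lemma mon_single [simp]: "mon x (single i k) = x i ^ k"
  by (simp add: mon_def)

lemma poly_mapping_sum_single:
  "p = (\<Sum>m\<in>keys p. single m (lookup p m))"
proof (rule poly_mapping_eqI)
  fix k
  show "lookup p k =
    lookup (\<Sum>m\<in>keys p. single m (lookup p m)) k"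
    by (cases "k \<in> keys p")
      (auto simp: lookup_sum lookup_single when_def in_keys_iff)
qed

text \<open>Serves on two levels, for polynomials and for exponent vectors, both being finitely
  supported functions.\<close>

lemma single_add_induct [case_names zero single add]:
  fixes p :: "'a \<Rightarrow>\<^sub>0 'b::comm_monoid_add"
  assumes "P 0" "\<And>m c. P (single m c)" "\<And>p q. P p \<Longrightarrow> P q \<Longrightarrow> P (p + q)"
  shows "P p"
proof -
  have "P (\<Sum>m\<in>A. single m (lookup p m))" if "finite A" for A
    using that by (induction A) (auto intro: assms)
  then show ?thesis
    by (subst poly_mapping_sum_single) simp
qed

context
  fixes \<kappa> :: "complex \<Rightarrow> 'a::comm_ring_1"
  assumes \<kappa>: "comm_ring_hom \<kappa>"
begin

interpretation \<kappa>: comm_ring_hom \<kappa> by (rule \<kappa>)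

lemma ev_superset:
  assumes "finite A" "keys p \<subseteq> A"
  shows "ev \<kappa> x p = (\<Sum>m\<in>A. \<kappa> (lookup p m) * mon x m)"
  unfolding ev_def
  by (rule sum.mono_neutral_left) (use assms in \<open>auto simp: in_keys_iff\<close>)

lemma ev_single: "ev \<kappa> x (single m c) = \<kappa> c * mon x m"
  by (subst ev_superset[of "{m}"]) auto

lemma ev_add: "ev \<kappa> x (p + q) = ev \<kappa> x p + ev \<kappa> x q"
proof -
  let ?A = "keys p \<union> keys q"
  have "keys (p + q) \<subseteq> ?A" by (rule Poly_Mapping.keys_add)
  then show ?thesis
    by (simp add: ev_superset[of ?A] lookup_add \<kappa>.hom_add distrib_right sum.distrib)
qed

lemma ev_zero: "ev \<kappa> x 0 = 0"
  by (simp add: ev_def)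

lemma ev_mult: "ev \<kappa> x (p * q) = ev \<kappa> x p * ev \<kappa> x q"
proof (induction p rule: single_add_induct)
  case (single m c)
  show ?case
    by (induction q rule: single_add_induct)
      (simp_all add: ev_zero mult_single ev_single mon_add \<kappa>.hom_mult algebra_simps ev_add)
qed (simp_all add: ev_zero ev_add algebra_simps)

lemma ev_hom: "comm_ring_hom (ev \<kappa> x)"
proof
  show "ev \<kappa> x 1 = 1"
    using ev_single[of x 0 1] by simp
qed (simp_all add: ev_zero ev_add ev_mult)

lemma ev_Const: "ev \<kappa> x (Const c) = \<kappa> c"
  by (simp add: ev_single)

lemma ev_var: "ev \<kappa> x (var i) = x i"
  by (simp add: var_def ev_single)

end

lemma comm_ring_hom_id: "comm_ring_hom (id :: 'a::comm_ring_1 \<Rightarrow> 'a)"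
  by unfold_locales auto

lemma comm_ring_hom_Const: "comm_ring_hom (Const :: complex \<Rightarrow> 'v mpoly)"
  by unfold_locales (auto simp: single_add mult_single)

interpretation eval_mpoly: comm_ring_hom "\<lambda>p. eval_mpoly p x" for x
  using ev_hom[OF comm_ring_hom_id, of x] by (simp add: eval_mpoly_ev)

lemmas eval_hom = eval_mpoly.hom_add eval_mpoly.hom_minus eval_mpoly.hom_mult eval_mpoly.hom_sum
  eval_mpoly.hom_prod eval_mpoly.hom_power

lemma eval_mpoly_Const [simp]: "eval_mpoly (Const c) x = c"
  by (simp add: eval_mpoly_ev ev_Const[OF comm_ring_hom_id])

lemma eval_mpoly_var [simp]: "eval_mpoly (var i) x = x i"
  by (simp add: eval_mpoly_ev ev_var[OF comm_ring_hom_id])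

lemma mon_var: "mon var m = single m (1 :: complex)"
proof (induction m rule: single_add_induct)
  case (single i k)
  show ?case
    by (induction k) (simp_all add: var_def mult_single flip: single_add)
qed (simp_all add: mon_add mult_single)

lemma single_eq_mon: "single m c = Const c * mon var m"
  by (simp add: mon_var mult_single)

lemma mpoly_ring_induct [case_names Const var add mult]:
  fixes p :: "'v mpoly"
  assumes "\<And>c. P (Const c)" "\<And>i. P (var i)"
    "\<And>p q. P p \<Longrightarrow> P q \<Longrightarrow> P (p + q)" "\<And>p q. P p \<Longrightarrow> P q \<Longrightarrow> P (p * q)"
  shows "P p"
proof (induction p rule: single_add_induct)
  case zero
  show ?case using assms(1)[of 0] by simp
next
  case (single m c)
  have "P (mon var m)"
  proof (induction m rule: single_add_induct)
    case zero
    show ?case using assms(1)[of 1] by simp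
  next
    case (single i k)
    have "P (var i ^ k)"
      using assms(1)[of 1] by (induction k) (auto intro: assms)
    then show ?case by simp
  qed (simp add: mon_add assms)
  then show ?case by (simp add: single_eq_mon[of m c] assms)
qed (rule assms)

lemma mpoly_hom_eqI:
  fixes \<phi> \<psi> :: "'v mpoly \<Rightarrow> 'a::comm_ring_1"
  assumes "comm_ring_hom \<phi>" "comm_ring_hom \<psi>"
    "\<And>c. \<phi> (Const c) = \<psi> (Const c)" "\<And>i. \<phi> (var i) = \<psi> (var i)"
  shows "\<phi> p = \<psi> p"
proof -
  interpret \<phi>: comm_ring_hom \<phi> by fact
  interpret \<psi>: comm_ring_hom \<psi> by fact
  show ?thesis
    by (induction p rule: mpoly_ring_induct)
      (simp_all add: assms \<phi>.hom_add \<phi>.hom_mult \<psi>.hom_add \<psi>.hom_mult)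
qed

lemma comm_ring_hom_comp:
  assumes "comm_ring_hom \<phi>" "comm_ring_hom \<psi>"
  shows "comm_ring_hom (\<lambda>p. \<phi> (\<psi> p))"
proof -
  interpret \<phi>: comm_ring_hom \<phi> by fact
  interpret \<psi>: comm_ring_hom \<psi> by fact
  show ?thesis
    by unfold_locales (simp_all add: \<phi>.hom_add \<phi>.hom_mult \<psi>.hom_add \<psi>.hom_mult)
qed

abbreviation subst :: "('v \<Rightarrow> 'w mpoly) \<Rightarrow> 'v mpoly \<Rightarrow> 'w mpoly" where
  "subst \<equiv> ev Const"

lemmas subst_hom = ev_hom[OF comm_ring_hom_Const]
  and subst_Const [simp] = ev_Const[OF comm_ring_hom_Const]
  and subst_var [simp] = ev_var[OF comm_ring_hom_Const]

interpretation subst: comm_ring_hom "subst x" for x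
  by (rule subst_hom)

text \<open>The library has no zero divisors only for linearly ordered sets of variables.\<close>

lemma mpoly_no_zero_divisors:
  fixes p q :: "'v::finite mpoly"
  assumes "p * q = 0"
  shows "p = 0 \<or> q = 0"
proof -
  obtain idx :: "'v \<Rightarrow> nat" where idx: "inj idx"
    using finite_imp_inj_to_nat_seg[of "UNIV :: 'v set"] by auto
  \<comment> \<open>Renaming the variables by \<open>idx\<close> leads to polynomials over the
    ordered type \<open>nat\<close>; the left inverse \<open>?G\<close> makes the renaming
    injective.\<close>
  let ?F = "subst (\<lambda>i. var (idx i))" and ?G = "subst (\<lambda>k. var (inv_into UNIV idx k))"
  have inv: "?G (?F p) = p" for p :: "'v mpoly"
    using mpoly_hom_eqI[OF comm_ring_hom_comp[OF subst_hom subst_hom] comm_ring_hom_id,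
        of "\<lambda>k. var (inv_into UNIV idx k)" "\<lambda>i. var (idx i)" p] idx by simp
  have "?F p * ?F q = 0"
    using assms by (metis subst.hom_mult subst.hom_zero)
  then have "?F p = 0 \<or> ?F q = 0" by simp
  then show ?thesis
    by (metis inv subst.hom_zero)
qed

lemma mpoly_prod_eq_0:
  fixes p :: "'a \<Rightarrow> 'v::finite mpoly"
  assumes "finite A" "(\<Prod>i\<in>A. p i) = 0"
  shows "\<exists>i\<in>A. p i = 0"
  using assms
  by (induction A) (auto dest: mpoly_no_zero_divisors)


subsection \<open>Homogeneous polynomials\<close>

definition mdeg :: "('v \<Rightarrow>\<^sub>0 nat) \<Rightarrow> nat" where
  "mdeg m = (\<Sum>i\<in>keys m. lookup m i)"

lemma forms_mdeg: "p \<in> forms d \<longleftrightarrow> (\<forall>m\<in>keys p. mdeg m = d)"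
  by (simp add: forms_def mdeg_def)

lemma mdeg_superset:
  assumes "finite A" "keys m \<subseteq> A"
  shows "mdeg m = (\<Sum>i\<in>A. lookup m i)"
  unfolding mdeg_def by (rule sum.mono_neutral_left) (use assms in \<open>auto simp: in_keys_iff\<close>)

lemma mdeg_add: "mdeg (m + m') = mdeg m + mdeg m'"
proof -
  let ?A = "keys m \<union> keys m'"
  have "keys (m + m') \<subseteq> ?A" by (rule Poly_Mapping.keys_add)
  then show ?thesis
    by (simp add: mdeg_superset[of ?A] lookup_add sum.distrib)
qed

lemma mdeg_0 [simp]: "mdeg 0 = 0"
  by (simp add: mdeg_def)

lemma mdeg_single [simp]: "mdeg (single i k) = k"
  by (simp add: mdeg_def)

lemma mdeg_eq_0_iff [simp]: "mdeg m = 0 \<longleftrightarrow> m = 0"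
  by (auto simp: mdeg_def in_keys_iff intro!: poly_mapping_eqI)

lemma mdeg_ge_lookup: "lookup m i \<le> mdeg m"
  unfolding mdeg_def
  by (cases "i \<in> keys m") (auto intro: member_le_sum simp: in_keys_iff)

lemma mdeg_eq_1D: "mdeg m = 1 \<Longrightarrow> \<exists>i. m = single i 1"
proof -
  assume m: "mdeg m = 1"
  then have "m \<noteq> 0" by auto
  then obtain i where i: "lookup m i \<noteq> 0"
    by (metis poly_mapping_eqI lookup_zero)
  have "m = single i 1 + (m - single i 1)"
    using i by (intro poly_mapping_eqI) (auto simp: lookup_add lookup_minus lookup_single when_def)
  then have "mdeg (m - single i 1) = 0"
    using m mdeg_add[of "single i 1" "m - single i 1"] by simp
  then show ?thesis
    using \<open>m = _\<close> by auto
qed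

lemma forms_0 [simp]: "0 \<in> forms d"
  by (simp add: forms_mdeg)

lemma forms_add: "p \<in> forms d \<Longrightarrow> q \<in> forms d \<Longrightarrow> p + q \<in> forms d"
  using Poly_Mapping.keys_add[of p q] by (auto simp: forms_mdeg)

lemma forms_sum: "(\<And>i. i \<in> A \<Longrightarrow> p i \<in> forms d) \<Longrightarrow> (\<Sum>i\<in>A. p i) \<in> forms d"
  by (induction A rule: infinite_finite_induct) (auto intro: forms_add)

lemma forms_mult: "p \<in> forms d \<Longrightarrow> q \<in> forms d' \<Longrightarrow> p * q \<in> forms (d + d')"
  using keys_mult[of p q] by (force simp: forms_mdeg mdeg_add)

lemma forms_single: "c = 0 \<or> mdeg m = d \<Longrightarrow> single m c \<in> forms d"
  by (auto simp: forms_mdeg)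

lemma forms_Const [simp]: "Const c \<in> forms 0"
  by (simp add: forms_single)

lemma forms_1 [simp]: "1 \<in> forms 0"
  using forms_Const[of 1] by simp

lemma forms_var [simp]: "var i \<in> forms 1"
  by (simp add: var_def forms_single)

lemma forms_mult_Const: "p \<in> forms d \<Longrightarrow> Const c * p \<in> forms d"
  using forms_mult[OF forms_Const] by fastforce

lemma forms_uminus: "p \<in> forms d \<Longrightarrow> - p \<in> forms d"
  by (auto simp: forms_mdeg in_keys_iff)

lemma forms_power: "p \<in> forms d \<Longrightarrow> p ^ k \<in> forms (k * d)"
  by (induction k) (auto intro: forms_mult)

lemma forms_prod:
  "(\<And>i. i \<in> A \<Longrightarrow> p i \<in> forms (d i)) \<Longrightarrow> (\<Prod>i\<in>A. p i) \<in> forms (\<Sum>i\<in>A. d i)"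
  by (induction A rule: infinite_finite_induct) (auto intro: forms_mult)

lemma forms_1_eq:
  fixes p :: "'v::finite mpoly"
  assumes "p \<in> forms 1"
  shows "p = (\<Sum>i\<in>UNIV. Const (lookup p (single i 1)) * var i)"
proof (rule poly_mapping_eqI)
  fix m
  have "lookup p m = (\<Sum>i\<in>UNIV.
    (lookup p (single i 1) when single i 1 = m))"
  proof (cases "mdeg m = 1")
    case True
    then obtain i where "m = single i 1" using mdeg_eq_1D by blast
    moreover have "single k 1 = single i (1 :: nat) \<longleftrightarrow> k = i" for k
      by (metis lookup_single_eq lookup_single_not_eq zero_neq_one)
    ultimately show ?thesis by (simp add: when_def)
  next
    case False
    then have "lookup p m = 0"
      using assms by (auto simp: forms_mdeg in_keys_iff)
    moreover have "single i 1 \<noteq> m" for i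
      using False by auto
    ultimately show ?thesis by simp
  qed
  then show "lookup p m = lookup (\<Sum>i\<in>UNIV.
    Const (lookup p (single i 1)) * var i) m"
    by (simp add: lookup_sum var_def mult_single lookup_single)
qed

lemma mon_scale:
  fixes x :: "'v \<Rightarrow> complex"
  shows "mon (\<lambda>i. c * x i) m = c ^ mdeg m * mon x m"
  by (simp add: mon_def mdeg_def power_mult_distrib prod.distrib power_sum)

lemma eval_mpoly_scale:
  assumes "p \<in> forms d"
  shows "eval_mpoly p (\<lambda>i. c * x i) = c ^ d * eval_mpoly p x"
  using assms by (simp add: eval_mpoly_ev ev_def mon_scale forms_mdeg sum_distrib_left algebra_simps)

lemma eval_mpoly_zero_arg:
  assumes "p \<in> forms d" "0 < d"
  shows "eval_mpoly p (\<lambda>i. 0) = 0"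
  using eval_mpoly_scale[OF assms(1), of 0 "\<lambda>i. 0"] assms(2) by (simp add: zero_power)


subsection \<open>Partial derivatives\<close>

lemma partial_deriv_superset:
  assumes "finite A" "keys p \<subseteq> A"
  shows "partial_deriv i p = (\<Sum>m\<in>A. single (m - single i 1)
     (of_nat (lookup m i) * lookup p m))"
  unfolding partial_deriv_def
  by (rule sum.mono_neutral_left) (use assms in \<open>auto simp: in_keys_iff\<close>)

lemma partial_deriv_single: "partial_deriv i (single m c) =
    single (m - single i 1) (of_nat (lookup m i) * c)"
  by (subst partial_deriv_superset[of "{m}"]) auto

lemma partial_deriv_0 [simp]: "partial_deriv i 0 = 0"
  by (simp add: partial_deriv_def)

lemma partial_deriv_add: "partial_deriv i (p + q) = partial_deriv i p + partial_deriv i q"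
proof -
  let ?A = "keys p \<union> keys q"
  have "keys (p + q) \<subseteq> ?A" by (rule Poly_Mapping.keys_add)
  then show ?thesis
    by (simp add: partial_deriv_superset[of ?A] lookup_add distrib_left single_add sum.distrib)
qed

lemma partial_deriv_sum: "partial_deriv i (\<Sum>j\<in>A. p j) = (\<Sum>j\<in>A. partial_deriv i (p j))"
  by (induction A rule: infinite_finite_induct) (auto simp: partial_deriv_add)

lemma partial_deriv_Const [simp]: "partial_deriv i (Const c) = 0"
  by (simp add: partial_deriv_single)

lemma partial_deriv_1 [simp]: "partial_deriv i 1 = 0"
  using partial_deriv_Const[of i 1] by simp

lemma partial_deriv_var: "partial_deriv i (var j) = (if i = j then 1 else 0)"
  by (auto simp: var_def partial_deriv_single lookup_single when_def)

lemma partial_deriv_mult: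
  "partial_deriv i (p * q) = partial_deriv i p * q + p * partial_deriv i q"
proof (induction p rule: single_add_induct)
  case (single m c)
  show ?case
  proof (induction q rule: single_add_induct)
    case (single m' c')
    let ?e = "single i (1::nat)"
    \<comment> \<open>Truncated subtraction is harmless: lowering the exponent of a variable in a
      product can be done in any factor that contains the variable, and a factor without it
      contributes coefficient 0.\<close>
    have *: "m + m' - ?e = m - ?e + m'" if "lookup m i \<noteq> 0" for m m' :: "'a \<Rightarrow>\<^sub>0 nat"
      using that by (intro poly_mapping_eqI) (auto simp: lookup_add lookup_minus lookup_single when_def)
    show ?case
      using *[of m m'] *[of m' m]
      by (cases "lookup m i = 0"; cases "lookup m' i = 0")
        (simp_all add: mult_single partial_deriv_single lookup_add algebra_simps flip: single_add)
  qed (simp_all add: partial_deriv_add algebra_simps)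
qed (simp_all add: partial_deriv_add algebra_simps)

lemma partial_deriv_Const_mult [simp]: "partial_deriv i (Const c * p) = Const c * partial_deriv i p"
  by (simp add: partial_deriv_mult)

lemma partial_deriv_power:
  "partial_deriv i (p ^ k) = of_nat k * p ^ (k - 1) * partial_deriv i p"
proof (induction k)
  case (Suc k)
  then show ?case
    by (cases k) (simp_all add: partial_deriv_mult algebra_simps)
qed (use partial_deriv_Const[of i 1] in simp)

lemma partial_deriv_forms:
  assumes "p \<in> forms d"
  shows "partial_deriv i p \<in> forms (d - 1)"
  unfolding partial_deriv_def
proof (intro forms_sum forms_single)
  fix m assume "m \<in> keys p"
  then have d: "mdeg m = d" using assms by (simp add: forms_mdeg)
  let ?e = "single i (1::nat)"
  show "of_nat (lookup m i) * lookup p m = 0 \<or> mdeg (m - ?e) = d - 1"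
  proof (cases "lookup m i = 0")
    case False
    then have "m = ?e + (m - ?e)"
      by (intro poly_mapping_eqI) (auto simp: lookup_add lookup_minus lookup_single when_def)
    then have "mdeg m = 1 + mdeg (m - ?e)"
      using mdeg_add[of ?e "m - ?e"] by simp
    then show ?thesis using d by simp
  qed simp
qed

text \<open>Multiplying the i-th partial derivative by \<open>var i\<close> multiplies each monomial
  by its exponent at i, and the exponents of a monomial of degree d add up to d.\<close>

lemma euler_identity:
  fixes p :: "'v::finite mpoly"
  assumes "p \<in> forms d"
  shows "(\<Sum>i\<in>UNIV. var i * partial_deriv i p) = of_nat d * p"
proof -
  have single: "var i * partial_deriv i (single m c) =
      single m (of_nat (lookup m i) * c)" for i :: 'v and m c
  proof (cases "lookup m i = 0")
    case False
    then have "single i 1 + (m - single i 1) = m"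
      by (intro poly_mapping_eqI) (auto simp: lookup_add lookup_minus lookup_single when_def)
    then show ?thesis by (simp add: partial_deriv_single var_def mult_single)
  qed (simp add: partial_deriv_single)
  have sum_single: "(\<Sum>i\<in>A. single m (h i)) = single m (\<Sum>i\<in>A. h i)"
    for A and h :: "'v \<Rightarrow> complex" and m :: "'v \<Rightarrow>\<^sub>0 nat"
    by (induction A rule: infinite_finite_induct) (auto simp: single_add)
  have "(\<Sum>i\<in>UNIV. var i * partial_deriv i p) = (\<Sum>i\<in>UNIV. \<Sum>m\<in>keys p.
      var i * partial_deriv i (single m (lookup p m)))"
    by (subst poly_mapping_sum_single[of p]) (simp only: partial_deriv_sum sum_distrib_left)
  also have "\<dots> = (\<Sum>m\<in>keys p.
      single m ((\<Sum>i\<in>UNIV. of_nat (lookup m i)) * lookup p m))"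
    by (subst sum.swap) (simp add: single sum_single sum_distrib_right)
  also have "\<dots> = (\<Sum>m\<in>keys p.
      of_nat d * single m (lookup p m))"
  proof (rule sum.cong)
    fix m assume "m \<in> keys p"
    then have "(\<Sum>i\<in>UNIV. of_nat (lookup m i)) = (of_nat d :: complex)"
      using assms by (simp add: forms_mdeg mdeg_superset[of UNIV] flip: of_nat_sum)
    then show "single m ((\<Sum>i\<in>UNIV. of_nat (lookup m i)) *
        lookup p m) = of_nat d * single m (lookup p m)"
      by (simp add: mult_single flip: single_of_nat)
  qed simp
  also have "\<dots> = of_nat d * p"
    by (subst (3) poly_mapping_sum_single[of p]) (simp add: sum_distrib_left)
  finally show ?thesis .
qed

text \<open>The derivative is meant over the reals, but the formula for it is complex linear, which
  yields holomorphy later.\<close>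

lemma has_derivative_eval_mpoly:
  fixes p :: "'v::finite mpoly"
  shows "((\<lambda>x. eval_mpoly p (($) x)) has_derivative
    (\<lambda>v. \<Sum>i\<in>UNIV. eval_mpoly (partial_deriv i p) (($) x) *
      v $ i)) (at x within S)"
proof (induction p rule: mpoly_ring_induct)
  case (Const c)
  show ?case by simp
next
  case (var i)
  have "(\<Sum>j\<in>UNIV. eval_mpoly (partial_deriv j (var i)) (($) x) *
      v $ j) = v $ i" for v
    by (simp add: partial_deriv_var if_distrib[of "\<lambda>p. eval_mpoly p _"] if_distrib[of "\<lambda>c. c * _"]
        cong: if_cong)
  then show ?case
    by (simp add: bounded_linear_imp_has_derivative bounded_linear_vec_nth)
next
  case (add p q)
  from has_derivative_add[OF this] show ?case
    by (simp add: eval_mpoly.hom_add partial_deriv_add algebra_simps sum.distrib)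
next
  case (mult p q)
  from has_derivative_mult[OF this] show ?case
    by (simp add: eval_hom partial_deriv_mult algebra_simps
        sum.distrib sum_distrib_left)
qed

lemma continuous_on_eval_mpoly:
  fixes p :: "'v::finite mpoly"
  shows "continuous_on S (\<lambda>x. eval_mpoly p (($) x))"
  using has_derivative_eval_mpoly[THEN has_derivative_continuous]
  by (auto simp: continuous_on_eq_continuous_within)

section \<open>The Koszul complex\<close>

text \<open>The coefficients are indexed by \<open>A\<close> and not by the image, so that
  \<open>b\<close> may repeat a generator.\<close>

lemma span_image_finite:
  fixes scale :: "'a::comm_ring_1 \<Rightarrow> 'b::ab_group_add \<Rightarrow> 'b"
  assumes "Modules.module scale" "finite A"
  shows "module.span scale (b ` A) = range (\<lambda>u. \<Sum>i\<in>A. scale (u i) (b i))"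
proof
  interpret Modules.module scale by fact
  show "span (b ` A) \<subseteq> range (\<lambda>u. \<Sum>i\<in>A. scale (u i) (b i))"
  proof (rule span_minimal)
    show "b ` A \<subseteq> range (\<lambda>u. \<Sum>i\<in>A. scale (u i) (b i))"
    proof
      fix x assume "x \<in> b ` A"
      then obtain j where j: "j \<in> A" "x = b j" by auto
      then have "x = (\<Sum>i\<in>A. scale (if i = j then 1 else 0) (b i))"
        using assms by (simp add: if_distrib[of "\<lambda>c. scale c _"] cong: if_cong)
      then show "x \<in> range (\<lambda>u. \<Sum>i\<in>A. scale (u i) (b i))"
        by (rule range_eqI[of _ _ "\<lambda>i. if i = j then 1 else 0"])
    qed
    show "subspace (range (\<lambda>u. \<Sum>i\<in>A. scale (u i) (b i)))"
    proof (rule subspaceI)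
      show "0 \<in> range (\<lambda>u. \<Sum>i\<in>A. scale (u i) (b i))"
        by (rule range_eqI[of _ _ "\<lambda>i. 0"]) simp
    next
      fix x y assume "x \<in> range (\<lambda>u. \<Sum>i\<in>A. scale (u i) (b i))" "y \<in> range (\<lambda>u. \<Sum>i\<in>A. scale (u i) (b i))"
      then obtain u v where "x = (\<Sum>i\<in>A. scale (u i) (b i))" "y = (\<Sum>i\<in>A. scale (v i) (b i))" by auto
      then show "x + y \<in> range (\<lambda>u. \<Sum>i\<in>A. scale (u i) (b i))"
        by (intro range_eqI[of _ _ "\<lambda>i. u i + v i"]) (simp add: scale_left_distrib sum.distrib)
    next
      fix c x assume "x \<in> range (\<lambda>u. \<Sum>i\<in>A. scale (u i) (b i))"
      then obtain u where "x = (\<Sum>i\<in>A. scale (u i) (b i))" by auto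
      then show "scale c x \<in> range (\<lambda>u. \<Sum>i\<in>A. scale (u i) (b i))"
        by (intro range_eqI[of _ _ "\<lambda>i. c * u i"]) (simp add: scale_sum_right)
    qed
  qed
  show "range (\<lambda>u. \<Sum>i\<in>A. scale (u i) (b i)) \<subseteq> span (b ` A)"
    by (force intro: span_sum span_scale span_base)
qed

text \<open>An arbitrary linear order of the variables, which fixes the signs in the Koszul complex.\<close>

definition vidx :: "'v::finite \<Rightarrow> nat" where
  "vidx = (SOME f. bij_betw f UNIV {..<CARD('v)})"

lemma bij_vidx: "bij_betw (vidx :: 'v::finite \<Rightarrow> nat) UNIV {..<CARD('v)}"
proof -
  have "\<exists>f :: 'v \<Rightarrow> nat. bij_betw f UNIV {..<CARD('v)}"
    using ex_bij_betw_finite_nat[of "UNIV :: 'v set"] by (simp add: atLeast0LessThan)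
  then show ?thesis
    unfolding vidx_def by (rule someI_ex)
qed

lemma vidx_eq_iff [simp]: "vidx i = vidx j \<longleftrightarrow> i = j"
  using bij_vidx by (auto simp: bij_betw_def dest: injD)

lemma vidx_surj: "s < CARD('v) \<Longrightarrow> \<exists>i :: 'v::finite. vidx i = s"
  using bij_vidx[where 'v = 'v] by (metis bij_betw_def imageE lessThan_iff)

definition koszul_sign :: "'v::finite \<Rightarrow> 'v set \<Rightarrow> 'a::comm_ring_1" where
  "koszul_sign i A = (-1) ^ card {a\<in>A. vidx a < vidx i}"

text \<open>A function on sets of variables gives the coefficients of an element of the exterior
  algebra, with one basis vector e_A per set \<open>A\<close>. This is the interior product that
  sends e_i to \<open>h i\<close>, read off at e_A.\<close>

definition koszul :: "('v::finite \<Rightarrow> 'a::comm_ring_1) \<Rightarrow> ('v set \<Rightarrow> 'a) \<Rightarrow> 'v set \<Rightarrow> 'a" where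
  "koszul h c A = (\<Sum>i\<in>-A. koszul_sign i A * h i * c (insert i A))"

text \<open>Exterior multiplication by the basis vector e_j, in terms of coefficients.\<close>

definition koszul_homotopy :: "'v::finite \<Rightarrow> ('v set \<Rightarrow> 'a::comm_ring_1) \<Rightarrow> 'v set \<Rightarrow> 'a" where
  "koszul_homotopy j c A = (if j \<in> A then koszul_sign j (A - {j}) * c (A - {j}) else 0)"

lemma koszul_sign_empty [simp]: "koszul_sign i {} = 1"
  by (simp add: koszul_sign_def)

lemma koszul_sign_square [simp]: "koszul_sign i A * koszul_sign i A = 1"
  by (simp add: koszul_sign_def flip: power_add mult_2)

lemma koszul_sign_insert:
  assumes "j \<notin> A"
  shows "koszul_sign i (insert j A) = (if vidx j < vidx i then - koszul_sign i A else koszul_sign i A)"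
proof -
  have "{a \<in> insert j A. vidx a < vidx i} =
    (if vidx j < vidx i then insert j {a\<in>A. vidx a < vidx i} else {a\<in>A. vidx a < vidx i})"
    by auto
  then show ?thesis
    using assms by (simp add: koszul_sign_def)
qed

text \<open>In exactly one of the two orders of insertion, the index inserted first precedes the
  other one and flips its sign.\<close>

lemma koszul_sign_swap:
  assumes "i \<notin> A" "j \<notin> A" "i \<noteq> j"
  shows "koszul_sign i A * koszul_sign j (insert i A) =
    - (koszul_sign j A * koszul_sign i (insert j A) :: 'a::comm_ring_1)"
  using assms vidx_eq_iff[of i j] by (auto simp: koszul_sign_insert simp del: vidx_eq_iff)

lemma koszul_add: "koszul h (\<lambda>A. c A + c' A) A = koszul h c A + koszul h c' A"
  by (simp add: koszul_def algebra_simps sum.distrib)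

lemma koszul_mult: "koszul h (\<lambda>A. s * c A) A = s * koszul h c A"
  by (simp add: koszul_def sum_distrib_left algebra_simps)

lemma koszul_zero: "koszul h (\<lambda>A. 0) A = 0"
  by (simp add: koszul_def)

lemma koszul_sum: "koszul h (\<lambda>A. \<Sum>j\<in>J. c j A) A = (\<Sum>j\<in>J. koszul h (c j) A)"
  by (induction J rule: infinite_finite_induct) (auto simp: koszul_add koszul_zero)

text \<open>The terms of the double sum for (i, j) and (j, i) cancel. To pair them, the sum is split
  according to which index comes first, and one half is transposed.\<close>

lemma koszul_koszul:
  fixes c :: "'v::finite set \<Rightarrow> 'a::comm_ring_1"
  shows "koszul h (koszul h c) A = 0"
proof -
  define T where "T i j = koszul_sign i A * koszul_sign j (insert i A) * (h i * h j * c (insert i (insert j A)))"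
    for i j
  have "koszul h (koszul h c) A = (\<Sum>i\<in>-A. \<Sum>j\<in>-insert i A. T i j)"
    by (simp add: koszul_def T_def sum_distrib_left algebra_simps insert_commute)
  also have "\<dots> = (\<Sum>i\<in>-A. \<Sum>j\<in>-A. if vidx i < vidx j then T i j else 0) +
      (\<Sum>i\<in>-A. \<Sum>j\<in>-A. if vidx j < vidx i then T i j else 0)"
  proof -
    have "(\<Sum>j\<in>-insert i A. T i j) = (\<Sum>j\<in>-A. if vidx i < vidx j then T i j else 0) +
        (\<Sum>j\<in>-A. if vidx j < vidx i then T i j else 0)" if "i \<in> -A" for i
    proof -
      have "(\<Sum>j\<in>-insert i A. T i j) = (\<Sum>j\<in>-A. if j \<noteq> i then T i j else 0)"
        by (rule sum.mono_neutral_cong_left) auto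
      also have "\<dots> = (\<Sum>j\<in>-A. (if vidx i < vidx j then T i j else 0) +
          (if vidx j < vidx i then T i j else 0))"
      proof (rule sum.cong)
        fix j
        consider "j = i" | "vidx i < vidx j" | "vidx j < vidx i"
          by (metis linorder_neqE_nat vidx_eq_iff)
        then show "(if j \<noteq> i then T i j else 0) = (if vidx i < vidx j then T i j else 0) +
            (if vidx j < vidx i then T i j else 0)"
          by cases auto
      qed simp
      finally show ?thesis by (simp add: sum.distrib)
    qed
    then show ?thesis by (simp add: sum.distrib)
  qed
  also have "(\<Sum>i\<in>-A. \<Sum>j\<in>-A. if vidx j < vidx i then T i j else 0) =
      (\<Sum>i\<in>-A. \<Sum>j\<in>-A. if vidx i < vidx j then T j i else 0)"
    by (rule sum.swap)
  also have "\<dots> = (\<Sum>i\<in>-A. \<Sum>j\<in>-A. - (if vidx i < vidx j then T i j else 0))"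
  proof (intro sum.cong refl)
    fix i j assume "i \<in> -A" "j \<in> -A"
    then have "T j i = - T i j" if "j \<noteq> i"
      unfolding T_def using koszul_sign_swap[of j A i, where 'a = 'a] that
      by (simp add: insert_commute mult.commute[of "h j"])
    then show "(if vidx i < vidx j then T j i else 0) = - (if vidx i < vidx j then T i j else 0)"
      by auto
  qed
  finally show ?thesis by (simp add: sum_negf)
qed

text \<open>Interior and exterior product satisfy the graded product rule: applied in both orders,
  they add up to multiplication by \<open>h j\<close>. Hence every element of the ideal of the
  \<open>h j\<close> acts as zero on homology.\<close>

lemma koszul_homotopy:
  fixes c :: "'v::finite set \<Rightarrow> 'a::comm_ring_1"
  shows "koszul h (koszul_homotopy j c) A + koszul_homotopy j (koszul h c) A = h j * c A"
proof (cases "j \<in> A")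
  case False
  have "koszul h (koszul_homotopy j c) A =
      (\<Sum>i\<in>-A. if i = j then koszul_sign j A * h j * (koszul_sign j A * c A) else 0)"
    unfolding koszul_def using False
    by (intro sum.cong) (auto simp: koszul_homotopy_def)
  also have "\<dots> = (koszul_sign j A * koszul_sign j A) * h j * c A"
    using False by (simp add: algebra_simps del: koszul_sign_square)
  finally show ?thesis
    using False by (simp add: koszul_homotopy_def)
next
  case True
  define B where "B = A - {j}"
  have B: "A = insert j B" "j \<notin> B" using True by (auto simp: B_def)
  have "-B = insert j (-A)" using B by auto
  then have "koszul_homotopy j (koszul h c) A = koszul_sign j B * (koszul_sign j B * h j * c A +
      (\<Sum>i\<in>-A. koszul_sign i B * h i * c (insert i B)))"
    using True B by (simp add: koszul_homotopy_def koszul_def flip: B_def)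
  also have "\<dots> = (koszul_sign j B * koszul_sign j B) * (h j * c A) +
      (\<Sum>i\<in>-A. koszul_sign j B * koszul_sign i B * h i * c (insert i B))"
    by (simp add: algebra_simps sum_distrib_left del: koszul_sign_square)
  also have "(\<Sum>i\<in>-A. koszul_sign j B * koszul_sign i B * h i * c (insert i B)) =
      - koszul h (koszul_homotopy j c) A"
    unfolding koszul_def sum_negf[symmetric]
  proof (rule sum.cong)
    fix i assume i: "i \<in> -A"
    have eq: "koszul_sign i A * koszul_sign j (insert i B) = - (koszul_sign j B * koszul_sign i B :: 'a)"
      using i B vidx_eq_iff[of i j] by (auto simp: koszul_sign_insert simp del: vidx_eq_iff)
    have "insert i A - {j} = insert i B" using i B by auto
    then have "koszul_sign i A * h i * koszul_homotopy j c (insert i A) =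
        (koszul_sign i A * koszul_sign j (insert i B)) * h i * c (insert i B)"
      using True by (simp add: koszul_homotopy_def algebra_simps)
    then show "koszul_sign j B * koszul_sign i B * h i * c (insert i B) =
        - (koszul_sign i A * h i * koszul_homotopy j c (insert i A))"
      by (simp add: eq)
  qed simp
  finally show ?thesis by simp
qed

text \<open>Membership in the k-th exterior power. Keeping all degrees in one type allows the degree
  to change within an induction.\<close>

definition cochain :: "nat \<Rightarrow> ('v set \<Rightarrow> 'a::zero) \<Rightarrow> bool" where
  "cochain k c \<longleftrightarrow> (\<forall>A. card A \<noteq> k \<longrightarrow> c A = 0)"

lemma cochain_koszul:
  fixes c :: "'v::finite set \<Rightarrow> 'a::comm_ring_1"
  shows "cochain (Suc k) c \<Longrightarrow> cochain k (koszul h c)"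
  by (auto simp: cochain_def koszul_def intro!: sum.neutral)

lemma cochain_koszul_homotopy:
  fixes c :: "'v::finite set \<Rightarrow> 'a::comm_ring_1"
  shows "cochain k c \<Longrightarrow> cochain (Suc k) (koszul_homotopy j c)"
  unfolding cochain_def koszul_homotopy_def
  by (metis card_Suc_Diff1 finite mult_zero_right)

text \<open>If an ideal contains a regular sequence \<open>y\<close> as long as its list of generators \<open>h\<close>, then the
  Koszul complex of \<open>h\<close> is acyclic. Since \<open>y s\<close> acts on the homology as zero, a cycle modulo
  \<open>Q s\<close> lifts to a cycle modulo \<open>Q (Suc s)\<close> of one degree more, and so on, until the degree exceeds
  the number of generators.\<close>

lemma koszul_exact:
  fixes h :: "'v::finite \<Rightarrow> 'a::comm_ring_1" and y :: "nat \<Rightarrow> 'a" and Q :: "nat \<Rightarrow> 'a set"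
  assumes y: "\<And>s. s < CARD('v) \<Longrightarrow> y s \<in> module.span (*) (range h)"
    and Q0: "Q 0 = {0}"
    and Q_Suc: "\<And>s. s < CARD('v) \<Longrightarrow> Q (Suc s) = {q + y s * u |q u. q \<in> Q s}"
    and regular: "\<And>s u. s < CARD('v) \<Longrightarrow> y s * u \<in> Q s \<Longrightarrow> u \<in> Q s"
    and z: "cochain k z" "0 < k" "\<And>A. koszul h z A = 0"
  shows "\<exists>w. cochain (Suc k) w \<and> z = koszul h w"
proof -
  have ideal: "0 \<in> Q s \<and> (\<forall>a\<in>Q s. \<forall>b\<in>Q s. a + b \<in> Q s) \<and> (\<forall>a\<in>Q s. \<forall>r. r * a \<in> Q s)"
    if "s \<le> CARD('v)" for s
    using that
  proof (induction s)
    case (Suc s)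
    then have IH: "0 \<in> Q s" "\<And>a b. a \<in> Q s \<Longrightarrow> b \<in> Q s \<Longrightarrow> a + b \<in> Q s"
      "\<And>a r. a \<in> Q s \<Longrightarrow> r * a \<in> Q s" by auto
    have "0 = 0 + y s * 0" by simp
    then have "0 \<in> {q + y s * u |q u. q \<in> Q s}" using IH(1) by blast
    moreover have "(q + y s * u) + (q' + y s * u') \<in> {q + y s * u |q u. q \<in> Q s}"
      if "q \<in> Q s" "q' \<in> Q s" for q q' u u'
    proof -
      have "(q + y s * u) + (q' + y s * u') = (q + q') + y s * (u + u')"
        by (simp add: algebra_simps)
      then show ?thesis using IH(2)[OF that] by blast
    qed
    moreover have "r * (q + y s * u) \<in> {q + y s * u |q u. q \<in> Q s}" if "q \<in> Q s" for q u r
    proof -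
      have "r * (q + y s * u) = r * q + y s * (r * u)"
        by (simp add: algebra_simps)
      then show ?thesis using IH(3)[OF that] by blast
    qed
    moreover have "Q (Suc s) = {q + y s * u |q u. q \<in> Q s}"
      using Suc.prems by (intro Q_Suc) simp
    ultimately show ?case by (simp only:) blast
  qed (simp add: Q0)
  have sum_Q: "(\<Sum>i\<in>I. c i) \<in> Q s" if "s \<le> CARD('v)" "\<And>i. i \<in> I \<Longrightarrow> c i \<in> Q s"
    for s and I :: "'v set" and c
    using that ideal by (induction I rule: infinite_finite_induct) auto
  have koszul_Q: "koszul h c A \<in> Q s" if "s \<le> CARD('v)" "\<And>A. c A \<in> Q s" for s c A
    unfolding koszul_def using that ideal by (intro sum_Q) auto
  have homotopy_Q: "koszul_homotopy j c A \<in> Q s" if "s \<le> CARD('v)" "\<And>A. c A \<in> Q s" for s c A j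
    unfolding koszul_homotopy_def using that ideal by auto
  \<comment> \<open>Downward induction on s for all degrees above s: at \<open>CARD('v)\<close> no
    set has that many elements, and at 0 the bound is the hypothesis that the degree is
    positive.\<close>
  have "\<forall>k z. s < k \<longrightarrow> cochain k z \<longrightarrow> (\<forall>A. koszul h z A \<in> Q s) \<longrightarrow>
      (\<exists>w. cochain (Suc k) w \<and> (\<forall>A. z A - koszul h w A \<in> Q s))" if "s \<le> CARD('v)" for s
    using that
  proof (induction rule: inc_induct)
    case base
    show ?case
    proof (intro allI impI)
      fix k and z :: "'v set \<Rightarrow> 'a" assume *: "CARD('v) < k" "cochain k z"
      have "card A \<noteq> k" for A :: "'v set"
        using card_mono[of UNIV A] *(1) by auto
      then have "z A = 0" for A using *(2) by (auto simp: cochain_def)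
      then show "\<exists>w. cochain (Suc k) w \<and> (\<forall>A. z A - koszul h w A \<in> Q CARD('v))"
        using ideal by (intro exI[of _ "\<lambda>A. 0"]) (auto simp: cochain_def koszul_zero)
    qed
  next
    case (step s)
    have s: "s < CARD('v)" "s \<le> CARD('v)" using step by auto
    note Q_add = ideal[OF s(2), THEN conjunct2, THEN conjunct1, rule_format]
      and Q_mult = ideal[OF s(2), THEN conjunct2, THEN conjunct2, rule_format]
      and Q_0 = ideal[OF s(2), THEN conjunct1]
    obtain a where a: "y s = (\<Sum>j\<in>UNIV. a j * h j)"
      using y[OF s(1)] span_image_finite[OF module_mult, of UNIV h] by auto
    show ?case
    proof (intro allI impI)
      fix k and z :: "'v set \<Rightarrow> 'a"
      assume z: "s < k" "cochain k z" "\<forall>A. koszul h z A \<in> Q s"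
      \<comment> \<open>The homotopies are combined with the coefficients that express
        \<open>y s\<close> through the \<open>h j\<close>. The boundary of \<open>w\<close> is then
        \<open>y s * z\<close> up to \<open>r\<close>, which lies in \<open>Q s\<close> because the
        boundary of \<open>z\<close> does.\<close>
      define w where "w A = (\<Sum>j\<in>UNIV. a j * koszul_homotopy j z A)" for A
      define r where "r A = (\<Sum>j\<in>UNIV. a j * koszul_homotopy j (koszul h z) A)" for A
      have w: "cochain (Suc k) w"
        using cochain_koszul_homotopy[OF z(2)] by (auto simp: cochain_def w_def)
      have r: "r A \<in> Q s" for A
        unfolding r_def using z(3) by (intro sum_Q Q_mult homotopy_Q s) auto
      have dw: "koszul h w A + r A = y s * z A" for A
      proof -
        have "koszul h w A + r A = (\<Sum>j\<in>UNIV. a j * (koszul h (koszul_homotopy j z) A +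
            koszul_homotopy j (koszul h z) A))"
          unfolding w_def[abs_def] r_def
          by (simp add: koszul_sum koszul_mult sum.distrib distrib_left)
        also have "\<dots> = y s * z A"
          by (simp add: koszul_homotopy a sum_distrib_right mult.assoc)
        finally show ?thesis .
      qed
      have "koszul h w A \<in> Q (Suc s)" for A
      proof -
        have "koszul h w A = (-1) * r A + y s * z A"
          by (simp flip: dw)
        then show ?thesis using Q_mult[OF r] Q_Suc[OF s(1)] by blast
      qed
      then obtain v where v: "cochain (Suc (Suc k)) v" "\<And>A. w A - koszul h v A \<in> Q (Suc s)"
        using step.IH w z(1) by (metis Suc_mono)
      then have "\<exists>q u. q \<in> Q s \<and> w A - koszul h v A = q + y s * u" for A
        using Q_Suc[OF s(1)] by blast
      then obtain q u where qu: "\<And>A. q A \<in> Q s" "\<And>A. w A - koszul h v A = q A + y s * u A"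
        by metis
      \<comment> \<open>\<open>q\<close> and \<open>u\<close> were chosen separately for every set.
        Cutting them off outside degree \<open>Suc k\<close> makes \<open>u'\<close> a cochain and
        keeps the equation, since \<open>w\<close> and the boundary of \<open>v\<close> vanish
        there.\<close>
      define q' u' where "q' A = (if card A = Suc k then q A else 0)"
        and "u' A = (if card A = Suc k then u A else 0)" for A
      have q': "q' A \<in> Q s" for A using qu(1) Q_0 by (simp add: q'_def)
      have w_eq: "w A = koszul h v A + (q' A + y s * u' A)" for A
      proof (cases "card A = Suc k")
        case True
        then show ?thesis using qu(2)[of A] by (simp add: q'_def u'_def algebra_simps)
      next
        case False
        then show ?thesis
          using w cochain_koszul[OF v(1), of h] by (simp add: cochain_def q'_def u'_def)
      qed
      have "y s * (z A - koszul h u' A) \<in> Q s" for A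
      proof -
        \<comment> \<open>The boundary of \<open>v\<close> is killed by the differential. Comparing
          with \<open>dw\<close> puts \<open>y s\<close> times the difference of \<open>z\<close>
          and the boundary of \<open>u'\<close> into \<open>Q s\<close>, and regularity cancels
          \<open>y s\<close>.\<close>
        have "koszul h w A = koszul h q' A + y s * koszul h u' A"
          by (subst w_eq[abs_def]) (simp add: koszul_add koszul_koszul koszul_mult)
        then have "y s * (z A - koszul h u' A) = r A + koszul h q' A"
          using dw[of A] by (simp add: algebra_simps)
        then show ?thesis
          using Q_add[OF r koszul_Q[OF s(2) q']] by simp
      qed
      then show "\<exists>w. cochain (Suc k) w \<and> (\<forall>A. z A - koszul h w A \<in> Q s)"
        using regular[OF s(1)] by (intro exI[of _ u']) (auto simp: cochain_def u'_def)
    qed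
  qed
  from this[of 0] show ?thesis
    using z by (auto simp: Q0 fun_eq_iff)
qed

section \<open>Powers of the variables as a regular sequence\<close>

lemma keys_var_power_mult:
  "keys (var i ^ M * p) \<subseteq> (+) (single i M) ` keys p"
proof -
  have "var i ^ M = single (single i M) (1 :: complex)"
    by (metis mon_single mon_var)
  then show ?thesis
    using keys_mult[of "var i ^ M" p] by auto
qed

text \<open>\<open>Q s\<close> is the monomial ideal of the first s powers. Membership in it is
  decided monomial by monomial, so that regularity becomes a statement on exponents.\<close>

lemma koszul_exact_mpoly:
  fixes h :: "'v::finite \<Rightarrow> 'v mpoly"
  assumes h: "\<And>i. var i ^ M \<in> module.span (*) (range h)"
    and z: "cochain k z" "0 < k" "\<And>A. koszul h z A = 0"
  shows "\<exists>w. cochain (Suc k) w \<and> z = koszul h w"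
proof -
  define v :: "nat \<Rightarrow> 'v" where "v = inv_into UNIV vidx"
  have v: "vidx (v s) = s" if "s < CARD('v)" for s
    unfolding v_def using vidx_surj[OF that] by (auto intro: f_inv_into_f)
  define Q :: "nat \<Rightarrow> 'v mpoly set" where
    "Q s = {p. \<forall>m\<in>keys p. \<exists>i. vidx i < s \<and> M \<le> lookup m i}" for s
  have Q_add: "p + q \<in> Q s" if "p \<in> Q s" "q \<in> Q s" for p q s
    using that Poly_Mapping.keys_add[of p q] unfolding Q_def by blast
  have Q_0: "0 \<in> Q s" for s
    by (simp add: Q_def)
  have Q_sum: "(\<Sum>m\<in>I. p m) \<in> Q s" if "\<And>m. m \<in> I \<Longrightarrow> p m \<in> Q s" for I :: "('v \<Rightarrow>\<^sub>0 nat) set" and p s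
    using that by (induction I rule: infinite_finite_induct) (auto intro: Q_add simp: Q_0)
  show ?thesis
  proof (rule koszul_exact[where y = "\<lambda>s. var (v s) ^ M" and Q = Q])
    show "Q 0 = {0}"
      by (auto simp: Q_def)
  next
    fix s assume s: "s < CARD('v)"
    let ?E = "single (v s) M"
    have y: "var (v s) ^ M = single ?E (1 :: complex)"
      by (metis mon_single mon_var)
    show "Q (Suc s) = {q + var (v s) ^ M * u |q u. q \<in> Q s}"
    proof (intro subset_antisym subsetI)
      fix p assume p: "p \<in> Q (Suc s)"
      \<comment> \<open>Monomials divisible by the new power are collected in \<open>u\<close>,
        after division; each of the others is divisible by an earlier power.\<close>
      let ?K = "keys p \<inter> {m. M \<le> lookup m (v s)}"
      define u where "u = (\<Sum>m\<in>?K. single (m - ?E) (lookup p m))"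
      define q where "q = (\<Sum>m\<in>keys p - ?K. single m (lookup p m))"
      have "var (v s) ^ M * u = (\<Sum>m\<in>?K. single m (lookup p m))"
        unfolding u_def y sum_distrib_left
      proof (rule sum.cong)
        fix m assume "m \<in> ?K"
        then have "?E + (m - ?E) = m"
          by (intro poly_mapping_eqI) (auto simp: lookup_add lookup_minus lookup_single when_def)
        then show "single ?E 1 * single (m - ?E) (lookup p m) =
            single m (lookup p m)"
          by (simp add: mult_single)
      qed simp
      then have "p = q + var (v s) ^ M * u"
        unfolding q_def using sum.subset_diff[of ?K "keys p"
            "\<lambda>m. single m (lookup p m)"]
        by (simp flip: poly_mapping_sum_single)
      moreover have "q \<in> Q s"
        unfolding q_def
      proof (rule Q_sum)
        fix m assume m: "m \<in> keys p - ?K"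
        then obtain i where i: "vidx i < Suc s" "M \<le> lookup m i"
          using p by (auto simp: Q_def)
        with m v[OF s] have "vidx i \<noteq> s" by auto
        then show "single m (lookup p m) \<in> Q s"
          using i by (auto simp: Q_def less_Suc_eq)
      qed
      ultimately show "p \<in> {q + var (v s) ^ M * u |q u. q \<in> Q s}" by blast
    next
      fix p assume "p \<in> {q + var (v s) ^ M * u |q u. q \<in> Q s}"
      then obtain q u where p: "p = q + var (v s) ^ M * u" "q \<in> Q s" by blast
      have "var (v s) ^ M * u \<in> Q (Suc s)"
        unfolding Q_def
      proof (intro CollectI ballI)
        fix m assume "m \<in> keys (var (v s) ^ M * u)"
        then obtain m' where "m = ?E + m'"
          using keys_var_power_mult[of "v s" M u] by auto
        then show "\<exists>i. vidx i < Suc s \<and> M \<le> lookup m i"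
          using v[OF s] by (intro exI[of _ "v s"]) (simp add: lookup_add)
      qed
      moreover have "q \<in> Q (Suc s)"
        using p(2) by (auto simp: Q_def intro: less_SucI)
      ultimately show "p \<in> Q (Suc s)"
        unfolding p(1) by (rule Q_add[rotated])
    qed
    fix u assume u: "var (v s) ^ M * u \<in> Q s"
    show "u \<in> Q s"
      unfolding Q_def
    proof (intro CollectI ballI)
      fix m assume m: "m \<in> keys u"
      have "lookup (var (v s) ^ M * u) (?E + m) = lookup u m"
      proof (induction u rule: single_add_induct)
        case (single m' c)
        then show ?case by (simp add: y mult_single lookup_single when_def)
      qed (simp_all add: distrib_left lookup_add)
      with m have "?E + m \<in> keys (var (v s) ^ M * u)"
        by (simp add: in_keys_iff)
      then obtain i where i: "vidx i < s" "M \<le> lookup (?E + m) i"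
        using u by (auto simp: Q_def)
      \<comment> \<open>The factor changes only the exponent at \<open>v s\<close>, so the
        divisibility by an earlier power already holds for \<open>m\<close>.\<close>
      then have "i \<noteq> v s" using v[OF s] by auto
      with i show "\<exists>i. vidx i < s \<and> M \<le> lookup m i"
        by (auto simp: lookup_add lookup_single when_def)
    qed
  qed (use h z in auto)
qed

section \<open>Hilbert's Nullstellensatz for forms\<close>

lemmas ideal_0 = module.subspace_0[OF module_mult]
  and ideal_add = module.subspace_add[OF module_mult]
  and ideal_mult = module.subspace_scale[OF module_mult]
  and ideal_diff = module.subspace_diff[OF module_mult]
  and ideal_sum = module.subspace_sum[OF module_mult]
  and ideal_span = module.subspace_span[OF module_mult]

lemma ideal_adjoin:
  assumes "module.subspace (*) I"
  shows "module.subspace (*) {a + b * y |a b. a \<in> I}"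
proof (rule module.subspaceI[OF module_mult])
  have "0 = 0 + 0 * y" by simp
  then show "0 \<in> {a + b * y |a b. a \<in> I}"
    using ideal_0[OF assms] by blast
next
  fix p q assume "p \<in> {a + b * y |a b. a \<in> I}" "q \<in> {a + b * y |a b. a \<in> I}"
  then obtain a b a' b' where "p = a + b * y" "q = a' + b' * y" "a \<in> I" "a' \<in> I" by auto
  then show "p + q \<in> {a + b * y |a b. a \<in> I}"
    using ideal_add[OF assms]
    by (intro CollectI exI[of _ "a + a'"] exI[of _ "b + b'"]) (auto simp: algebra_simps)
next
  fix r p assume "p \<in> {a + b * y |a b. a \<in> I}"
  then obtain a b where "p = a + b * y" "a \<in> I" by auto
  then show "r * p \<in> {a + b * y |a b. a \<in> I}"
    using ideal_mult[OF assms]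
    by (intro CollectI exI[of _ "r * a"] exI[of _ "r * b"]) (auto simp: algebra_simps)
qed

lemma ideal_adjoin_superset: "I \<subseteq> {a + b * y |a b. a \<in> I}" for y :: "'a::comm_ring_1"
proof
  fix a assume "a \<in> I"
  moreover have "a = a + 0 * y" by simp
  ultimately show "a \<in> {a + b * y |a b. a \<in> I}" by blast
qed

lemma ideal_adjoin_self:
  assumes "module.subspace (*) I"
  shows "y \<in> {a + b * y |a b. a \<in> I}"
proof -
  have "y = 0 + 1 * y" by simp
  then show ?thesis using ideal_0[OF assms] by blast
qed

lemma finite_mdeg_le: "finite {m :: 'v::finite \<Rightarrow>\<^sub>0 nat. mdeg m \<le> d}"
proof (rule finite_imageD)
  have "lookup ` {m. mdeg m \<le> d} \<subseteq> Pi\<^sub>E (UNIV :: 'v set) (\<lambda>_. {..d})"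
    by (auto intro!: order_trans[OF mdeg_ge_lookup])
  then show "finite (lookup ` {m :: 'v \<Rightarrow>\<^sub>0 nat. mdeg m \<le> d})"
    by (rule finite_subset) (simp add: finite_PiE)
  show "inj_on lookup {m :: 'v \<Rightarrow>\<^sub>0 nat. mdeg m \<le> d}"
    by (simp add: inj_on_def)
qed

lemma vector_space_Const: "vector_space (\<lambda>c p. Const c * p :: 'v mpoly)"
  by unfold_locales (simp_all add: distrib_left distrib_right single_add mult_single flip: mult.assoc)

text \<open>The polynomials of degree at most d form a finite-dimensional space. By injectivity the
  relation can be indexed by \<open>C\<close> instead of by vectors.\<close>

lemma mpoly_infinite_dependent:
  fixes q :: "'a \<Rightarrow> 'v::finite mpoly"
  assumes "infinite C" "inj_on q C" "\<And>c m. c \<in> C \<Longrightarrow> m \<in> keys (q c) \<Longrightarrow> mdeg m \<le> d"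
  shows "\<exists>F u. finite F \<and> F \<subseteq> C \<and> (\<Sum>c\<in>F. Const (u c) * q c) = 0 \<and> (\<exists>c\<in>F. u c \<noteq> 0)"
proof -
  interpret vector_space "\<lambda>c p. Const c * p :: 'v mpoly"
    by (rule vector_space_Const)
  let ?T = "(\<lambda>m. single m 1) ` {m. mdeg m \<le> d}"
  have "q c \<in> span ?T" if "c \<in> C" for c
  proof -
    have "q c = (\<Sum>m\<in>keys (q c). Const (lookup (q c) m) * single m 1)"
      by (subst poly_mapping_sum_single) (simp add: mult_single)
    also have "\<dots> \<in> span ?T"
      using assms(3)[OF that] by (intro span_sum span_scale span_base) auto
    finally show ?thesis .
  qed
  moreover have "infinite (q ` C)"
    using assms(1,2) by (simp add: finite_image_iff)
  ultimately have "dependent (q ` C)"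
    using independent_span_bound[of ?T "q ` C"] finite_mdeg_le by blast
  then obtain t u where t: "finite t" "t \<subseteq> q ` C" "(\<Sum>v\<in>t. Const (u v) * v) = 0" "\<exists>v\<in>t. u v \<noteq> 0"
    unfolding dependent_explicit by blast
  then obtain F where F: "F \<subseteq> C" "finite F" "t = q ` F"
    by (meson finite_subset_image)
  have "inj_on q F" using F(1) assms(2) by (rule inj_on_subset[rotated])
  then have "(\<Sum>c\<in>F. Const (u (q c)) * q c) = 0"
    using t(3) F(3) by (simp add: sum.reindex)
  then show ?thesis
    using t(4) F by (intro exI[of _ F] exI[of _ "\<lambda>c. u (q c)"]) auto
qed

text \<open>If \<open>y - c\<close> is invertible modulo \<open>I\<close> for all \<open>c\<close>, then the inverses of uncountably many
  \<open>y - c\<close> are linearly dependent, since the polynomials have countable dimension. Clearing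
  denominators yields a polynomial relation for \<open>y\<close>, whose linear factors are units.\<close>

lemma ideal_adjoin_proper:
  fixes I :: "'v::finite mpoly set"
  assumes I: "module.subspace (*) I" "1 \<notin> I"
  shows "\<exists>c. 1 \<notin> {a + b * (y - Const c) |a b. a \<in> I}"
proof (rule ccontr)
  assume "\<not> ?thesis"
  then have "\<exists>a q. a \<in> I \<and> 1 = a + q * (y - Const c)" for c by blast
  then obtain a q where aq: "\<And>c. a c \<in> I" "\<And>c. 1 = a c + q c * (y - Const c)" by metis
  interpret pe: comm_ring_hom "\<lambda>R. poly (map_poly Const R) y"
  proof -
    interpret map_poly_comm_ring_hom "Const :: complex \<Rightarrow> 'v mpoly"
      using comm_ring_hom_Const by (simp add: map_poly_comm_ring_hom_def)
    show "comm_ring_hom (\<lambda>R. poly (map_poly Const R) y)"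
      by (rule comm_ring_hom_comp) unfold_locales
  qed
  have pe_linear: "poly (map_poly Const [:- c, 1:]) y = y - Const c" for c
    by (simp add: map_poly_pCons single_uminus)
  have pe_const: "poly (map_poly Const [:c:]) y = Const c" for c
    by (cases "c = 0") (simp_all add: map_poly_pCons)
  \<comment> \<open>That is, \<open>y\<close> is transcendental modulo \<open>I\<close>:
    \<open>R\<close> splits over the complex numbers, and each factor \<open>y - Const r\<close> can
    be cancelled with its inverse \<open>q r\<close> until a constant remains, which must be 0 as
    \<open>I\<close> is proper.\<close>
  have "R = 0" if "poly (map_poly Const R) y \<in> I" for R
    using that
  proof (induction "degree R" arbitrary: R rule: less_induct)
    case less
    show "R = 0"
    proof (cases "degree R = 0")
      case True
      then obtain c where R: "R = [:c:]" by (rule degree_eq_zeroE)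
      show ?thesis
      proof (rule ccontr)
        assume "R \<noteq> 0"
        then have "Const (inverse c) * Const c = (1 :: 'v mpoly)"
          using R by (simp add: mult_single)
        moreover have "Const c \<in> I"
          using less.prems R by (simp add: pe_const)
        ultimately show False
          using ideal_mult[OF I(1)] I(2) by metis
      qed
    next
      case False
      then obtain r where "poly R r = 0"
        using fundamental_theorem_of_algebra[of R] by (auto simp: constant_degree)
      then obtain S where S: "R = [:-r, 1:] * S"
        by (auto simp: poly_eq_0_iff_dvd elim: dvdE)
      have "poly (map_poly Const S) y =
          a r * poly (map_poly Const S) y + q r * ((y - Const r) * poly (map_poly Const S) y)"
        by (subst mult_1_left[symmetric], subst aq(2)[of r]) (simp add: algebra_simps)
      also have "\<dots> = poly (map_poly Const S) y * a r + q r * poly (map_poly Const R) y"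
        by (simp only: S pe.hom_mult pe_linear mult.commute)
      also have "\<dots> \<in> I"
        using less.prems aq(1) by (intro ideal_add[OF I(1)] ideal_mult[OF I(1)])
      finally have "S = 0"
      proof (rule less.hyps[rotated])
        have "S \<noteq> 0" using False S by auto
        then have "degree ([:-r, 1:] * S) = Suc (degree S)"
          by (subst degree_mult_eq) auto
        then show "degree S < degree R" unfolding S by simp
      qed
      then show ?thesis using S by simp
    qed
  qed
  note relation = this
  \<comment> \<open>If \<open>y - Const c\<close> and \<open>y - Const d\<close> had the same
    inverse modulo \<open>I\<close>, subtracting the two equations would put a nonzero multiple of
    \<open>q c\<close> into \<open>I\<close>, hence \<open>q c\<close> and then 1.\<close>
  have inj: "inj q"
  proof (rule injI, rule ccontr)
    fix c d assume "q c = q d" "c \<noteq> d"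
    have inv: "Const (c - d) * Const (inverse (c - d)) = (1 :: 'v mpoly)"
      using \<open>c \<noteq> d\<close> by (simp add: mult_single)
    have *: "q c * Const (c - d) = a c - a d"
    proof -
      have "a c + q c * (y - Const c) = a d + q c * (y - Const d)"
        by (metis aq(2) \<open>q c = q d\<close>)
      then show ?thesis by (simp add: single_diff algebra_simps)
    qed
    have "q c = q c * Const (c - d) * Const (inverse (c - d))"
      by (simp only: inv mult.assoc mult_1_right)
    also have "\<dots> = Const (inverse (c - d)) * (a c - a d)"
      by (simp only: * mult.commute)
    finally have "q c \<in> I"
      using ideal_mult[OF I(1) ideal_diff[OF I(1) aq(1) aq(1)]] by simp
    then have "a c + (y - Const c) * q c \<in> I"
      by (intro ideal_add[OF I(1)] ideal_mult[OF I(1)] aq(1))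
    then have "1 \<in> I"
      by (subst aq(2)[of c]) (simp only: mult.commute)
    then show False using I(2) by simp
  qed
  \<comment> \<open>Countably many sets \<open>C d\<close> cover the uncountable set of complex
    numbers, so one of them is infinite; there the inverses have bounded degree.\<close>
  define C where "C d = {c. \<forall>m\<in>keys (q c). mdeg m \<le> d}" for d
  have "c \<in> (\<Union>d. C d)" for c
    by (auto simp: C_def intro!: exI[of _ "Max (mdeg ` keys (q c))"])
  then have "(\<Union>d. C d) = UNIV" by blast
  moreover have "countable (\<Union>d. C d)" if "\<And>d. finite (C d)"
    using that by (simp add: countable_finite)
  ultimately obtain d where "infinite (C d)"
    using uncountable_UNIV_complex by metis
  moreover have "inj_on q (C d)"
    using inj by (rule inj_on_subset) simp
  moreover have "mdeg m \<le> d" if "c \<in> C d" "m \<in> keys (q c)" for c m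
    using that by (simp add: C_def)
  ultimately obtain F u where F: "finite F" "(\<Sum>c\<in>F. Const (u c) * q c) = 0" "\<exists>c\<in>F. u c \<noteq> 0"
    using mpoly_infinite_dependent[of "C d" q d] by blast
  \<comment> \<open>The numerator of the sum of the fractions u(c) / (X - c) over their common
    denominator. At \<open>y\<close> it agrees modulo \<open>I\<close> with the linear relation of
    the inverses times that denominator.\<close>
  define R where "R = (\<Sum>c\<in>F. Polynomial.smult (u c) (\<Prod>b\<in>F - {c}. [:-b, 1:]))"
  have "poly (map_poly Const R) y \<in> I"
  proof -
    let ?P = "\<lambda>B. \<Prod>b\<in>B. (y - Const b)"
    have pe_smult: "poly (map_poly Const (Polynomial.smult c R)) y = Const c * poly (map_poly Const R) y" for c R
      using pe.hom_mult[of "[:c:]" R] by (simp add: pe_const)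
    have "poly (map_poly Const R) y = (\<Sum>c\<in>F. Const (u c) * ?P (F - {c}))"
      unfolding R_def by (simp only: pe.hom_sum pe_smult pe.hom_prod pe_linear)
    also have "\<dots> = (\<Sum>c\<in>F. Const (u c) * (?P (F - {c}) * a c + q c * ?P F))"
    proof (rule sum.cong)
      fix c assume "c \<in> F"
      then have P: "?P F = (y - Const c) * ?P (F - {c})"
        using F(1) by (simp add: prod.remove)
      have "?P (F - {c}) * a c + q c * ?P F = ?P (F - {c}) * (a c + q c * (y - Const c))"
        unfolding P by (simp add: algebra_simps)
      then show "Const (u c) * ?P (F - {c}) = Const (u c) * (?P (F - {c}) * a c + q c * ?P F)"
        by (simp flip: aq(2))
    qed simp
    also have "\<dots> = (\<Sum>c\<in>F. Const (u c) * (?P (F - {c}) * a c)) + (\<Sum>c\<in>F. Const (u c) * q c) * ?P F"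
      by (simp add: sum.distrib sum_distrib_right distrib_left mult.assoc)
    also have "\<dots> \<in> I"
      using aq(1) F(2) by (simp add: ideal_sum[OF I(1)] ideal_mult[OF I(1)])
    finally show ?thesis .
  qed
  then have "R = 0" by (rule relation)
  obtain c where c: "c \<in> F" "u c \<noteq> 0" using F(3) by blast
  \<comment> \<open>At a point \<open>c\<close> with nonzero coefficient all other summands contain
    the factor \<open>c - c\<close>, so only one term survives and \<open>R\<close> is not
    zero.\<close>
  have "poly R c = (\<Sum>d\<in>F. u d * (\<Prod>b\<in>F - {d}. c - b))"
    by (simp add: R_def poly_sum poly_prod)
  also have "\<dots> = (\<Sum>d\<in>F. if d = c then u c * (\<Prod>b\<in>F - {c}. c - b) else 0)"
    using F(1) c(1) by (intro sum.cong) (auto simp: prod_zero_iff)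
  also have "\<dots> \<noteq> 0"
    using F(1) c by (auto simp: prod_zero_iff)
  finally show False using \<open>R = 0\<close> by simp
qed

text \<open>The differences \<open>var i - Const (p i)\<close> are adjoined one variable at a time
  while the ideal stays proper. Modulo the final ideal each polynomial equals its value at
  \<open>p\<close>, so a nonzero value on \<open>I\<close> would give a unit in it.\<close>

theorem weak_nullstellensatz:
  fixes I :: "'v::finite mpoly set"
  assumes I: "module.subspace (*) I" "1 \<notin> I"
  shows "\<exists>p. \<forall>f\<in>I. eval_mpoly f p = 0"
proof -
  have "\<exists>J p. I \<subseteq> J \<and> module.subspace (*) J \<and> 1 \<notin> J \<and> (\<forall>i\<in>X. var i - Const (p i) \<in> J)" for X :: "'v set"
    using finite[of X]
  proof (induction X)
    case empty
    show ?case using I by blast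
  next
    case (insert i X)
    then obtain J p where J: "I \<subseteq> J" "module.subspace (*) J" "1 \<notin> J" "\<forall>i\<in>X. var i - Const (p i) \<in> J"
      by blast
    obtain c where c: "1 \<notin> {a + b * (var i - Const c) |a b. a \<in> J}"
      using ideal_adjoin_proper[OF J(2,3)] by blast
    let ?J = "{a + b * (var i - Const c) |a b. a \<in> J}"
    have "J \<subseteq> ?J" by (rule ideal_adjoin_superset)
    moreover have "var i - Const c \<in> ?J" by (rule ideal_adjoin_self[OF J(2)])
    ultimately show ?case
      using J insert.hyps c ideal_adjoin[OF J(2)]
      by (intro exI[of _ ?J] exI[of _ "p(i := c)"]) (auto simp del: mem_Collect_eq)
  qed
  from this[of UNIV] obtain J p where J: "I \<subseteq> J" "module.subspace (*) J" "1 \<notin> J"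
    "\<And>i. var i - Const (p i) \<in> J" by auto
  have eval: "f - Const (eval_mpoly f p) \<in> J" for f
  proof (induction f rule: mpoly_ring_induct)
    case (Const c)
    show ?case using ideal_0[OF J(2)] by simp
  next
    case (var i)
    show ?case using J(4) by simp
  next
    case (add f g)
    from ideal_add[OF J(2) this] show ?case
      by (simp add: eval_mpoly.hom_add single_add algebra_simps)
  next
    case (mult f g)
    have "f * g - Const (eval_mpoly (f * g) p) =
        g * (f - Const (eval_mpoly f p)) + Const (eval_mpoly f p) * (g - Const (eval_mpoly g p))"
      by (simp add: eval_mpoly.hom_mult algebra_simps mult_single)
    then show ?case
      using ideal_add[OF J(2) ideal_mult[OF J(2) mult(1)] ideal_mult[OF J(2) mult(2)]] by simp
  qed
  have "eval_mpoly f p = 0" if "f \<in> I" for f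
  proof (rule ccontr)
    assume nz: "eval_mpoly f p \<noteq> 0"
    have "Const (eval_mpoly f p) \<in> J"
      using ideal_diff[OF J(2) _ eval[of f], of f] that J(1) by auto
    from ideal_mult[OF J(2) this, of "Const (inverse (eval_mpoly f p))"] show False
      using nz J(3) by (simp add: mult_single)
  qed
  then show ?thesis by blast
qed

section \<open>Homogeneous components\<close>

definition hcomp :: "nat \<Rightarrow> 'v mpoly \<Rightarrow> 'v mpoly" where
  "hcomp d p = (\<Sum>m\<in>keys p. single m (lookup p m when mdeg m = d))"

lemma lookup_hcomp: "lookup (hcomp d p) m = (lookup p m when mdeg m = d)"
  unfolding hcomp_def lookup_sum lookup_single
  by (cases "m \<in> keys p") (auto simp: when_def in_keys_iff)

lemma hcomp_add: "hcomp d (p + q) = hcomp d p + hcomp d q"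
  by (rule poly_mapping_eqI) (simp add: lookup_hcomp lookup_add when_def)

lemma hcomp_0 [simp]: "hcomp d 0 = 0"
  by (rule poly_mapping_eqI) (simp add: lookup_hcomp)

lemma hcomp_diff: "hcomp d (p - q) = hcomp d p - hcomp d q"
  by (rule poly_mapping_eqI) (simp add: lookup_hcomp lookup_minus when_def)

lemma hcomp_sum: "hcomp d (\<Sum>i\<in>A. p i) = (\<Sum>i\<in>A. hcomp d (p i))"
  by (induction A rule: infinite_finite_induct) (auto simp: hcomp_add)

lemma hcomp_form: "p \<in> forms e \<Longrightarrow> hcomp d p = (if d = e then p else 0)"
  by (rule poly_mapping_eqI) (auto simp: lookup_hcomp forms_mdeg when_def in_keys_iff)

lemma hcomp_mult_form:
  assumes "h \<in> forms e"
  shows "hcomp d (a * h) = (if e \<le> d then hcomp (d - e) a * h else 0)"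
proof (induction a rule: single_add_induct)
  case (single m c)
  have m: "single m c \<in> forms (mdeg m)" by (rule forms_single) simp
  show ?case
    using forms_mult[OF m assms] by (auto simp: hcomp_form[OF m] hcomp_form)
qed (simp_all add: distrib_right hcomp_add)

lemma hcomp_eventually_0: "\<exists>N. \<forall>d\<ge>N. hcomp d p = 0"
proof (intro exI[of _ "Suc (Max (mdeg ` keys p))"] allI impI poly_mapping_eqI)
  fix d m assume d: "Suc (Max (mdeg ` keys p)) \<le> d"
  have "mdeg m \<noteq> d" if "m \<in> keys p"
  proof -
    have "mdeg m \<le> Max (mdeg ` keys p)" using that by (intro Max_ge) auto
    then show ?thesis using d by linarith
  qed
  then show "lookup (hcomp d p) m = lookup 0 m"
    by (auto simp: lookup_hcomp when_def in_keys_iff)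
qed

text \<open>The ideal generated by the forms and \<open>1 - x\<^sub>i\<close> is the whole ring; comparing homogeneous
  components in an equation that expresses \<open>1\<close> shows that a power of \<open>x\<^sub>i\<close> is in the ideal of the
  forms.\<close>

theorem homogeneous_nullstellensatz:
  fixes h :: "'j::finite \<Rightarrow> 'v::finite mpoly"
  assumes h: "\<And>j. h j \<in> forms (e j)"
    and zero: "\<And>p. (\<And>j. eval_mpoly (h j) p = 0) \<Longrightarrow> p = (\<lambda>_. 0)"
  shows "\<exists>M. \<forall>i. var i ^ M \<in> module.span (*) (range h)"
proof -
  define I where "I = module.span (*) (range h)"
  have I: "module.subspace (*) I" unfolding I_def by (rule ideal_span)
  have h_I: "h j \<in> I" for j unfolding I_def by (rule module.span_base[OF module_mult]) simp
  \<comment> \<open>The ideal is graded because its generators are forms.\<close>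
  have hcomp_I: "hcomp d a \<in> I" if a: "a \<in> I" for a d
  proof -
    obtain u where u: "a = (\<Sum>j\<in>UNIV. u j * h j)"
      using a span_image_finite[OF module_mult, of UNIV h] by (auto simp: I_def)
    show ?thesis
      unfolding u hcomp_sum using h_I ideal_0[OF I]
      by (intro ideal_sum[OF I]) (auto simp: hcomp_mult_form[OF h] intro!: ideal_mult[OF I])
  qed
  have "\<exists>M. var i ^ M \<in> I" for i
  proof -
    have "1 \<in> {a + b * (1 - var i) |a b. a \<in> I}"
    proof (rule ccontr)
      assume "1 \<notin> {a + b * (1 - var i) |a b. a \<in> I}"
      then obtain p where p: "\<And>f. f \<in> {a + b * (1 - var i) |a b. a \<in> I} \<Longrightarrow> eval_mpoly f p = 0"
        using weak_nullstellensatz[OF ideal_adjoin[OF I]] by blast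
      have "eval_mpoly (h j) p = 0" for j
        using p h_I ideal_adjoin_superset by blast
      then have "p = (\<lambda>_. 0)" by (rule zero)
      moreover have "eval_mpoly (1 - var i) p = 0"
        using p ideal_adjoin_self[OF I] by blast
      ultimately show False by (simp add: eval_mpoly.hom_minus)
    qed
    then obtain a b where ab: "1 = a + b * (1 - var i)" "a \<in> I" by auto
    have b: "hcomp d 1 = hcomp d a + hcomp d b - (if 1 \<le> d then hcomp (d - 1) b * var i else 0)" for d
    proof -
      have "hcomp d 1 = hcomp d a + (hcomp d b - hcomp d (b * var i))"
        by (subst ab(1)) (simp add: algebra_simps hcomp_add hcomp_diff)
      then show ?thesis by (simp add: hcomp_mult_form[OF forms_var])
    qed
    \<comment> \<open>By comparison of degrees, modulo \<open>I\<close> the component of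
      \<open>b\<close> in degree 0 is 1, and each further one is \<open>var i\<close> times its
      predecessor. The components of \<open>b\<close> are eventually 0, which puts a power of
      \<open>var i\<close> into \<open>I\<close>.\<close>
    have "hcomp d b - var i ^ d \<in> I" for d
    proof (induction d)
      case 0
      have "hcomp 0 b - var i ^ 0 = (-1) * hcomp 0 a"
        using b[of 0] by (simp add: hcomp_form[OF forms_1] algebra_simps)
      then show ?case using hcomp_I[OF ab(2)] ideal_mult[OF I] by metis
    next
      case (Suc d)
      have "hcomp (Suc d) b - var i ^ Suc d = var i * (hcomp d b - var i ^ d) + (-1) * hcomp (Suc d) a"
        using b[of "Suc d"] by (simp add: hcomp_form[OF forms_1] algebra_simps)
      then show ?case
        using ideal_add[OF I ideal_mult[OF I Suc] ideal_mult[OF I hcomp_I[OF ab(2)]]] by metis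
    qed
    moreover obtain N where "hcomp N b = 0"
      using hcomp_eventually_0[of b] by blast
    ultimately have "0 - var i ^ N \<in> I" by metis
    from ideal_mult[OF I this, of "-1"] show ?thesis by auto
  qed
  then obtain M where M: "\<And>i. var i ^ M i \<in> I" by metis
  have "var i ^ Max (range M) \<in> I" for i
  proof -
    have "M i \<le> Max (range M)" by simp
    then have "var i ^ Max (range M) = var i ^ (Max (range M) - M i) * (var i ^ M i :: 'v mpoly)"
      by (simp flip: power_add)
    then show ?thesis using ideal_mult[OF I M] by metis
  qed
  then show ?thesis unfolding I_def by blast
qed

section \<open>Resolutions from complexes of cochains\<close>

text \<open>A differential with arbitrary matrix entries \<open>m k A i\<close> from the basis
  vector of \<open>insert i A\<close> to that of \<open>A\<close>. It allows the lowest maps to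
  differ from the Koszul ones on the same bases; the cut-off makes the result a k-cochain.\<close>

definition cochain_diff ::
    "(nat \<Rightarrow> 'v::finite set \<Rightarrow> 'v \<Rightarrow> 'a::comm_ring_1) \<Rightarrow> nat \<Rightarrow> ('v set \<Rightarrow> 'a) \<Rightarrow> 'v set \<Rightarrow> 'a" where
  "cochain_diff m k c A = (if card A = k then \<Sum>i\<in>-A. m k A i * c (insert i A) else 0)"

lemma cochain_diff_add: "cochain_diff m k (\<lambda>A. c A + c' A) A = cochain_diff m k c A + cochain_diff m k c' A"
  by (simp add: cochain_diff_def distrib_left sum.distrib)

lemma cochain_diff_mult: "cochain_diff m k (\<lambda>A. s * c A) A = s * cochain_diff m k c A"
  by (simp add: cochain_diff_def sum_distrib_left mult.left_commute)

lemma cochain_cochain_diff: "cochain k (cochain_diff m k c)"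
  by (simp add: cochain_def cochain_diff_def)

text \<open>A numbering of the k-element sets, to pass from cochains to the free modules, whose
  coordinates are numbered.\<close>

definition subset_enum :: "nat \<Rightarrow> nat \<Rightarrow> 'v::finite set" where
  "subset_enum k = (SOME f. bij_betw f {..<CARD('v) choose k} {A. card A = k})"

lemma bij_subset_enum:
  "bij_betw (subset_enum k :: nat \<Rightarrow> 'v::finite set) {..<CARD('v) choose k} {A. card A = k}"
proof -
  have "card {A :: 'v set. card A = k} = CARD('v) choose k"
    using n_subsets[of "UNIV :: 'v set" k] by simp
  then have "\<exists>f. bij_betw f {..<CARD('v) choose k} {A :: 'v set. card A = k}"
    using ex_bij_betw_nat_finite[of "{A :: 'v set. card A = k}"] by (simp add: atLeast0LessThan)
  then show ?thesis
    unfolding subset_enum_def by (rule someI_ex)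
qed

lemma card_subset_enum: "i < CARD('v) choose k \<Longrightarrow> card (subset_enum k i :: 'v::finite set) = k"
  using bij_subset_enum[of k, where 'v = 'v] by (auto simp: bij_betw_def)

lemma subset_enum_eq_iff:
  "i < CARD('v) choose k \<Longrightarrow> j < CARD('v) choose k \<Longrightarrow>
    (subset_enum k i :: 'v::finite set) = subset_enum k j \<longleftrightarrow> i = j"
  using bij_subset_enum[of k, where 'v = 'v] by (auto simp: bij_betw_def inj_on_def)

definition subset_index :: "nat \<Rightarrow> 'v::finite set \<Rightarrow> nat" where
  "subset_index k = inv_into {..<CARD('v) choose k} (subset_enum k)"

lemma subset_index:
  fixes A :: "'v::finite set"
  assumes "card A = k"
  shows "subset_index k A < CARD('v) choose k" "subset_enum k (subset_index k A) = A"
proof -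
  have "A \<in> subset_enum k ` {..<CARD('v) choose k}"
    using bij_subset_enum[of k, where 'v = 'v] assms by (simp add: bij_betw_def)
  from inv_into_into[OF this] f_inv_into_f[OF this]
  show "subset_index k A < CARD('v) choose k" "subset_enum k (subset_index k A) = A"
    unfolding subset_index_def by auto
qed

lemma subset_index_subset_enum:
  "i < CARD('v) choose k \<Longrightarrow> subset_index k (subset_enum k i :: 'v::finite set) = i"
  using subset_index[OF card_subset_enum, of i k] subset_enum_eq_iff by blast

definition to_cochain :: "nat \<Rightarrow> (nat \<Rightarrow> 'a::zero) \<Rightarrow> 'v::finite set \<Rightarrow> 'a" where
  "to_cochain k v A = (if card A = k then v (subset_index k A) else 0)"

definition of_cochain :: "nat \<Rightarrow> ('v::finite set \<Rightarrow> 'a::zero) \<Rightarrow> nat \<Rightarrow> 'a" where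
  "of_cochain k c i = (if i < CARD('v) choose k then c (subset_enum k i) else 0)"

lemma cochain_to_cochain: "cochain k (to_cochain k v)"
  by (simp add: cochain_def to_cochain_def)

lemma to_of_cochain: "cochain k c \<Longrightarrow> to_cochain k (of_cochain k c) = c"
  by (auto simp: fun_eq_iff cochain_def to_cochain_def of_cochain_def subset_index)

lemma of_to_cochain:
  fixes v :: "nat \<Rightarrow> 'w mpoly"
  assumes "v \<in> free_mod (replicate (CARD('v) choose k) s)"
  shows "of_cochain k (to_cochain k v :: 'v::finite set \<Rightarrow> _) = v"
  using assms
  by (auto simp: fun_eq_iff to_cochain_def of_cochain_def free_mod_def card_subset_enum
      subset_index_subset_enum)

lemma of_cochain_free_mod:
  "of_cochain k (c :: 'v::finite set \<Rightarrow> _) \<in> free_mod (replicate (CARD('v) choose k) s)"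
  by (simp add: free_mod_def of_cochain_def)

lemma of_cochain_eq_0_iff: "cochain k c \<Longrightarrow> of_cochain k c = 0 \<longleftrightarrow> c = (\<lambda>_. 0)"
proof
  assume "cochain k c" "of_cochain k c = 0"
  then have "c A = to_cochain k 0 A" for A
    using to_of_cochain[of k c] by simp
  then show "c = (\<lambda>_. 0)" by (simp add: fun_eq_iff to_cochain_def)
qed (simp add: fun_eq_iff of_cochain_def)

text \<open>The component of degree d of S(-s). The case s > d is separate because subtraction of
  naturals is truncated.\<close>

definition homogeneous_upto :: "nat \<Rightarrow> nat \<Rightarrow> 'v mpoly \<Rightarrow> bool" where
  "homogeneous_upto s d p \<longleftrightarrow> (if s \<le> d then p \<in> forms (d - s) else p = 0)"

lemma free_mod_component_replicate: "v \<in> free_mod_component (replicate N s) d \<longleftrightarrow>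
    v \<in> free_mod (replicate N s) \<and> (\<forall>i<N. homogeneous_upto s d (v i))"
  by (auto simp: free_mod_component_def homogeneous_upto_def)

lemma cochain_diff_homogeneous:
  assumes "\<And>A i. card A = k \<Longrightarrow> m k A i \<in> forms (t - s)" "s \<le> t"
    and c: "\<And>A. card A = Suc k \<Longrightarrow> homogeneous_upto t d (c A)"
  shows "homogeneous_upto s d (cochain_diff m k c A)"
proof -
  have "homogeneous_upto s d (m k A i * c (insert i A))" if "card A = k" "i \<notin> A" for i
  proof (cases "t \<le> d")
    case True
    then have "c (insert i A) \<in> forms (d - t)"
      using c[of "insert i A"] that by (simp add: homogeneous_upto_def)
    from forms_mult[OF assms(1)[OF that(1), of i] this] show ?thesis
      using True assms(2) by (simp add: homogeneous_upto_def)
  next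
    case False
    then show ?thesis
      using c[of "insert i A"] that by (simp add: homogeneous_upto_def)
  qed
  then show ?thesis
    by (auto simp: cochain_diff_def homogeneous_upto_def intro!: forms_sum sum.neutral)
qed

lemma residue_class_eq_iff:
  assumes "module.subspace (*) J"
  shows "residue_class J p = residue_class J q \<longleftrightarrow> p - q \<in> J"
proof
  have "p \<in> residue_class J p"
    using ideal_0[OF assms] by (simp add: residue_class_def)
  moreover assume "residue_class J p = residue_class J q"
  ultimately have "p \<in> residue_class J q" by simp
  then show "p - q \<in> J" by (simp add: residue_class_def)
next
  assume pq: "p - q \<in> J"
  have "r - p \<in> J \<longleftrightarrow> r - q \<in> J" for r
    using ideal_add[OF assms _ pq, of "r - p"] ideal_diff[OF assms _ pq, of "r - q"] by auto
  then show "residue_class J p = residue_class J q"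
    by (auto simp: residue_class_def)
qed

lemma ideal_irrelevant: "module.subspace (*) irrelevant_ideal"
  unfolding irrelevant_ideal_def by (rule ideal_span)

text \<open>Euler's identity writes d times the form as a combination of the variables, and d is
  invertible.\<close>

lemma form_in_irrelevant_ideal:
  fixes p :: "'v::finite mpoly"
  assumes "p \<in> forms d" "0 < d"
  shows "p \<in> irrelevant_ideal"
proof -
  have var: "var i \<in> irrelevant_ideal" for i :: 'v
    unfolding irrelevant_ideal_def by (rule module.span_base[OF module_mult]) simp
  have "(\<Sum>i\<in>UNIV. partial_deriv i p * var i) \<in> irrelevant_ideal"
    by (intro ideal_sum[OF ideal_irrelevant] ideal_mult[OF ideal_irrelevant] var)
  then have "of_nat d * p \<in> irrelevant_ideal"
    using euler_identity[OF assms(1)] by (simp add: mult.commute)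
  then have "Const (1 / of_nat d) * (of_nat d * p) \<in> irrelevant_ideal"
    by (rule ideal_mult[OF ideal_irrelevant])
  moreover have "Const (1 / of_nat d) * (of_nat d :: 'v mpoly) = 1"
    using assms(2) by (simp add: mult_single flip: single_of_nat)
  ultimately show ?thesis by (simp flip: mult.assoc)
qed

lemma one_notin_irrelevant_ideal: "1 \<notin> (irrelevant_ideal :: 'v::finite mpoly set)"
proof
  assume "1 \<in> (irrelevant_ideal :: 'v mpoly set)"
  then obtain u where "1 = (\<Sum>i\<in>UNIV. u i * var i :: 'v mpoly)"
    using span_image_finite[OF module_mult, of UNIV "var :: 'v \<Rightarrow> _"]
    by (auto simp: irrelevant_ideal_def)
  then have "eval_mpoly 1 (\<lambda>_. 0) = eval_mpoly (\<Sum>i\<in>UNIV. u i * var i) (\<lambda>_. 0)" by simp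
  then show False
    by (simp add: eval_hom)
qed

text \<open>Strictly increasing shifts make all matrix entries forms of positive degree, which gives
  minimality, and the differences of shifts make the maps graded of degree 0. The length is finite
  because the binomial coefficients vanish beyond \<open>CARD('v)\<close>.\<close>

lemma minimal_graded_free_resolution_of_cochains:
  fixes J :: "'v::finite mpoly set" and m :: "nat \<Rightarrow> 'v set \<Rightarrow> 'v \<Rightarrow> 'v mpoly"
  assumes s: "s 0 = 0" "\<And>k. s k < s (Suc k)"
    and m: "\<And>k A i. card A = k \<Longrightarrow> m k A i \<in> forms (s (Suc k) - s k)"
    and J: "J = module.span (*) (range (m 0 {}))"
    and exact: "\<And>k c. cochain (Suc k) c \<Longrightarrow> cochain_diff m k c = (\<lambda>_. 0) \<longleftrightarrow>
      (\<exists>w. cochain (Suc (Suc k)) w \<and> c = cochain_diff m (Suc k) w)"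
  shows "\<exists>\<epsilon> \<delta>. minimal_graded_free_resolution J (\<lambda>k. replicate (CARD('v) choose k) (s k)) \<epsilon> \<delta>"
proof -
  define F where "F k = replicate (CARD('v) choose k) (s k)" for k
  \<comment> \<open>Only coordinate 0 matters, since the first module has rank 1: its basis vector
    is the empty set.\<close>
  define \<epsilon> where "\<epsilon> v = residue_class J (v 0)" for v :: "nat \<Rightarrow> 'v mpoly"
  define \<delta> where "\<delta> k v = of_cochain k (cochain_diff m k (to_cochain (Suc k) v))" for k v
  have sub: "module.subspace (*) J" unfolding J by (rule ideal_span)
  have F0: "F 0 = [0]" by (simp add: F_def s(1))
  have \<delta>_of_cochain: "\<delta> k (of_cochain (Suc k) c) = of_cochain k (cochain_diff m k c)"
    if "cochain (Suc k) c" for k c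
    using that by (simp add: \<delta>_def to_of_cochain)
  have \<delta>_eq_0: "\<delta> k v = 0 \<longleftrightarrow> cochain_diff m k (to_cochain (Suc k) v) = (\<lambda>_. 0)" for k v
    by (simp add: \<delta>_def of_cochain_eq_0_iff cochain_cochain_diff)
  have hom\<epsilon>: "graded_hom_quotient (F 0) J \<epsilon>"
    unfolding graded_hom_quotient_def
  proof (intro conjI allI ballI impI)
    show "\<epsilon> ` free_mod (F 0) \<subseteq> quotient_algebra J"
      by (auto simp: \<epsilon>_def quotient_algebra_def)
  next
    fix v w :: "nat \<Rightarrow> 'v mpoly" and p q
    assume "\<epsilon> v = residue_class J p \<and> \<epsilon> w = residue_class J q"
    then have "v 0 - p \<in> J" "w 0 - q \<in> J"
      by (auto simp: \<epsilon>_def residue_class_eq_iff[OF sub])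
    from ideal_add[OF sub this] show "\<epsilon> (v + w) = residue_class J (p + q)"
      by (simp add: \<epsilon>_def residue_class_eq_iff[OF sub] algebra_simps)
  next
    fix r and v :: "nat \<Rightarrow> 'v mpoly" and p
    assume "\<epsilon> v = residue_class J p"
    then have "v 0 - p \<in> J"
      by (auto simp: \<epsilon>_def residue_class_eq_iff[OF sub])
    from ideal_mult[OF sub this, of r] show "\<epsilon> (fun_scale r v) = residue_class J (r * p)"
      by (simp add: \<epsilon>_def fun_scale_def residue_class_eq_iff[OF sub] algebra_simps)
  next
    fix d show "\<epsilon> ` free_mod_component (F 0) d \<subseteq> residue_class J ` forms d"
      by (auto simp: \<epsilon>_def F0 free_mod_component_def)
  qed
  have hom\<delta>: "graded_hom (F (Suc k)) (F k) (\<delta> k)" for k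
    unfolding graded_hom_def
  proof (intro conjI allI ballI impI)
    show "\<delta> k ` free_mod (F (Suc k)) \<subseteq> free_mod (F k)"
      by (auto simp: \<delta>_def F_def of_cochain_free_mod)
  next
    fix v w :: "nat \<Rightarrow> 'v mpoly"
    have "to_cochain (Suc k) (v + w) = (\<lambda>A :: 'v set. to_cochain (Suc k) v A + to_cochain (Suc k) w A)"
      by (simp add: fun_eq_iff to_cochain_def)
    then show "\<delta> k (v + w) = \<delta> k v + \<delta> k w"
      by (auto simp: \<delta>_def of_cochain_def cochain_diff_add)
  next
    fix r and v :: "nat \<Rightarrow> 'v mpoly"
    have "to_cochain (Suc k) (fun_scale r v) = (\<lambda>A :: 'v set. r * to_cochain (Suc k) v A)"
      by (simp add: fun_eq_iff to_cochain_def fun_scale_def)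
    then show "\<delta> k (fun_scale r v) = fun_scale r (\<delta> k v)"
      by (auto simp: \<delta>_def of_cochain_def fun_scale_def cochain_diff_mult)
  next
    fix d show "\<delta> k ` free_mod_component (F (Suc k)) d \<subseteq> free_mod_component (F k) d"
    proof
      fix x assume "x \<in> \<delta> k ` free_mod_component (F (Suc k)) d"
      then obtain v where v: "x = \<delta> k v" "v \<in> free_mod_component (F (Suc k)) d" by auto
      have "homogeneous_upto (s (Suc k)) d (to_cochain (Suc k) v A)" if "card A = Suc k" for A :: "'v set"
        using v(2) that subset_index[of A "Suc k"]
        by (simp add: F_def free_mod_component_replicate to_cochain_def)
      then have "homogeneous_upto (s k) d (cochain_diff m k (to_cochain (Suc k) v) A)" for A
        by (intro cochain_diff_homogeneous[where t = "s (Suc k)"] m less_imp_le s(2)) auto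
      then show "x \<in> free_mod_component (F k) d"
        by (simp add: F_def free_mod_component_replicate v(1) \<delta>_def of_cochain_free_mod of_cochain_def)
    qed
  qed
  have surj: "\<epsilon> ` free_mod (F 0) = quotient_algebra J"
  proof -
    have "residue_class J p \<in> \<epsilon> ` free_mod (F 0)" for p
      by (rule image_eqI[of _ _ "\<lambda>i. if i = 0 then p else 0"]) (auto simp: \<epsilon>_def F0 free_mod_def)
    then show ?thesis by (auto simp: \<epsilon>_def quotient_algebra_def)
  qed
  have exact_0: "{v \<in> free_mod (F 0). \<epsilon> v = residue_class J 0} = \<delta> 0 ` free_mod (F 1)"
  proof -
    have \<delta>_0: "\<delta> 0 v = (\<lambda>i. if i = 0 then \<Sum>j\<in>UNIV. m 0 {} j * to_cochain 1 v {j} else 0)" for v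
      using card_subset_enum[of 0 0, where 'v = 'v]
      by (auto simp: \<delta>_def of_cochain_def cochain_diff_def fun_eq_iff)
    show ?thesis
    proof (intro subset_antisym subsetI)
      fix v assume "v \<in> {v \<in> free_mod (F 0). \<epsilon> v = residue_class J 0}"
      then have v: "v 0 \<in> J" "\<And>i. 0 < i \<Longrightarrow> v i = 0"
        by (auto simp: \<epsilon>_def residue_class_eq_iff[OF sub] F0 free_mod_def)
      then obtain u where u: "v 0 = (\<Sum>j\<in>UNIV. u j * m 0 {} j)"
        using span_image_finite[OF module_mult, of UNIV "m 0 {}"] by (auto simp: J)
      define c where "c A = (if card A = 1 then u (the_elem A) else 0)" for A :: "'v set"
      have "cochain 1 c" by (simp add: cochain_def c_def)
      then have "v = \<delta> 0 (of_cochain 1 c)"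
        using v(2) by (auto simp: \<delta>_0 fun_eq_iff to_of_cochain u c_def mult.commute)
      moreover have "of_cochain 1 c \<in> free_mod (F 1)"
        unfolding F_def by (rule of_cochain_free_mod)
      ultimately show "v \<in> \<delta> 0 ` free_mod (F 1)" by (rule image_eqI)
    next
      fix v assume "v \<in> \<delta> 0 ` free_mod (F 1)"
      then obtain w where v: "v = \<delta> 0 w" by auto
      have "m 0 {} j \<in> J" for j
        unfolding J by (rule module.span_base[OF module_mult]) simp
      then have "v 0 \<in> J"
        unfolding v \<delta>_0 by (auto intro!: ideal_sum[OF sub] ideal_mult[OF sub] simp: mult.commute[of "m 0 {} _"])
      then show "v \<in> {v \<in> free_mod (F 0). \<epsilon> v = residue_class J 0}"
        by (auto simp: \<epsilon>_def residue_class_eq_iff[OF sub] F0 free_mod_def v \<delta>_0)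
    qed
  qed
  have exact_Suc: "{v \<in> free_mod (F (Suc k)). \<delta> k v = 0} = \<delta> (Suc k) ` free_mod (F (Suc (Suc k)))" for k
  proof (intro subset_antisym subsetI)
    fix v assume v: "v \<in> {v \<in> free_mod (F (Suc k)). \<delta> k v = 0}"
    then obtain w where w: "cochain (Suc (Suc k)) w" "to_cochain (Suc k) v = cochain_diff m (Suc k) w"
      using exact[OF cochain_to_cochain] by (auto simp: \<delta>_eq_0)
    have "v = of_cochain (Suc k) (to_cochain (Suc k) v :: 'v set \<Rightarrow> _)"
      using v by (intro of_to_cochain[symmetric, where s = "s (Suc k)"]) (simp add: F_def)
    also have "\<dots> = \<delta> (Suc k) (of_cochain (Suc (Suc k)) w)"
      using w by (simp add: \<delta>_of_cochain)
    finally have "v = \<delta> (Suc k) (of_cochain (Suc (Suc k)) w)" .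
    moreover have "of_cochain (Suc (Suc k)) w \<in> free_mod (F (Suc (Suc k)))"
      unfolding F_def by (rule of_cochain_free_mod)
    ultimately show "v \<in> \<delta> (Suc k) ` free_mod (F (Suc (Suc k)))" by (rule image_eqI)
  next
    fix v assume "v \<in> \<delta> (Suc k) ` free_mod (F (Suc (Suc k)))"
    then obtain w where v: "v = of_cochain (Suc k) (cochain_diff m (Suc k) (to_cochain (Suc (Suc k)) w))"
      by (auto simp: \<delta>_def)
    have "cochain_diff m k (cochain_diff m (Suc k) (to_cochain (Suc (Suc k)) w)) = (\<lambda>_. 0)"
      using exact[OF cochain_cochain_diff] cochain_to_cochain by blast
    then show "v \<in> {v \<in> free_mod (F (Suc k)). \<delta> k v = 0}"
      unfolding v by (simp add: F_def of_cochain_free_mod \<delta>_eq_0 to_of_cochain cochain_cochain_diff)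
  qed
  have minimal: "\<delta> k v i \<in> irrelevant_ideal" for k v i
  proof -
    have "m k A j * c \<in> irrelevant_ideal" if "card A = k" for A j c
    proof -
      have "m k A j \<in> irrelevant_ideal"
        by (rule form_in_irrelevant_ideal[OF m[OF that]]) (use s(2) in simp)
      from ideal_mult[OF ideal_irrelevant this, of c] show ?thesis by (simp add: mult.commute)
    qed
    then have "cochain_diff m k c A \<in> irrelevant_ideal" for c A
      unfolding cochain_diff_def by (simp add: ideal_sum[OF ideal_irrelevant] ideal_0[OF ideal_irrelevant])
    then show ?thesis
      by (simp add: \<delta>_def of_cochain_def ideal_0[OF ideal_irrelevant])
  qed
  have "minimal_graded_free_resolution J F \<epsilon> \<delta>"
    unfolding minimal_graded_free_resolution_def
    by (intro conjI allI ballI hom\<epsilon> hom\<delta> surj exact_0 exact_Suc minimal)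
  then show ?thesis
    unfolding F_def[abs_def] by (rule exI[of _ \<epsilon>, OF exI[of _ \<delta>]])
qed

section \<open>Linear forms as coordinates\<close>

text \<open>\<open>a\<close> is the coefficient matrix of the forms and \<open>c\<close> its
  inverse. The k-th column of \<open>c\<close> is the vertex of the simplex of hyperplanes at which
  \<open>l k\<close> is 1 and the other forms vanish.\<close>

locale hyperplane_coordinates =
  fixes l :: "'v::finite \<Rightarrow> 'v mpoly" and a c :: "'v \<Rightarrow> 'v \<Rightarrow> complex"
  assumes l_eq: "l j = (\<Sum>k\<in>UNIV. Const (a j k) * var k)"
    and ac: "(\<Sum>k\<in>UNIV. a i k * c k j) = (if i = j then 1 else 0)"
    and ca: "(\<Sum>j\<in>UNIV. c i j * a j k) = (if i = k then 1 else 0)"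

lemma Const_sum: "Const (\<Sum>i\<in>A. u i) = (\<Sum>i\<in>A. Const (u i))"
  by (induction A rule: infinite_finite_induct) (auto simp: single_add)

text \<open>An empty intersection says that the coefficient matrix has trivial kernel, hence an
  inverse.\<close>

lemma hyperplane_coordinates_exist:
  fixes l :: "'v::finite \<Rightarrow> 'v mpoly"
  assumes l: "\<And>j. l j \<in> forms 1" "(\<Inter>j. hypersurface (l j)) = {}"
  shows "\<exists>a c. hyperplane_coordinates l a c"
proof -
  define a where "a j k = lookup (l j) (single k 1)" for j k
  have l_eq: "l j = (\<Sum>k\<in>UNIV. Const (a j k) * var k)" for j
    unfolding a_def by (rule forms_1_eq[OF l(1)])
  let ?A = "(\<chi> j k. a j k) :: complex ^ 'v ^ 'v"
  have "x = 0" if "?A *v x = 0" for x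
  proof (rule ccontr)
    assume "x \<noteq> 0"
    moreover have "eval_mpoly (l j) (($) x) = 0" for j
      using arg_cong[OF that, of "\<lambda>v. v $ j"]
      by (simp add: l_eq eval_hom matrix_vector_mult_def)
    ultimately have "x \<in> (\<Inter>j. hypersurface (l j))"
      by (simp add: hypersurface_def)
    then show False using l(2) by simp
  qed
  then obtain C where C: "C ** ?A = Finite_Cartesian_Product.mat 1"
    using matrix_left_invertible_ker[of ?A] by blast
  then have C': "?A ** C = Finite_Cartesian_Product.mat 1"
    by (simp add: matrix_left_right_inverse)
  define c where "c i j = C $ i $ j" for i j
  have "hyperplane_coordinates l a c"
  proof
    fix i j
    have "(?A ** C) $ i $ j = (if i = j then 1 else 0)"
      unfolding C' by (simp add: Finite_Cartesian_Product.mat_def)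
    then show "(\<Sum>k\<in>UNIV. a i k * c k j) = (if i = j then 1 else 0)"
      by (simp add: matrix_matrix_mult_def c_def)
    have "(C ** ?A) $ i $ j = (if i = j then 1 else 0)"
      unfolding C by (simp add: Finite_Cartesian_Product.mat_def)
    then show "(\<Sum>k\<in>UNIV. c i k * a k j) = (if i = j then 1 else 0)"
      by (simp add: matrix_matrix_mult_def c_def)
  qed (rule l_eq)
  then show ?thesis by blast
qed

context hyperplane_coordinates
begin

lemma l_forms: "l j \<in> forms 1"
  unfolding l_eq by (intro forms_sum forms_mult_Const forms_var)

lemma var_eq: "var i = (\<Sum>j\<in>UNIV. Const (c i j) * l j)"
proof -
  have "(\<Sum>j\<in>UNIV. Const (c i j) * l j) = (\<Sum>k\<in>UNIV. Const (\<Sum>j\<in>UNIV. c i j * a j k) * var k)"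
    unfolding l_eq Const_sum sum_distrib_left sum_distrib_right
    by (subst sum.swap) (simp add: mult_single flip: mult.assoc)
  also have "\<dots> = (\<Sum>k\<in>UNIV. if i = k then var k else 0)"
    by (rule sum.cong) (auto simp: ca)
  finally show ?thesis by simp
qed

lemma eval_l_point: "eval_mpoly (l j) (\<lambda>i. c i k) = (if j = k then 1 else 0)"
  by (simp add: l_eq eval_hom ac)

lemma eval_l_eq_0D:
  assumes "\<And>j. eval_mpoly (l j) p = 0"
  shows "p = (\<lambda>_. 0)"
proof
  fix i
  have "p i = eval_mpoly (\<Sum>j\<in>UNIV. Const (c i j) * l j) p"
    by (simp flip: var_eq)
  also have "\<dots> = 0"
    by (simp add: eval_hom assms)
  finally show "p i = 0" .
qed

section \<open>Derivations dual to the linear forms\<close>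

definition D :: "'v \<Rightarrow> 'v mpoly \<Rightarrow> 'v mpoly" where
  "D j p = (\<Sum>i\<in>UNIV. Const (c i j) * partial_deriv i p)"

lemma D_add: "D j (p + q) = D j p + D j q"
  by (simp add: D_def partial_deriv_add distrib_left sum.distrib)

lemma D_mult: "D j (p * q) = D j p * q + p * D j q"
  by (simp add: D_def partial_deriv_mult distrib_left distrib_right sum.distrib sum_distrib_left
      sum_distrib_right algebra_simps)

lemma D_1 [simp]: "D j 1 = 0"
  by (simp add: D_def)

lemma D_l: "D j (l i) = (if i = j then 1 else 0)"
proof -
  have "D j (l i) = (\<Sum>k\<in>UNIV. Const (c k j * a i k))"
    by (simp add: D_def l_eq partial_deriv_sum partial_deriv_var if_distrib[of "\<lambda>p. _ * p"]
        mult_single cong: if_cong)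
  also have "\<dots> = Const (\<Sum>k\<in>UNIV. a i k * c k j)"
    by (simp add: Const_sum mult.commute)
  finally show ?thesis by (simp add: ac)
qed

lemma D_forms: "p \<in> forms d \<Longrightarrow> D j p \<in> forms (d - 1)"
  unfolding D_def by (intro forms_sum forms_mult_Const partial_deriv_forms)

lemma partial_deriv_eq: "partial_deriv i p = (\<Sum>j\<in>UNIV. Const (a j i) * D j p)"
proof -
  have "(\<Sum>j\<in>UNIV. Const (a j i) * D j p) = (\<Sum>k\<in>UNIV. Const (\<Sum>j\<in>UNIV. c k j * a j i) * partial_deriv k p)"
    unfolding D_def Const_sum sum_distrib_left sum_distrib_right
    by (subst sum.swap) (simp add: mult_single mult.commute[of "a _ _"] flip: mult.assoc)
  also have "\<dots> = (\<Sum>k\<in>UNIV. if k = i then partial_deriv k p else 0)"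
    by (rule sum.cong) (auto simp: ca)
  finally show ?thesis by simp
qed

lemma jacobian_ideal_eq: "jacobian_ideal p = module.span (*) (range (\<lambda>j. D j p))"
proof (rule subset_antisym)
  have sub: "module.subspace (*) (module.span (*) S)" for S :: "'v mpoly set"
    by (rule ideal_span)
  show "jacobian_ideal p \<subseteq> module.span (*) (range (\<lambda>j. D j p))"
    unfolding jacobian_ideal_def
  proof (rule module.span_minimal[OF module_mult _ sub], safe)
    fix i show "partial_deriv i p \<in> module.span (*) (range (\<lambda>j. D j p))"
      unfolding partial_deriv_eq
      by (intro ideal_sum[OF sub] ideal_mult[OF sub] module.span_base[OF module_mult]) simp
  qed
  show "module.span (*) (range (\<lambda>j. D j p)) \<subseteq> jacobian_ideal p"
    unfolding jacobian_ideal_def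
  proof (rule module.span_minimal[OF module_mult _ sub], safe)
    fix j show "D j p \<in> module.span (*) (range (\<lambda>j. partial_deriv j p))"
      unfolding D_def
      by (intro ideal_sum[OF sub] ideal_mult[OF sub] module.span_base[OF module_mult]) simp
  qed
qed

lemma euler_identity_D:
  assumes "p \<in> forms d"
  shows "(\<Sum>j\<in>UNIV. l j * D j p) = of_nat d * p"
proof -
  have "(\<Sum>j\<in>UNIV. l j * D j p) = (\<Sum>i\<in>UNIV. (\<Sum>j\<in>UNIV. Const (c i j) * l j) * partial_deriv i p)"
    unfolding D_def sum_distrib_left sum_distrib_right
    by (subst sum.swap) (simp add: algebra_simps)
  then show ?thesis
    using euler_identity[OF assms] by (simp flip: var_eq)
qed

lemma D_prod_l: "finite I \<Longrightarrow> D j (\<Prod>i\<in>I. l i) = (if j \<in> I then \<Prod>i\<in>I - {j}. l i else 0)"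
proof (induction I rule: finite_induct)
  case (insert k I)
  show ?case
  proof (cases "j = k")
    case True
    then show ?thesis using insert by (simp add: D_mult D_l)
  next
    case False
    then have "insert k I - {j} = insert k (I - {j})" by auto
    then show ?thesis using insert False by (simp add: D_mult D_l)
  qed
qed simp

lemma D_mult_prod_l: "D j (p * (\<Prod>i\<in>UNIV. l i)) = (\<Prod>i\<in>UNIV - {j}. l i) * (p + l j * D j p)"
proof -
  have "(\<Prod>i\<in>UNIV. l i) = l j * (\<Prod>i\<in>UNIV - {j}. l i)"
    by (rule prod.remove) auto
  then show ?thesis
    by (simp add: D_mult D_prod_l D_l algebra_simps)
qed

text \<open>The projection along the j-th vertex onto the hyperplane, acting on polynomials. It
  kills \<open>l j\<close> and fixes the other \<open>l i\<close>; by \<open>restrict_decomp\<close>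
  its kernel is the ideal of \<open>l j\<close>. It replaces computations modulo this prime.\<close>

definition restrict :: "'v \<Rightarrow> 'v mpoly \<Rightarrow> 'v mpoly" where
  "restrict j = subst (\<lambda>i. var i - Const (c i j) * l j)"

lemma restrict_hom: "comm_ring_hom (restrict j)"
  unfolding restrict_def by (rule subst_hom)

lemma restrict_l: "restrict j (l i) = (if i = j then 0 else l i)"
proof -
  interpret restrict: comm_ring_hom "restrict j" by (rule restrict_hom)
  have "restrict j (l i) = l i - (\<Sum>k\<in>UNIV. Const (a i k) * (Const (c k j) * l j))"
    by (subst (1 2) l_eq) (simp add: restrict_def subst.hom_sum subst.hom_mult algebra_simps sum_subtractf)
  also have "(\<Sum>k\<in>UNIV. Const (a i k) * (Const (c k j) * l j)) = Const (\<Sum>k\<in>UNIV. a i k * c k j) * l j"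
    by (simp add: Const_sum sum_distrib_right mult_single flip: mult.assoc)
  finally show ?thesis by (auto simp: ac)
qed

lemma restrict_decomp: "\<exists>q. p = restrict j p + l j * q"
proof (induction p rule: mpoly_ring_induct)
  case (Const k)
  show ?case by (auto simp: restrict_def intro!: exI[of _ 0])
next
  case (var i)
  show ?case by (auto simp: restrict_def intro!: exI[of _ "Const (c i j)"])
next
  case (add p q)
  then obtain p' q' where p: "p = restrict j p + l j * p'" and q: "q = restrict j q + l j * q'" by blast
  have "p + q = (restrict j p + l j * p') + (restrict j q + l j * q')"
    by (simp only: p[symmetric] q[symmetric])
  also have "\<dots> = restrict j (p + q) + l j * (p' + q')"
    by (simp add: restrict_def subst.hom_add algebra_simps)
  finally show ?case by blast
next
  case (mult p q)
  then obtain p' q' where p: "p = restrict j p + l j * p'" and q: "q = restrict j q + l j * q'" by blast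
  have "p * q = (restrict j p + l j * p') * q" by (simp flip: p)
  also have "\<dots> = restrict j p * (restrict j q + l j * q') + l j * p' * q"
    by (simp add: distrib_right flip: q)
  also have "\<dots> = restrict j (p * q) + l j * (restrict j p * q' + p' * q)"
    by (simp add: restrict_def subst.hom_mult algebra_simps)
  finally show ?case by blast
qed

end

section \<open>The resolution and the syzygies for a nondegenerate form\<close>

lemma koszul_sign_mult_forms: "p \<in> forms d \<Longrightarrow> koszul_sign i A * p \<in> forms d"
  by (cases "even (card {a \<in> A. vidx a < vidx i})") (simp_all add: koszul_sign_def forms_uminus)

text \<open>The condition \<open>nondegenerate\<close> is the algebraic substitute for smoothness
  and normal crossings.\<close>

locale nondegenerate_form = hyperplane_coordinates +
  fixes g :: "'a mpoly" and e :: nat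
  assumes card: "2 \<le> CARD('a)"
    and g: "g \<in> forms e" "0 < e"
    and nondegenerate: "\<And>p. (\<And>j. eval_mpoly (l j) p * eval_mpoly (D j g) p = 0) \<Longrightarrow> p = (\<lambda>_. 0)"
begin

definition f :: "'a mpoly" where "f = g * (\<Prod>i\<in>UNIV. l i)"

definition h :: "'a \<Rightarrow> 'a mpoly" where "h j = g + l j * D j g"

lemma D_f: "D j f = (\<Prod>i\<in>UNIV - {j}. l i) * h j"
  by (simp add: f_def h_def D_mult_prod_l)

lemma h_forms: "h j \<in> forms e"
  using forms_mult[OF l_forms[of j] D_forms[OF g(1), of j]] g by (auto simp: h_def intro!: forms_add)

lemma D_f_forms: "D j f \<in> forms (e + CARD('a) - 1)"
proof -
  have "(\<Prod>i\<in>UNIV - {j}. l i) \<in> forms (\<Sum>i\<in>UNIV - {j}. 1)"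
    by (rule forms_prod) (rule l_forms)
  from forms_mult[OF this h_forms[of j]] have "D j f \<in> forms ((\<Sum>i\<in>UNIV - {j}. 1) + e)"
    by (simp only: D_f)
  moreover have "(\<Sum>i\<in>UNIV - {j}. 1) + e = e + CARD('a) - 1"
    using card by simp
  ultimately show ?thesis by (simp only:)
qed

text \<open>Recovers \<open>g\<close> from the \<open>h j\<close>, so that their common zeros are
  also zeros of \<open>g\<close> and of all \<open>l j * D j g\<close>.\<close>

lemma sum_h: "(\<Sum>j\<in>UNIV. h j) = of_nat (CARD('a) + e) * g"
  by (simp add: h_def sum.distrib euler_identity_D[OF g(1)] algebra_simps)

lemma h_no_common_zero:
  assumes "\<And>j. eval_mpoly (h j) p = 0"
  shows "p = (\<lambda>_. 0)"
proof (rule nondegenerate)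
  have "eval_mpoly (of_nat (CARD('a) + e) * g) p = 0"
    unfolding sum_h[symmetric] by (simp add: eval_mpoly.hom_sum assms)
  then have "eval_mpoly g p = 0"
    using g(2) by (simp add: eval_mpoly.hom_mult flip: single_of_nat of_nat_add)
  then show "eval_mpoly (l j) p * eval_mpoly (D j g) p = 0" for j
    using assms[of j] by (simp add: h_def eval_hom)
qed

lemma koszul_exact_h:
  assumes "cochain k z" "0 < k" "\<And>A. koszul h z A = 0"
  shows "\<exists>w. cochain (Suc k) w \<and> z = koszul h w"
proof -
  obtain M where "\<And>i. var i ^ M \<in> module.span (*) (range h)"
    using homogeneous_nullstellensatz[of h "\<lambda>_. e"] h_forms h_no_common_zero by blast
  then show ?thesis using assms by (rule koszul_exact_mpoly)
qed

lemma l_nonzero: "l j \<noteq> 0"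
  using D_l[of j j] by (auto simp: D_def)

text \<open>Otherwise \<open>l j\<close> divides \<open>g\<close>. At a vertex \<open>k\<close>
  other than \<open>j\<close>, where only \<open>l k\<close> is nonzero, \<open>D k g\<close> would
  vanish as a multiple of \<open>l j\<close>, contrary to nondegeneracy.\<close>

lemma restrict_D_f_nonzero: "restrict j (D j f) \<noteq> 0"
proof
  interpret restrict: comm_ring_hom "restrict j" by (rule restrict_hom)
  assume "restrict j (D j f) = 0"
  then have "(\<Prod>i\<in>UNIV - {j}. l i) * restrict j (h j) = 0"
    by (simp add: D_f restrict.hom_mult restrict.hom_prod restrict_l)
  then have "restrict j (h j) = 0"
    using mpoly_no_zero_divisors mpoly_prod_eq_0[of "UNIV - {j}" l] l_nonzero by auto
  then have "restrict j g = 0"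
    by (simp add: h_def restrict.hom_add restrict.hom_mult restrict_l)
  then obtain q where q: "g = l j * q"
    using restrict_decomp[of g j] by auto
  obtain k where k: "k \<noteq> j"
  proof -
    have "card (UNIV - {j}) \<noteq> 0" using card by simp
    then have "UNIV - {j} \<noteq> {}" by (metis card.empty)
    then show ?thesis using that by blast
  qed
  have "(\<lambda>i. c i k) = (\<lambda>_. 0)"
  proof (rule nondegenerate)
    fix i show "eval_mpoly (l i) (\<lambda>i. c i k) * eval_mpoly (D i g) (\<lambda>i. c i k) = 0"
      using k by (auto simp: eval_l_point q D_mult D_l eval_hom)
  qed
  then show False
    using eval_l_point[of k k] eval_mpoly_zero_arg[OF l_forms, of k] by simp
qed

lemma sum_D_f:
  "(\<Prod>i\<in>UNIV. l i) * (\<Sum>j\<in>UNIV. h j * b j) = (\<Sum>j\<in>UNIV. l j * b j * D j f)"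
  unfolding sum_distrib_left
proof (rule sum.cong)
  fix j
  have "(\<Prod>i\<in>UNIV. l i) = l j * (\<Prod>i\<in>UNIV - {j}. l i)"
    by (rule prod.remove) auto
  then show "(\<Prod>i\<in>UNIV. l i) * (h j * b j) = l j * b j * D j f"
    by (simp add: D_f algebra_simps)
qed simp

text \<open>Every \<open>D i f\<close> with i different from j is a multiple of \<open>l j\<close>,
  whereas \<open>D j f\<close> is not. Restriction to the j-th hyperplane therefore isolates
  \<open>b j\<close> and shows that \<open>l j\<close> divides it. Afterwards the product of all
  \<open>l i\<close> cancels.\<close>

lemma syzygy_iff: "(\<Sum>j\<in>UNIV. b j * D j f) = 0 \<longleftrightarrow>
    (\<exists>b'. (\<forall>j. b j = l j * b' j) \<and> (\<Sum>j\<in>UNIV. h j * b' j) = 0)"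
proof
  assume syz: "(\<Sum>j\<in>UNIV. b j * D j f) = 0"
  have "restrict j (b j) = 0" for j
  proof -
    interpret restrict: comm_ring_hom "restrict j" by (rule restrict_hom)
    have "restrict j (D i f) = 0" if "i \<noteq> j" for i
    proof -
      have "(\<Prod>k\<in>UNIV - {i}. restrict j (l k)) = 0"
        by (rule prod_zero) (use that in \<open>auto simp: restrict_l\<close>)
      then show ?thesis
        by (simp only: D_f restrict.hom_mult restrict.hom_prod mult_zero_left)
    qed
    then have "restrict j (\<Sum>i\<in>UNIV. b i * D i f) =
        (\<Sum>i\<in>UNIV. if i = j then restrict j (b j) * restrict j (D j f) else 0)"
      unfolding restrict.hom_sum restrict.hom_mult by (intro sum.cong) auto
    then show ?thesis
      using syz mpoly_no_zero_divisors restrict_D_f_nonzero[of j] by auto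
  qed
  then have "\<exists>q. b j = l j * q" for j
    using restrict_decomp[of "b j" j] by auto
  then obtain b' where b': "\<And>j. b j = l j * b' j" by metis
  have "(\<Prod>i\<in>UNIV. l i) * (\<Sum>j\<in>UNIV. h j * b' j) = (\<Sum>j\<in>UNIV. b j * D j f)"
    unfolding b' by (rule sum_D_f)
  then have "(\<Sum>j\<in>UNIV. h j * b' j) = 0"
    using syz mpoly_no_zero_divisors mpoly_prod_eq_0[of UNIV l] l_nonzero by auto
  then show "\<exists>b'. (\<forall>j. b j = l j * b' j) \<and> (\<Sum>j\<in>UNIV. h j * b' j) = 0"
    using b' by blast
next
  assume "\<exists>b'. (\<forall>j. b j = l j * b' j) \<and> (\<Sum>j\<in>UNIV. h j * b' j) = 0"
  then obtain b' where b': "\<And>j. b j = l j * b' j" "(\<Sum>j\<in>UNIV. h j * b' j) = 0" by blast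
  then show "(\<Sum>j\<in>UNIV. b j * D j f) = 0"
    unfolding b'(1) sum_D_f[symmetric] by simp
qed

lemma koszul_exact_at_1:
  fixes b :: "'a \<Rightarrow> 'a mpoly"
  shows "(\<Sum>j\<in>UNIV. b j * D j f) = 0 \<longleftrightarrow>
    (\<exists>w. cochain 2 w \<and> (\<forall>j. b j = l j * koszul h w {j}))"
proof
  assume "(\<Sum>j\<in>UNIV. b j * D j f) = 0"
  then obtain b' where b': "\<And>j. b j = l j * b' j" "(\<Sum>j\<in>UNIV. h j * b' j) = 0"
    unfolding syzygy_iff by blast
  define z where "z A = (if card A = 1 then b' (the_elem A) else 0)" for A :: "'a set"
  have z: "cochain 1 z" by (simp add: cochain_def z_def)
  have "koszul h z A = 0" for A
  proof (cases "A = {}")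
    case True
    then show ?thesis using b'(2) by (simp add: koszul_def z_def)
  next
    case False
    then have "card A \<noteq> 0" by simp
    then show ?thesis
      using cochain_koszul[of 0 z h] z by (simp add: cochain_def)
  qed
  then obtain w where "cochain 2 w" "z = koszul h w"
    using koszul_exact_h[OF z] by (auto simp: numeral_2_eq_2)
  moreover have "z {j} = b' j" for j by (simp add: z_def)
  ultimately show "\<exists>w. cochain 2 w \<and> (\<forall>j. b j = l j * koszul h w {j})"
    using b'(1) by metis
next
  assume "\<exists>w. cochain 2 w \<and> (\<forall>j. b j = l j * koszul h w {j})"
  then obtain w where w: "\<And>j. b j = l j * koszul h w {j}" by blast
  have "(\<Sum>j\<in>UNIV. h j * koszul h w {j}) = koszul h (koszul h w) {}"
    by (simp add: koszul_def[of h "koszul h w"])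
  then have "(\<Sum>j\<in>UNIV. h j * koszul h w {j}) = 0"
    by (simp add: koszul_koszul)
  then show "(\<Sum>j\<in>UNIV. b j * D j f) = 0"
    unfolding syzygy_iff using w by (intro exI[of _ "\<lambda>j. koszul h w {j}"]) simp
qed

text \<open>The Koszul matrices, except that the rows of the second map, indexed by singletons,
  carry the factor \<open>l\<close> of their element, and that the first map is the row of the
  \<open>D i f\<close>.\<close>

definition res_coeff :: "nat \<Rightarrow> 'a set \<Rightarrow> 'a \<Rightarrow> 'a mpoly" where
  "res_coeff k A i = (if k = 0 then D i f
     else if k = 1 then l (the_elem A) * (koszul_sign i A * h i) else koszul_sign i A * h i)"

lemma res_coeff_diff:
  shows "cochain_diff res_coeff 0 b A = (if A = {} then \<Sum>i\<in>UNIV. b {i} * D i f else 0)"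
    and "cochain_diff res_coeff 1 b A = (if card A = 1 then l (the_elem A) * koszul h b A else 0)"
    and "2 \<le> k \<Longrightarrow> cochain (Suc k) b \<Longrightarrow> cochain_diff res_coeff k b = koszul h b"
proof -
  show "cochain_diff res_coeff 0 b A = (if A = {} then \<Sum>i\<in>UNIV. b {i} * D i f else 0)"
    by (simp add: cochain_diff_def res_coeff_def mult.commute)
  show "cochain_diff res_coeff 1 b A = (if card A = 1 then l (the_elem A) * koszul h b A else 0)"
    by (simp add: cochain_diff_def res_coeff_def koszul_def sum_distrib_left mult.assoc)
  show "cochain_diff res_coeff k b = koszul h b" if "2 \<le> k" "cochain (Suc k) b"
  proof
    fix A
    have "koszul h b A = 0" if "card A \<noteq> k"
      using cochain_koszul[of k b h] \<open>cochain (Suc k) b\<close> that by (simp add: cochain_def)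
    then show "cochain_diff res_coeff k b A = koszul h b A"
      using that(1) by (auto simp: cochain_diff_def res_coeff_def koszul_def mult.assoc)
  qed
qed

lemma koszul_exact_iff:
  assumes "cochain (Suc k) b"
  shows "koszul h b = (\<lambda>_. 0) \<longleftrightarrow> (\<exists>w. cochain (Suc (Suc k)) w \<and> b = koszul h w)"
proof
  assume "koszul h b = (\<lambda>_. 0)"
  then show "\<exists>w. cochain (Suc (Suc k)) w \<and> b = koszul h w"
    using koszul_exact_h[OF assms] by simp
next
  assume "\<exists>w. cochain (Suc (Suc k)) w \<and> b = koszul h w"
  then obtain w where b: "b = koszul h w" by blast
  show "koszul h b = (\<lambda>_. 0)"
    unfolding b by (rule ext) (rule koszul_koszul)
qed

theorem minimal_resolution:
  "\<exists>\<epsilon> \<delta>. minimal_graded_free_resolution (jacobian_ideal f)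
    (\<lambda>k. replicate (CARD('a) choose k) (shift (CARD('a) - 1) e k)) \<epsilon> \<delta>"
proof (rule minimal_graded_free_resolution_of_cochains)
  show "shift (CARD('a) - 1) e 0 = 0" by (simp add: shift_def)
  show "shift (CARD('a) - 1) e k < shift (CARD('a) - 1) e (Suc k)" for k
    using g(2) card by (auto simp: shift_def)
  show "jacobian_ideal f = module.span (*) (range (res_coeff 0 {}))"
    by (simp add: jacobian_ideal_eq res_coeff_def[abs_def])
next
  fix k A i assume "card (A :: 'a set) = k"
  have sign: "koszul_sign i A * h i \<in> forms e"
    by (rule koszul_sign_mult_forms[OF h_forms])
  consider "k = 0" | "k = 1" | "2 \<le> k" by linarith
  then show "res_coeff k A i \<in> forms (shift (CARD('a) - 1) e (Suc k) - shift (CARD('a) - 1) e k)"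
  proof cases
    case 1
    then show ?thesis using D_f_forms[of i] by (simp add: res_coeff_def shift_def)
  next
    case 2
    then have "shift (CARD('a) - 1) e (Suc k) - shift (CARD('a) - 1) e k = 1 + e"
      using card by (simp add: shift_def)
    then show ?thesis using 2 forms_mult[OF l_forms sign] by (simp add: res_coeff_def)
  next
    case 3
    then show ?thesis using sign by (simp add: res_coeff_def shift_def)
  qed
next
  fix k and b :: "'a set \<Rightarrow> 'a mpoly" assume b: "cochain (Suc k) b"
  consider "k = 0" | "k = 1" | "2 \<le> k" by linarith
  then show "cochain_diff res_coeff k b = (\<lambda>_. 0) \<longleftrightarrow>
      (\<exists>w. cochain (Suc (Suc k)) w \<and> b = cochain_diff res_coeff (Suc k) w)"
  proof cases
    case 1
    \<comment> \<open>A 1-cochain amounts to its values on singletons, so exactness here is the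
      description of syzygies in \<open>koszul_exact_at_1\<close>.\<close>
    have "b = cochain_diff res_coeff 1 w \<longleftrightarrow> (\<forall>j. b {j} = l j * koszul h w {j})" for w
    proof
      assume *: "\<forall>j. b {j} = l j * koszul h w {j}"
      show "b = cochain_diff res_coeff 1 w"
      proof
        fix A show "b A = cochain_diff res_coeff 1 w A"
          using b 1 * by (cases "card A = 1")
            (auto simp: res_coeff_diff(2)[unfolded One_nat_def] cochain_def card_1_singleton_iff)
      qed
    next
      assume "b = cochain_diff res_coeff 1 w"
      then show "\<forall>j. b {j} = l j * koszul h w {j}"
        by (metis res_coeff_diff(2) is_singletonI is_singleton_altdef the_elem_eq)
    qed
    then show ?thesis
      using koszul_exact_at_1[of "\<lambda>j. b {j}"] 1
      by (auto simp: res_coeff_diff(1) fun_eq_iff[of "cochain_diff _ 0 _"] numeral_2_eq_2)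
  next
    case 2
    \<comment> \<open>Multiplying rows by nonzero forms does not change the kernel, and the next map
      is unmodified.\<close>
    have "cochain_diff res_coeff 1 b = (\<lambda>_. 0) \<longleftrightarrow> koszul h b = (\<lambda>_. 0)"
    proof
      assume "cochain_diff res_coeff 1 b = (\<lambda>_. 0)"
      then have "card A = 1 \<longrightarrow> l (the_elem A) * koszul h b A = 0" for A
        by (metis res_coeff_diff(2))
      then have "card A = 1 \<longrightarrow> koszul h b A = 0" for A
        using mpoly_no_zero_divisors l_nonzero by blast
      moreover have "card A \<noteq> 1 \<longrightarrow> koszul h b A = 0" for A
        using cochain_koszul[of 1 b h] b 2 by (simp add: cochain_def)
      ultimately show "koszul h b = (\<lambda>_. 0)" by blast
    qed (simp add: fun_eq_iff res_coeff_diff(2)[unfolded One_nat_def])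
    then show ?thesis
      using koszul_exact_iff[OF b] 2 res_coeff_diff(3)[of "Suc k"] by auto
  next
    case 3
    then show ?thesis
      using koszul_exact_iff[OF b] res_coeff_diff(3)[of k b] b
        res_coeff_diff(3)[of "Suc k"] by auto
  qed
qed

text \<open>The syzygy of the \<open>D j f\<close> that belongs to the 2-cochain \<open>w\<close>,
  transformed by \<open>c\<close> into a syzygy of the partial derivatives.\<close>

definition koszul_syzygy :: "('a set \<Rightarrow> 'a mpoly) \<Rightarrow> 'a \<Rightarrow> 'a mpoly" where
  "koszul_syzygy w i = (\<Sum>j\<in>UNIV. Const (c i j) * (l j * koszul h w {j}))"

lemma koszul_syzygy_forms:
  assumes "\<And>A. w A \<in> forms 0"
  shows "koszul_syzygy w i \<in> forms (e + 1)"
proof -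
  have "koszul h w A \<in> forms e" for A
    unfolding koszul_def
  proof (rule forms_sum)
    fix i assume "i \<in> - A"
    have "h i * w (insert i A) \<in> forms e"
      using forms_mult[OF h_forms assms] by simp
    then show "koszul_sign i A * h i * w (insert i A) \<in> forms e"
      by (simp add: mult.assoc koszul_sign_mult_forms)
  qed
  then show ?thesis
    unfolding koszul_syzygy_def
    using forms_mult[OF l_forms] by (intro forms_sum forms_mult_Const) fastforce
qed

lemma koszul_syzygy_inverse: "(\<Sum>i\<in>UNIV. Const (a j i) * koszul_syzygy w i) = l j * koszul h w {j}"
proof -
  have "(\<Sum>i\<in>UNIV. Const (a j i) * koszul_syzygy w i) =
      (\<Sum>k\<in>UNIV. Const (\<Sum>i\<in>UNIV. a j i * c i k) * (l k * koszul h w {k}))"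
    unfolding koszul_syzygy_def Const_sum sum_distrib_left sum_distrib_right
    by (subst sum.swap) (simp add: mult_single flip: mult.assoc)
  also have "\<dots> = (\<Sum>k\<in>UNIV. if j = k then l k * koszul h w {k} else 0)"
    by (rule sum.cong) (auto simp: ac)
  finally show ?thesis by simp
qed

lemma jacobian_syzygies_eq: "jacobian_syzygies f = koszul_syzygy ` {w. cochain 2 w}"
proof (intro subset_antisym subsetI)
  fix b assume "b \<in> jacobian_syzygies f"
  then have "(\<Sum>i\<in>UNIV. b i * partial_deriv i f) = 0"
    by (simp add: jacobian_syzygies_def)
  moreover define b' where "b' j = (\<Sum>i\<in>UNIV. Const (a j i) * b i)" for j
  have "(\<Sum>j\<in>UNIV. b' j * D j f) = (\<Sum>i\<in>UNIV. b i * partial_deriv i f)"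
    unfolding b'_def partial_deriv_eq sum_distrib_left sum_distrib_right
    by (subst sum.swap) (simp add: algebra_simps)
  ultimately obtain w where w: "cochain 2 w" "\<And>j. b' j = l j * koszul h w {j}"
    using koszul_exact_at_1[of b'] by auto
  have "b i = koszul_syzygy w i" for i
  proof -
    have "koszul_syzygy w i = (\<Sum>k\<in>UNIV. Const (\<Sum>j\<in>UNIV. c i j * a j k) * b k)"
      unfolding koszul_syzygy_def w(2)[symmetric] b'_def Const_sum sum_distrib_left sum_distrib_right
      by (subst sum.swap) (simp add: mult_single flip: mult.assoc)
    also have "\<dots> = (\<Sum>k\<in>UNIV. if i = k then b k else 0)"
      by (rule sum.cong) (auto simp: ca)
    finally show ?thesis by simp
  qed
  then show "b \<in> koszul_syzygy ` {w. cochain 2 w}"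
    using w(1) by blast
next
  fix b assume "b \<in> koszul_syzygy ` {w. cochain 2 w}"
  then obtain w where w: "cochain 2 w" "b = koszul_syzygy w" by blast
  have "(\<Sum>i\<in>UNIV. b i * partial_deriv i f) = (\<Sum>j\<in>UNIV. (l j * koszul h w {j}) * D j f)"
    unfolding w(2) koszul_syzygy_inverse[symmetric] partial_deriv_eq sum_distrib_left sum_distrib_right
    by (subst sum.swap) (simp add: algebra_simps)
  also have "\<dots> = 0"
    by (rule iffD2[OF koszul_exact_at_1]) (use w(1) in blast)
  finally show "b \<in> jacobian_syzygies f"
    by (simp add: jacobian_syzygies_def)
qed

text \<open>A relation among the generators of the syzygies is a boundary of the Koszul complex, so it has
  no constant coefficients.\<close>

theorem syzygies:
  "syzygy_hypersurface f (replicate (CARD('a) choose 2) (e + 1))"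
proof -
  let ?N = "CARD('a) choose 2"
  define u :: "nat \<Rightarrow> 'a set \<Rightarrow> 'a mpoly" where "u k A = (if A = subset_enum 2 k then 1 else 0)" for k A
  define \<rho> where "\<rho> k = koszul_syzygy (u k)" for k
  have span: "module.span fun_scale (\<rho> ` K) = range (\<lambda>r. \<Sum>k\<in>K. fun_scale (r k) (\<rho> k))"
    if "K \<subseteq> {..<?N}" for K
    using that by (intro span_image_finite[OF module_fun_scale]) (rule finite_subset, auto)
  have lin: "(\<Sum>k\<in>K. fun_scale (r k) (\<rho> k)) = koszul_syzygy (\<lambda>A. \<Sum>k\<in>K. r k * u k A)" for r K
  proof
    fix i
    have "(\<Sum>k\<in>K. fun_scale (r k) (\<rho> k)) i = (\<Sum>k\<in>K. r k * koszul_syzygy (u k) i)"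
      by (induction K rule: infinite_finite_induct) (auto simp: fun_scale_def \<rho>_def)
    also have "\<dots> = koszul_syzygy (\<lambda>A. \<Sum>k\<in>K. r k * u k A) i"
      unfolding koszul_syzygy_def koszul_sum koszul_mult sum_distrib_left
      by (subst sum.swap) (simp add: algebra_simps)
    finally show "(\<Sum>k\<in>K. fun_scale (r k) (\<rho> k)) i = koszul_syzygy (\<lambda>A. \<Sum>k\<in>K. r k * u k A) i" .
  qed
  have u_cochain: "cochain 2 (\<lambda>A. \<Sum>k\<in>K. r k * u k A)" if "K \<subseteq> {..<?N}" for r K
    unfolding cochain_def
  proof (intro allI impI sum.neutral ballI)
    fix A :: "'a set" and k assume "card A \<noteq> 2" "k \<in> K"
    then have "A \<noteq> subset_enum 2 k"
      using card_subset_enum[of k 2, where 'v = 'a] that by auto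
    then show "r k * u k A = 0" by (simp add: u_def)
  qed
  have "range (\<lambda>r. \<Sum>k\<in>{..<?N}. fun_scale (r k) (\<rho> k)) = jacobian_syzygies f"
  proof (intro subset_antisym subsetI)
    fix b assume "b \<in> range (\<lambda>r. \<Sum>k\<in>{..<?N}. fun_scale (r k) (\<rho> k))"
    then show "b \<in> jacobian_syzygies f"
      using u_cochain by (auto simp: lin jacobian_syzygies_eq)
  next
    fix b assume "b \<in> jacobian_syzygies f"
    then obtain w where w: "cochain 2 w" "b = koszul_syzygy w"
      by (auto simp: jacobian_syzygies_eq)
    have "w A = (\<Sum>k\<in>{..<?N}. w (subset_enum 2 k) * u k A)" for A
    proof (cases "card A = 2")
      case True
      have "(\<Sum>k\<in>{..<?N}. w (subset_enum 2 k) * u k A) =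
          (\<Sum>k\<in>{..<?N}. if k = subset_index 2 A then w A else 0)"
        using subset_index[OF True] subset_index_subset_enum[of _ 2, where 'v = 'a]
        by (intro sum.cong) (auto simp: u_def)
      then show ?thesis using subset_index(1)[OF True] by simp
    next
      case False
      then show ?thesis
        using w(1) u_cochain[of "{..<?N}" "\<lambda>k. w (subset_enum 2 k)"] by (simp add: cochain_def)
    qed
    then have "w = (\<lambda>A. \<Sum>k\<in>{..<?N}. w (subset_enum 2 k) * u k A)" by blast
    then show "b \<in> range (\<lambda>r. \<Sum>k\<in>{..<?N}. fun_scale (r k) (\<rho> k))"
      unfolding lin w(2) by (intro range_eqI[of _ _ "\<lambda>k. w (subset_enum 2 k)"]) simp
  qed
  then have generate: "module.span fun_scale (\<rho> ` {..<?N}) = jacobian_syzygies f"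
    by (simp add: span)
  have "module.span fun_scale (\<rho> ` K) \<noteq> jacobian_syzygies f" if K: "K \<subset> {..<?N}" for K
  proof
    assume eq: "module.span fun_scale (\<rho> ` K) = jacobian_syzygies f"
    obtain k0 where k0: "k0 < ?N" "k0 \<notin> K" using K by auto
    have finK: "finite K" using K finite_subset by auto
    have "\<rho> k0 \<in> module.span fun_scale (\<rho> ` {..<?N})"
      by (rule module.span_base[OF module_fun_scale]) (use k0 in auto)
    then have "\<rho> k0 \<in> module.span fun_scale (\<rho> ` K)"
      by (simp only: generate eq)
    then obtain r where r: "\<rho> k0 = (\<Sum>k\<in>K. fun_scale (r k) (\<rho> k))"
      unfolding span[OF psubset_imp_subset[OF K]] by blast
    \<comment> \<open>The coefficients of the supposed relation, all on one side. The coefficient 1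
      at \<open>k0\<close> is what cannot lie in the irrelevant ideal.\<close>
    define s where "s k = (if k = k0 then 1 else - r k)" for k
    define w where "w A = (\<Sum>k\<in>insert k0 K. s k * u k A)" for A
    have w: "cochain 2 w"
      unfolding w_def[abs_def] using K k0 by (intro u_cochain) auto
    have "koszul_syzygy w = (\<Sum>k\<in>insert k0 K. fun_scale (s k) (\<rho> k))"
      unfolding w_def[abs_def] lin ..
    also have "\<dots> = \<rho> k0 + (\<Sum>k\<in>K. fun_scale (s k) (\<rho> k))"
      using finK k0 by (simp add: s_def fun_scale_def)
    also have "(\<Sum>k\<in>K. fun_scale (s k) (\<rho> k)) = - (\<Sum>k\<in>K. fun_scale (r k) (\<rho> k))"
      unfolding sum_negf[symmetric] using k0(2)
      by (intro sum.cong) (auto simp: s_def fun_scale_def fun_eq_iff)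
    finally have "koszul_syzygy w = 0" using r by (simp add: zero_fun_def)
    then have "l j * koszul h w {j} = 0" for j
      using koszul_syzygy_inverse[of j w] by simp
    then have "koszul h w {j} = 0" for j
      using mpoly_no_zero_divisors l_nonzero by blast
    moreover have "cochain 1 (koszul h w)"
      using cochain_koszul[of 1 w h] w by (simp add: numeral_2_eq_2)
    ultimately have "koszul h w A = 0" for A
      by (cases "card A = 1") (auto simp: cochain_def card_1_singleton_iff)
    then obtain w' where w': "w = koszul h w'"
      using koszul_exact_h[OF w] by auto
    have "h i \<in> irrelevant_ideal" for i
      by (rule form_in_irrelevant_ideal[OF h_forms g(2)])
    then have "(\<Sum>i\<in>-A. (koszul_sign i A * w' (insert i A)) * h i) \<in> irrelevant_ideal" for A
      by (intro ideal_sum[OF ideal_irrelevant] ideal_mult[OF ideal_irrelevant])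
    then have "w A \<in> irrelevant_ideal" for A
      by (simp add: w' koszul_def algebra_simps)
    moreover have "w (subset_enum 2 k0) = 1"
    proof -
      have "(\<Sum>k\<in>K. s k * u k (subset_enum 2 k0)) = 0"
        using K k0 subset_enum_eq_iff[OF _ k0(1)]
        by (intro sum.neutral) (auto simp: u_def)
      then show ?thesis using finK k0 by (simp add: w_def s_def u_def)
    qed
    ultimately show False using one_notin_irrelevant_ideal by metis
  qed
  moreover have "\<rho> k j \<in> forms (e + 1)" for k j
    unfolding \<rho>_def by (rule koszul_syzygy_forms) (simp add: u_def)
  ultimately show ?thesis
    unfolding syzygy_hypersurface_def using generate
    by (intro conjI exI[of _ \<rho>]) (auto simp: sorted_replicate)
qed

end

lemma vec_nth_vec_lambda: "($) (\<chi> i. f i) = f"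
  by (simp add: fun_eq_iff)

section \<open>Complex linear forms and holomorphic maps\<close>

definition linear_form :: "(complex ^ 'v \<Rightarrow> complex) \<Rightarrow> bool" where
  "linear_form \<phi> \<longleftrightarrow> (\<forall>x y. \<phi> (x + y) = \<phi> x + \<phi> y) \<and> (\<forall>c x. \<phi> (c *s x) = c * \<phi> x)"

lemma linear_form_add: "linear_form \<phi> \<Longrightarrow> \<phi> (x + y) = \<phi> x + \<phi> y"
  and linear_form_scale: "linear_form \<phi> \<Longrightarrow> \<phi> (c *s x) = c * \<phi> x"
  by (auto simp: linear_form_def)

lemma linear_form_0: "linear_form \<phi> \<Longrightarrow> \<phi> 0 = 0"
  using linear_form_scale[of \<phi> 0 0] by simp

lemma linear_form_sum: "linear_form \<phi> \<Longrightarrow> \<phi> (\<Sum>i\<in>A. x i) = (\<Sum>i\<in>A. \<phi> (x i))"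
  by (induction A rule: infinite_finite_induct) (auto simp: linear_form_0 linear_form_add)

lemma linear_form_axis:
  fixes x :: "complex ^ 'v::finite"
  assumes "linear_form \<phi>"
  shows "\<phi> x = (\<Sum>i\<in>UNIV. x $ i * \<phi> (axis i 1))"
  by (subst basis_expansion[of x, symmetric])
    (simp add: linear_form_sum[OF assms] linear_form_scale[OF assms])

text \<open>A complex vector space is not a finite union of proper subspaces.\<close>

lemma linear_forms_common_nonzero:
  fixes V :: "(complex ^ 'v) set"
  assumes "finite \<Phi>" "\<And>\<phi>. \<phi> \<in> \<Phi> \<Longrightarrow> linear_form \<phi>" "\<And>\<phi>. \<phi> \<in> \<Phi> \<Longrightarrow> \<exists>v\<in>V. \<phi> v \<noteq> 0"
    and V: "0 \<in> V" "\<And>x y. x \<in> V \<Longrightarrow> y \<in> V \<Longrightarrow> x + y \<in> V" "\<And>c x. x \<in> V \<Longrightarrow> c *s x \<in> V"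
  shows "\<exists>v\<in>V. \<forall>\<phi>\<in>\<Phi>. \<phi> v \<noteq> 0"
  using assms(1-3)
proof (induction \<Phi> rule: finite_induct)
  case empty
  show ?case using V(1) by auto
next
  case (insert \<phi> \<Phi>)
  then obtain v w where v: "v \<in> V" "\<And>\<psi>. \<psi> \<in> \<Phi> \<Longrightarrow> \<psi> v \<noteq> 0" and w: "w \<in> V" "\<phi> w \<noteq> 0"
    by (metis insertCI)
  have "finite {t. \<psi> (v + t *s w) = 0}" if "\<psi> \<in> insert \<phi> \<Phi>" for \<psi>
  proof -
    have \<psi>: "linear_form \<psi>" "\<psi> v \<noteq> 0 \<or> \<psi> w \<noteq> 0" using that insert.prems v w by auto
    \<comment> \<open>On the line through \<open>v\<close> in direction \<open>w\<close> a form has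
      at most one zero. If it vanishes at \<open>w\<close> it is a nonzero constant there; the
      quotient by zero then bounds an empty set.\<close>
    have "{t. \<psi> (v + t *s w) = 0} \<subseteq> {- \<psi> v / \<psi> w}"
    proof
      fix t assume "t \<in> {t. \<psi> (v + t *s w) = 0}"
      then have "\<psi> v + t * \<psi> w = 0"
        by (simp add: linear_form_add[OF \<psi>(1)] linear_form_scale[OF \<psi>(1)])
      then show "t \<in> {- \<psi> v / \<psi> w}"
        using \<psi>(2) by (cases "\<psi> w = 0") (auto simp: field_simps add_eq_0_iff)
    qed
    then show ?thesis by (rule finite_subset) simp
  qed
  then have "finite (\<Union>\<psi>\<in>insert \<phi> \<Phi>. {t. \<psi> (v + t *s w) = 0})"
    using insert.hyps by blast
  then obtain t where "t \<notin> (\<Union>\<psi>\<in>insert \<phi> \<Phi>. {t. \<psi> (v + t *s w) = 0})"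
    using ex_new_if_finite infinite_UNIV_char_0 by blast
  then show ?case using V v(1) w(1) by (intro bexI[of _ "v + t *s w"]) auto
qed

text \<open>Gaussian elimination: a nonzero entry in equation \<open>j\<close> is the pivot that
  removes this equation together with the unknown \<open>k0\<close>.\<close>

lemma underdetermined_system:
  fixes b :: "'i \<Rightarrow> 'k \<Rightarrow> 'a::field"
  assumes "finite I" "finite K" "card I < card K"
  shows "\<exists>u. (\<exists>k\<in>K. u k \<noteq> 0) \<and> (\<forall>i\<in>I. (\<Sum>k\<in>K. u k * b i k) = 0)"
  using assms
proof (induction I arbitrary: K b rule: finite_induct)
  case empty
  then show ?case by (intro exI[of _ "\<lambda>_. 1"]) (auto simp: card_gt_0_iff)
next
  case (insert j I)
  show ?case
  proof (cases "\<forall>k\<in>K. b j k = 0")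
    case True
    then show ?thesis
      using insert.IH[of K b] insert.prems insert.hyps by auto
  next
    case False
    then obtain k0 where k0: "k0 \<in> K" "b j k0 \<noteq> 0" by auto
    have "card I < card (K - {k0})"
      using insert.prems insert.hyps k0(1) by simp
    then obtain u where u: "\<exists>k\<in>K - {k0}. u k \<noteq> 0"
      "\<And>i. i \<in> I \<Longrightarrow> (\<Sum>k\<in>K - {k0}. u k * (b i k - b i k0 * b j k / b j k0)) = 0"
      using insert.IH[of "K - {k0}" "\<lambda>i k. b i k - b i k0 * b j k / b j k0"] insert.prems(1)
      by auto
    define s where "s = (\<Sum>k\<in>K - {k0}. u k * b j k)"
    \<comment> \<open>The eliminated unknown gets the value that solves equation
      \<open>j\<close>.\<close>
    define u' where "u' = u(k0 := - s / b j k0)"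
    have sum: "(\<Sum>k\<in>K. u' k * b i k) = - s / b j k0 * b i k0 + (\<Sum>k\<in>K - {k0}. u k * b i k)" for i
      using k0(1) insert.prems(1) by (simp add: sum.remove u'_def)
    have "(\<Sum>k\<in>K. u' k * b i k) = 0" if "i \<in> insert j I" for i
    proof (cases "i = j")
      case True
      then show ?thesis using k0(2) by (simp add: sum s_def)
    next
      case False
      then have "(\<Sum>k\<in>K - {k0}. u k * b i k) - (\<Sum>k\<in>K - {k0}. u k * (b i k0 * b j k / b j k0)) = 0"
        using u(2)[of i] that by (simp add: right_diff_distrib sum_subtractf)
      moreover have "(\<Sum>k\<in>K - {k0}. u k * (b i k0 * b j k / b j k0)) = s / b j k0 * b i k0"
        unfolding s_def sum_divide_distrib sum_distrib_right by (rule sum.cong) auto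
      ultimately show ?thesis by (simp add: sum)
    qed
    moreover have "\<exists>k\<in>K. u' k \<noteq> 0" using u(1) by (auto simp: u'_def)
    ultimately show ?thesis by blast
  qed
qed

lemma linear_forms_common_zero:
  fixes \<phi> :: "'i \<Rightarrow> complex ^ 'v::finite \<Rightarrow> complex"
  assumes "finite I" "card I < CARD('v)" "\<And>i. i \<in> I \<Longrightarrow> linear_form (\<phi> i)"
  shows "\<exists>v. v \<noteq> 0 \<and> (\<forall>i\<in>I. \<phi> i v = 0)"
proof -
  obtain u where u: "\<exists>k. u k \<noteq> 0" "\<forall>i\<in>I. (\<Sum>k\<in>UNIV. u k * \<phi> i (axis k 1)) = 0"
    using underdetermined_system[of I "UNIV :: 'v set" "\<lambda>i k. \<phi> i (axis k 1)"] assms by auto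
  have "\<phi> i (\<chi> k. u k) = 0" if "i \<in> I" for i
    using linear_form_axis[OF assms(3)[OF that], of "\<chi> k. u k"] u(2) that by simp
  moreover have "(\<chi> k. u k) \<noteq> 0" using u(1) by (auto simp: vec_eq_iff)
  ultimately show ?thesis by blast
qed

section \<open>Complex derivatives along lines\<close>

lemma bounded_linear_axis: "bounded_linear (axis k :: 'a::real_normed_vector \<Rightarrow> 'a ^ 'v::finite)"
proof (rule bounded_linear_intro[where K = 1])
  show "norm (axis k x :: 'a ^ 'v) \<le> norm x * 1" for x :: 'a
  proof -
    have "(\<Sum>i\<in>UNIV. (norm (axis k x $ i :: 'a))\<^sup>2) = (\<Sum>i\<in>UNIV. if i = k then (norm x)\<^sup>2 else 0)"
      by (rule sum.cong) (auto simp: axis_def)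
    then show ?thesis by (simp add: norm_vec_def L2_set_def)
  qed
qed (auto simp: axis_def vec_eq_iff)

lemma has_derivative_vec_lambda:
  fixes f :: "'v::finite \<Rightarrow> 'a::real_normed_vector \<Rightarrow> 'b::real_normed_vector"
  assumes "\<And>k. (f k has_derivative f' k) F"
  shows "((\<lambda>x. \<chi> k. f k x) has_derivative (\<lambda>v. \<chi> k. f' k v)) F"
proof -
  have sum: "(\<chi> k. g k) = (\<Sum>k\<in>UNIV. axis k (g k))" for g :: "'v \<Rightarrow> 'b"
    by (simp add: vec_eq_iff axis_def)
  show ?thesis
    unfolding sum
    by (intro has_derivative_sum bounded_linear.has_derivative[OF bounded_linear_axis] assms)
qed

lemma bounded_linear_vec_scale: "bounded_linear (\<lambda>t::complex. t *s (v :: complex ^ 'v::finite))"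
proof -
  have "((\<lambda>t::complex. \<chi> k. t * v $ k) has_derivative (\<lambda>t. \<chi> k. t * v $ k)) (at 0)"
    by (intro has_derivative_vec_lambda derivative_eq_intros) auto
  then show ?thesis
    unfolding vector_scalar_mult_def by (rule has_derivative_bounded_linear)
qed

text \<open>Complex homogeneity of the real derivative is what gives a complex derivative in the
  parameter of the line.\<close>

lemma directional_derivative:
  fixes F :: "complex ^ 'v::finite \<Rightarrow> complex"
  assumes "(F has_derivative F') (at p)" "\<And>c v. F' (c *s v) = c * F' v"
  shows "((\<lambda>t. F (p + t *s v)) has_field_derivative F' v) (at 0)"
proof -
  have "((\<lambda>t. p + t *s v) has_derivative (\<lambda>t. t *s v)) (at 0)"
    using has_derivative_add[OF has_derivative_const
        bounded_linear_imp_has_derivative[OF bounded_linear_vec_scale]] by simp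
  moreover have "(F has_derivative F') (at (p + 0 *s v))" using assms(1) by simp
  ultimately have "((\<lambda>t. F (p + t *s v)) has_derivative (\<lambda>t. F' (t *s v))) (at 0)"
    by (rule has_derivative_compose)
  moreover have "(\<lambda>t. F' (t *s v)) = (*) (F' v)"
    by (simp add: fun_eq_iff assms(2))
  ultimately show ?thesis
    by (simp add: has_field_derivative_def)
qed

lemma has_field_derivative_quotient_limit:
  fixes q :: "complex \<Rightarrow> complex"
  assumes "(q has_field_derivative D) (at 0)" "q 0 = 0"
  shows "((\<lambda>t. q t / t) \<longlongrightarrow> D) (at 0)"
  using assms by (simp add: has_field_derivative_iff)

text \<open>Convergence after division by the higher power forces the limit for the lower power to
  be 0. Used in both directions to compare orders of vanishing.\<close>

lemma leading_coefficient_unique: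
  fixes \<phi> :: "complex \<Rightarrow> complex"
  assumes "((\<lambda>t. \<phi> t / t ^ r) \<longlongrightarrow> A) (at 0)" "((\<lambda>t. \<phi> t / t ^ s) \<longlongrightarrow> B) (at 0)" "r < s"
  shows "A = 0"
proof -
  have "((\<lambda>t. \<phi> t / t ^ s * t ^ (s - r)) \<longlongrightarrow> B * 0 ^ (s - r)) (at 0)"
    by (intro tendsto_mult assms(2) tendsto_power tendsto_ident_at)
  moreover have "\<forall>\<^sub>F t in at 0. \<phi> t / t ^ s * t ^ (s - r) = \<phi> t / t ^ r"
  proof (rule eventually_mono[OF eventually_neq_at_within[of 0]])
    fix t :: complex assume "t \<noteq> 0"
    have "t ^ s = t ^ r * t ^ (s - r)" using assms(3) by (simp flip: power_add)
    with \<open>t \<noteq> 0\<close> show "\<phi> t / t ^ s * t ^ (s - r) = \<phi> t / t ^ r"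
      by simp
  qed
  ultimately have "((\<lambda>t. \<phi> t / t ^ r) \<longlongrightarrow> B * 0 ^ (s - r)) (at 0)"
    by (rule Lim_transform_eventually)
  then have "A = B * 0 ^ (s - r)"
    using assms(1) by (intro tendsto_unique) auto
  then show ?thesis using assms(3) by simp
qed

lemma tendsto_along_line:
  fixes p v :: "complex ^ 'v::finite"
  shows "((\<lambda>t. p + t *s v) \<longlongrightarrow> p) (at 0)"
proof -
  have "((\<lambda>t. p + t *s v) \<longlongrightarrow> p + 0 *s v) (at 0)"
    by (intro tendsto_add tendsto_const bounded_linear.tendsto[OF bounded_linear_vec_scale] tendsto_ident_at)
  then show ?thesis by simp
qed

lemma eventually_along_line:
  fixes p v :: "complex ^ 'v::finite"
  assumes "open U" "p \<in> U"
  shows "\<forall>\<^sub>F t in at 0. p + t *s v \<in> U"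
  using tendsto_along_line assms by (rule topological_tendstoD)

lemma holomorphic_fun_derivative:
  assumes "holomorphic_fun U \<psi>" "p \<in> U"
  shows "\<exists>\<psi>'. (\<psi> has_derivative \<psi>') (at p) \<and> linear_form \<psi>'"
proof -
  obtain \<psi>' where \<psi>': "(\<psi> has_derivative \<psi>') (at p)" "\<And>c v. \<psi>' (c *s v) = c * \<psi>' v"
    using assms by (auto simp: holomorphic_fun_def)
  then have "linear_form \<psi>'"
    using has_derivative_bounded_linear[OF \<psi>'(1)]
    by (auto simp: linear_form_def linear_add bounded_linear.linear)
  with \<psi>'(1) show ?thesis by blast
qed

text \<open>The differentials of the n coordinates kill only the direction of the cone, which the
  additional equation at \<open>i0\<close> excludes. In a direction \<open>v\<close> killed by all
  of them, the lift \<sigma> of Y is stationary to first order while it remains proportional to the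
  moving point; this forces \<open>v\<close> to be 0.\<close>

lemma analytic_coordinates_derivative_kernel:
  fixes p v :: "complex ^ 'n::finite option"
  assumes Y: "analytic_coordinates U Y" "p \<in> U"
    and Y': "\<And>k. ((\<lambda>x. Y x $ k) has_derivative Y' k) (at p)" "\<And>k. linear_form (Y' k)"
    and i0: "p $ i0 \<noteq> 0" and v: "\<And>k. Y' k v = 0" "v $ i0 = 0"
  shows "v = 0"
proof -
  obtain \<sigma> where \<sigma>: "holomorphic_map (Y ` U) \<sigma>" "\<And>x. x \<in> U \<Longrightarrow> \<exists>c. c \<noteq> 0 \<and> \<sigma> (Y x) = c *s x"
    using Y(1) by (auto simp: analytic_coordinates_def)
  have "open U"
    using Y(1) by (auto simp: analytic_coordinates_def holomorphic_map_def holomorphic_fun_def)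
  define A where "A i t = \<sigma> (Y (p + t *s v)) $ i" for i t
  have A': "(A i has_field_derivative 0) (at 0)" for i
  proof -
    obtain \<sigma>' where \<sigma>': "((\<lambda>y. \<sigma> y $ i) has_derivative \<sigma>') (at (Y p))" "linear_form \<sigma>'"
      using holomorphic_fun_derivative[of "Y ` U" "\<lambda>y. \<sigma> y $ i" "Y p"] \<sigma>(1) Y(2)
      by (auto simp: holomorphic_map_def)
    have "((\<lambda>x. \<chi> k. Y x $ k) has_derivative (\<lambda>w. \<chi> k. Y' k w)) (at p)"
      by (rule has_derivative_vec_lambda) (rule Y'(1))
    then have "(Y has_derivative (\<lambda>w. \<chi> k. Y' k w)) (at p)" by simp
    from has_derivative_compose[OF this \<sigma>'(1)]
    have "((\<lambda>x. \<sigma> (Y x) $ i) has_derivative (\<lambda>w. \<sigma>' (\<chi> k. Y' k w))) (at p)" .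
    moreover have "\<sigma>' (\<chi> k. Y' k (c *s w)) = c * \<sigma>' (\<chi> k. Y' k w)" for c w
    proof -
      have "(\<chi> k. Y' k (c *s w)) = c *s (\<chi> k. Y' k w)"
        by (simp add: vec_eq_iff linear_form_scale[OF Y'(2)])
      then show ?thesis by (simp add: linear_form_scale[OF \<sigma>'(2)])
    qed
    ultimately have "((\<lambda>t. \<sigma> (Y (p + t *s v)) $ i) has_field_derivative \<sigma>' (\<chi> k. Y' k v)) (at 0)"
      by (rule directional_derivative)
    moreover have "(\<chi> k. Y' k v) = 0" by (simp add: vec_eq_iff v(1))
    ultimately show ?thesis
      by (simp add: A_def[abs_def] linear_form_0[OF \<sigma>'(2)])
  qed
  have "v $ i = 0" for i
  proof -
    \<comment> \<open>The 2 by 2 minor of the lift and the point in rows \<open>i\<close> and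
      \<open>i0\<close>. It vanishes by proportionality, and its derivative at 0 isolates
      \<open>v $ i\<close>.\<close>
    define B where "B t = A i t * p $ i0 - A i0 t * (p $ i + t * v $ i)" for t
    have "(B has_field_derivative - (A i0 0 * v $ i)) (at 0)"
      unfolding B_def[abs_def] by (auto intro!: derivative_eq_intros A')
    moreover have "B t = 0" if "p + t *s v \<in> U" for t
      using \<sigma>(2)[OF that] v(2) by (auto simp: B_def A_def algebra_simps)
    then have "\<forall>\<^sub>F t in nhds 0. B t = 0"
      using eventually_along_line[OF \<open>open U\<close> Y(2), of v] Y(2)
      by (auto simp: eventually_nhds_conv_at elim: eventually_mono)
    then have "(B has_field_derivative 0) (at 0)"
      using DERIV_cong_ev[of 0 0 B "\<lambda>_. 0" 0 0] by simp
    ultimately have "A i0 0 * v $ i = 0"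
      using DERIV_unique by fastforce
    moreover have "A i0 0 \<noteq> 0"
      using \<sigma>(2)[OF Y(2)] i0 by (auto simp: A_def)
    ultimately show ?thesis by simp
  qed
  then show ?thesis by (simp add: vec_eq_iff)
qed


section \<open>Normal crossings and common zeros\<close>

context hyperplane_coordinates
begin

lemma linear_form_l: "linear_form (\<lambda>v. eval_mpoly (l j) (($) v))"
  by (simp add: linear_form_def l_eq eval_hom algebra_simps
      sum.distrib sum_distrib_left)

lemma sum_partial_deriv_eq:
  "(\<Sum>i\<in>UNIV. eval_mpoly (partial_deriv i p) x * v $ i) =
    (\<Sum>j\<in>UNIV. eval_mpoly (D j p) x * eval_mpoly (l j) (($) v))"
  unfolding partial_deriv_eq l_eq
  by (simp add: eval_hom sum_distrib_left sum_distrib_right,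
      subst sum.swap, simp add: algebra_simps)

end

text \<open>At a point \<open>p\<close> of \<open>V\<close>, the leading form of \<open>f\<close> is on the one hand a multiple of the product of
  \<open>dg\<close> and of the \<open>l j\<close> vanishing at \<open>p\<close>, and on the other hand a multiple of the product of the
  differentials \<open>m k\<close> of the coordinates. So each \<open>m k\<close> is proportional to a factor of the former
  product. If \<open>dg\<close> is a combination of the \<open>l j\<close>, the \<open>m k\<close> are dependent for reasons of dimension.\<close>

lemma normal_crossing_nondegenerate:
  fixes l :: "'n::finite option \<Rightarrow> 'n option mpoly"
  assumes "hyperplane_coordinates l a c"
    and g: "g \<in> forms e" "0 < e" "smooth_hypersurface g"
    and nc: "normal_crossing_divisor (g * (\<Prod>j\<in>UNIV. l j))"
    and zero: "\<And>j. eval_mpoly (l j) q * eval_mpoly (hyperplane_coordinates.D c j g) q = 0"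
  shows "q = (\<lambda>_. 0)"
proof (rule ccontr)
  interpret hyperplane_coordinates l a c by fact
  assume "q \<noteq> (\<lambda>_. 0)"
  define p where "p = (\<chi> i. q i)"
  have q: "q = ($) p" by (simp add: p_def fun_eq_iff)
  obtain i0 where i0: "p $ i0 \<noteq> 0" using \<open>q \<noteq> (\<lambda>_. 0)\<close> q by auto
  then have "p \<noteq> 0" by auto
  define L where "L j v = eval_mpoly (l j) (($) v)" for j v
  define G where "G v = (\<Sum>i\<in>UNIV. eval_mpoly (partial_deriv i g) (($) p) * v $ i)" for v
  define I where "I = {j. L j p = 0}"
  have L: "linear_form (L j)" for j
    unfolding L_def[abs_def] by (rule linear_form_l)
  have G: "linear_form G"
    by (simp add: linear_form_def G_def algebra_simps sum.distrib sum_distrib_left)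
  \<comment> \<open>Summing the hypothesis over j gives a multiple of \<open>g\<close> by Euler's
    identity, so the point lies on W.\<close>
  have "eval_mpoly (\<Sum>j\<in>UNIV. l j * D j g) q = 0"
    by (simp only: eval_hom zero sum.neutral_const)
  then have gp: "eval_mpoly g (($) p) = 0"
    unfolding euler_identity_D[OF g(1)] using g(2) by (simp add: eval_mpoly.hom_mult q flip: single_of_nat)
  have G_nonzero: "\<exists>v. G v \<noteq> 0"
  proof -
    obtain i where "eval_mpoly (partial_deriv i g) (($) p) \<noteq> 0"
      using g(3) gp \<open>p \<noteq> 0\<close> by (auto simp: smooth_hypersurface_def hypersurface_def)
    moreover have "G (axis i 1) = eval_mpoly (partial_deriv i g) (($) p)"
      by (simp add: G_def axis_def if_distrib[of "\<lambda>x. _ * x"] cong: if_cong)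
    ultimately show ?thesis by metis
  qed
  have L_nonzero: "\<exists>v. L j v \<noteq> 0" for j
    using eval_l_point[of j j] by (intro exI[of _ "\<chi> i. c i j"]) (simp add: L_def vec_nth_vec_lambda)
  \<comment> \<open>Outside \<open>I\<close> the form \<open>l j\<close> does not vanish at
    \<open>p\<close>, so \<open>D j g\<close> does: the differential of \<open>g\<close> involves
    only the \<open>L j\<close> with j in \<open>I\<close>.\<close>
  have G_I: "G v = 0" if "\<And>j. j \<in> I \<Longrightarrow> L j v = 0" for v
  proof -
    have "eval_mpoly (D j g) (($) p) * L j v = 0" for j
      using that[of j] zero[of j] by (auto simp: I_def L_def q)
    then show ?thesis
      unfolding G_def sum_partial_deriv_eq by (intro sum.neutral ballI) (simp only: L_def)
  qed
  define f where "f = g * (\<Prod>j\<in>UNIV. l j)"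
  have f_eval: "eval_mpoly f (($) x) = eval_mpoly g (($) x) * (\<Prod>j\<in>UNIV. L j x)" for x
    by (simp add: f_def eval_hom L_def)
  have "p \<in> hypersurface f"
    using \<open>p \<noteq> 0\<close> by (simp add: hypersurface_def f_eval gp)
  then obtain U Y R u where U: "p \<in> U" "analytic_coordinates U Y" "Y p = 0"
    "holomorphic_fun U u" "\<And>x. x \<in> U \<Longrightarrow> u x \<noteq> 0"
    "\<And>x. x \<in> U \<Longrightarrow> eval_mpoly f (($) x) = u x * (\<Prod>k\<in>R. Y x $ k)"
    using nc unfolding normal_crossing_divisor_def f_def[symmetric] by metis
  have Y_hol: "holomorphic_fun U (\<lambda>x. Y x $ k)" for k
    using U(2) by (auto simp: analytic_coordinates_def holomorphic_map_def)
  have "open U" using U(4) by (simp add: holomorphic_fun_def)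
  have "\<exists>m. ((\<lambda>x. Y x $ k) has_derivative m) (at p) \<and> linear_form m" for k
    using holomorphic_fun_derivative[OF Y_hol U(1)] .
  then obtain m where m: "\<And>k. ((\<lambda>x. Y x $ k) has_derivative m k) (at p)" "\<And>k. linear_form (m k)"
    by metis
  have kernel: "v = 0" if "\<And>k. m k v = 0" "v $ i0 = 0" for v
    using analytic_coordinates_derivative_kernel[OF U(2,1) m i0 that] .
  have coord: "linear_form (\<lambda>v. v $ i0)" by (simp add: linear_form_def)
  have m_nonzero: "\<exists>v. m k v \<noteq> 0" for k
  proof (rule ccontr)
    assume *: "\<not> ?thesis"
    \<comment> \<open>If one differential were zero, the other n - 1 together with the equation at
      \<open>i0\<close>, encoded by \<open>None\<close>, would be n equations in n + 1 unknowns, and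
      a nonzero solution would contradict \<open>kernel\<close>.\<close>
    have "card (insert None (Some ` (UNIV - {k}))) = CARD('n)"
      by (subst card_insert_disjoint) (auto simp: card_image card_Suc_Diff1)
    moreover define \<psi> where "\<psi> i v = (case i of None \<Rightarrow> v $ i0 | Some k \<Rightarrow> m k v)" for i v
    have "linear_form (\<psi> i)" for i
      using coord m(2) by (cases i) (simp_all add: \<psi>_def[abs_def])
    ultimately obtain v where v: "v \<noteq> 0" "\<forall>i\<in>insert None (Some ` (UNIV - {k})). \<psi> i v = 0"
      using linear_forms_common_zero[of "insert None (Some ` (UNIV - {k}))" \<psi>]
      by (auto simp: card_UNIV_option)
    then have "v $ i0 = 0" and "\<And>k'. k' \<noteq> k \<Longrightarrow> m k' v = 0"
      by (auto simp: \<psi>_def)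
    then have "m k' v = 0" for k' using * by (cases "k' = k") auto
    then show False using kernel[of v] \<open>v $ i0 = 0\<close> v(1) by auto
  qed
  define K where "K = (\<Prod>j\<in>-I. L j p)"
  have K: "K \<noteq> 0" by (auto simp: K_def I_def)
  have lim_left: "((\<lambda>t. eval_mpoly f (($) (p + t *s v)) / t ^ Suc (card I)) \<longlongrightarrow>
      G v * (\<Prod>j\<in>I. L j v) * K) (at 0)" for v
  proof -
    have "((\<lambda>t. eval_mpoly g (($) (p + t *s v))) has_field_derivative G v) (at 0)"
      unfolding G_def by (rule directional_derivative[OF has_derivative_eval_mpoly])
        (simp add: sum_distrib_left algebra_simps)
    then have "((\<lambda>t. eval_mpoly g (($) (p + t *s v)) / t) \<longlongrightarrow> G v) (at 0)"
      by (rule has_field_derivative_quotient_limit) (simp add: gp)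
    moreover have "((\<lambda>t. \<Prod>j\<in>-I. L j (p + t *s v)) \<longlongrightarrow> K) (at 0)"
      unfolding K_def
    proof (rule tendsto_prod)
      fix j
      have "((\<lambda>t. L j p + t * L j v) \<longlongrightarrow> L j p + 0 * L j v) (at 0)"
        by (intro tendsto_intros)
      then show "((\<lambda>t. L j (p + t *s v)) \<longlongrightarrow> L j p) (at 0)"
        by (simp add: linear_form_add[OF L] linear_form_scale[OF L])
    qed
    ultimately have "((\<lambda>t. eval_mpoly g (($) (p + t *s v)) / t * (\<Prod>j\<in>I. L j v) *
        (\<Prod>j\<in>-I. L j (p + t *s v))) \<longlongrightarrow> G v * (\<Prod>j\<in>I. L j v) * K) (at 0)"
      by (intro tendsto_mult tendsto_const)
    moreover have "\<forall>\<^sub>F t in at 0. eval_mpoly g (($) (p + t *s v)) / t * (\<Prod>j\<in>I. L j v) *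
        (\<Prod>j\<in>-I. L j (p + t *s v)) = eval_mpoly f (($) (p + t *s v)) / t ^ Suc (card I)"
    proof (rule eventually_mono[OF eventually_neq_at_within[of 0]])
      fix t :: complex assume "t \<noteq> 0"
      have "(\<Prod>j\<in>UNIV. L j (p + t *s v)) = (\<Prod>j\<in>I. L j (p + t *s v)) * (\<Prod>j\<in>-I. L j (p + t *s v))"
        by (subst prod.union_disjoint[symmetric]) auto
      also have "(\<Prod>j\<in>I. L j (p + t *s v)) = (\<Prod>j\<in>I. t * L j v)"
        by (rule prod.cong) (auto simp: I_def linear_form_add[OF L] linear_form_scale[OF L])
      finally have "eval_mpoly f (($) (p + t *s v)) = eval_mpoly g (($) (p + t *s v)) *
          (t ^ card I * (\<Prod>j\<in>I. L j v) * (\<Prod>j\<in>-I. L j (p + t *s v)))"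
        by (simp add: f_eval prod.distrib)
      then show "eval_mpoly g (($) (p + t *s v)) / t * (\<Prod>j\<in>I. L j v) *
          (\<Prod>j\<in>-I. L j (p + t *s v)) = eval_mpoly f (($) (p + t *s v)) / t ^ Suc (card I)"
        using \<open>t \<noteq> 0\<close> by (simp add: field_simps)
    qed
    ultimately show ?thesis by (rule Lim_transform_eventually)
  qed
  have lim_right: "((\<lambda>t. eval_mpoly f (($) (p + t *s v)) / t ^ card R) \<longlongrightarrow>
      u p * (\<Prod>k\<in>R. m k v)) (at 0)" for v
  proof -
    obtain u' where "(u has_derivative u') (at p)"
      using holomorphic_fun_derivative[OF U(4,1)] by blast
    then have "isCont u p" by (rule has_derivative_continuous)
    then have "((\<lambda>t. u (p + t *s v)) \<longlongrightarrow> u p) (at 0)"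
      using tendsto_along_line by (rule isCont_tendsto_compose)
    moreover have "((\<lambda>t. \<Prod>k\<in>R. Y (p + t *s v) $ k / t) \<longlongrightarrow> (\<Prod>k\<in>R. m k v)) (at 0)"
    proof (rule tendsto_prod)
      fix k
      have "((\<lambda>t. Y (p + t *s v) $ k) has_field_derivative m k v) (at 0)"
        by (rule directional_derivative[OF m(1)]) (rule linear_form_scale[OF m(2)])
      then show "((\<lambda>t. Y (p + t *s v) $ k / t) \<longlongrightarrow> m k v) (at 0)"
        by (rule has_field_derivative_quotient_limit) (simp add: U(3))
    qed
    ultimately have "((\<lambda>t. u (p + t *s v) * (\<Prod>k\<in>R. Y (p + t *s v) $ k / t)) \<longlongrightarrow>
        u p * (\<Prod>k\<in>R. m k v)) (at 0)"
      by (rule tendsto_mult)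
    moreover have "\<forall>\<^sub>F t in at 0. u (p + t *s v) * (\<Prod>k\<in>R. Y (p + t *s v) $ k / t) =
        eval_mpoly f (($) (p + t *s v)) / t ^ card R"
      using eventually_along_line[OF \<open>open U\<close> U(1), of v]
      by (rule eventually_mono) (simp add: U(6) prod_dividef)
    ultimately show ?thesis by (rule Lim_transform_eventually)
  qed
  \<comment> \<open>In a direction where none of the finitely many linear factors vanishes, both
    leading coefficients are nonzero, so the two orders of vanishing agree.\<close>
  have card_R: "card R = Suc (card I)"
  proof -
    have "\<exists>v\<in>UNIV. \<forall>\<phi>\<in>insert G (L ` I \<union> m ` R). \<phi> v \<noteq> 0"
      by (rule linear_forms_common_nonzero) (use G L m(2) G_nonzero L_nonzero m_nonzero in auto)
    then obtain v where v: "G v \<noteq> 0" "\<And>j. j \<in> I \<Longrightarrow> L j v \<noteq> 0" "\<And>k. k \<in> R \<Longrightarrow> m k v \<noteq> 0" by auto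
    then have "G v * (\<Prod>j\<in>I. L j v) * K \<noteq> 0" "u p * (\<Prod>k\<in>R. m k v) \<noteq> 0"
      using K U(5)[OF U(1)] by auto
    then show ?thesis
      using leading_coefficient_unique[OF lim_left lim_right, of v]
        leading_coefficient_unique[OF lim_right lim_left, of v] by linarith
  qed
  have eq: "G v * (\<Prod>j\<in>I. L j v) * K = u p * (\<Prod>k\<in>R. m k v)" for v
    using lim_right[of v] lim_left[of v] by (intro tendsto_unique) (auto simp: card_R)
  have m_I: "m k v = 0" if k: "k \<in> R" and v: "\<And>j. j \<in> I \<Longrightarrow> L j v = 0" for k v
  proof -
    \<comment> \<open>On the kernel of \<open>m k\<close> the product of \<open>G\<close> and the
      \<open>L j\<close> vanishes. A vector space is not a finite union of proper subspaces, so a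
      single factor vanishes on the whole kernel.\<close>
    have "\<exists>\<phi>\<in>insert G (L ` I). \<forall>w\<in>{w. m k w = 0}. \<phi> w = 0"
    proof (rule ccontr)
      assume *: "\<not> ?thesis"
      have "\<exists>w\<in>{w. m k w = 0}. \<forall>\<phi>\<in>insert G (L ` I). \<phi> w \<noteq> 0"
        by (rule linear_forms_common_nonzero)
          (use * G L in \<open>auto simp: linear_form_0[OF m(2)] linear_form_add[OF m(2)] linear_form_scale[OF m(2)]\<close>)
      then obtain w where w: "m k w = 0" "G w \<noteq> 0" "\<And>j. j \<in> I \<Longrightarrow> L j w \<noteq> 0" by auto
      have "(\<Prod>k\<in>R. m k w) = 0" using k w(1) by (intro prod_zero) auto
      then have "G w * (\<Prod>j\<in>I. L j w) * K = 0" unfolding eq by simp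
      then show False using w K by simp
    qed
    then obtain \<phi> where \<phi>: "\<phi> \<in> insert G (L ` I)" "\<And>w. m k w = 0 \<Longrightarrow> \<phi> w = 0" by auto
    have lin: "linear_form \<phi>" using \<phi>(1) G L by auto
    obtain v1 where v1: "\<phi> v1 \<noteq> 0" using \<phi>(1) G_nonzero L_nonzero by auto
    then have "m k v1 \<noteq> 0" using \<phi>(2) by auto
    \<comment> \<open>Projecting \<open>v\<close> along \<open>v1\<close> into the kernel of
      \<open>m k\<close> shows that \<open>m k\<close> is proportional to the factor, and the factor
      vanishes at \<open>v\<close>.\<close>
    then have "m k (v + (- (m k v / m k v1)) *s v1) = 0"
      unfolding linear_form_add[OF m(2)] linear_form_scale[OF m(2)] by simp
    then have "\<phi> (v + (- (m k v / m k v1)) *s v1) = 0" by (rule \<phi>(2))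
    moreover have "\<phi> v = 0" using \<phi>(1) v G_I[OF v] by auto
    ultimately have "(- (m k v / m k v1)) * \<phi> v1 = 0"
      unfolding linear_form_add[OF lin] linear_form_scale[OF lin] by simp
    then show ?thesis using v1 \<open>m k v1 \<noteq> 0\<close> by simp
  qed
  \<comment> \<open>The \<open>L j\<close> with j in \<open>I\<close>, the differentials outside
    \<open>R\<close> and the equation at \<open>i0\<close>. As \<open>R\<close> has one element more
    than \<open>I\<close>, these are n equations in n + 1 unknowns; a solution annihilates the
    remaining differentials too.\<close>
  define E where "E = Inl ` I \<union> Inr ` insert None (Some ` (-R))"
  define \<phi> where "\<phi> i v = (case i of Inl j \<Rightarrow> L j v | Inr None \<Rightarrow> v $ i0 | Inr (Some k) \<Rightarrow> m k v)"
    for i :: "'n option + 'n option" and v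
  have "card (insert None (Some ` (-R))) = Suc (CARD('n) - card R)"
    by (subst card_insert_disjoint) (auto simp: card_image Compl_eq_Diff_UNIV card_Diff_subset)
  moreover have "card E = card (Inl ` I :: ('n option + 'n option) set) +
      card (Inr ` insert None (Some ` (-R)) :: ('n option + 'n option) set)"
    unfolding E_def by (rule card_Un_disjoint) auto
  moreover have "card (Inl ` I :: ('n option + 'n option) set) = card I"
    "card (Inr ` insert None (Some ` (-R)) :: ('n option + 'n option) set) = card (insert None (Some ` (-R)))"
    by (rule card_image, rule inj_onI, simp)+
  ultimately have "card E = card I + Suc (CARD('n) - card R)"
    by (simp only:)
  moreover have "card R \<le> CARD('n)" by (rule card_mono) auto
  ultimately have "card E < CARD('n option)"
    using card_R by (simp add: card_UNIV_option)
  moreover have "linear_form (\<phi> i)" for i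
  proof (cases i)
    case (Inr b)
    then show ?thesis using m(2) coord by (cases b) (simp_all add: \<phi>_def[abs_def])
  qed (use L in \<open>simp add: \<phi>_def[abs_def]\<close>)
  moreover have "finite E" by (simp add: E_def)
  ultimately obtain v where v: "v \<noteq> 0" "\<And>i. i \<in> E \<Longrightarrow> \<phi> i v = 0"
    using linear_forms_common_zero[of E \<phi>] by blast
  have "L j v = 0" if "j \<in> I" for j
    using v(2)[of "Inl j"] that by (simp add: E_def \<phi>_def)
  then have "m k v = 0" for k
    using m_I[of k v] v(2)[of "Inr (Some k)"] by (cases "k \<in> R") (auto simp: E_def \<phi>_def)
  moreover have "v $ i0 = 0"
    using v(2)[of "Inr None"] by (simp add: E_def \<phi>_def)
  ultimately show False using kernel v(1) by blast
qed

section \<open>Charts with normal crossings\<close>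

lemma holomorphic_map_iff:
  fixes F :: "complex ^ 'm::finite \<Rightarrow> complex ^ 'k::finite"
  shows "holomorphic_map U F \<longleftrightarrow> open U \<and>
    (\<forall>x\<in>U. \<exists>F'. (F has_derivative F') (at x) \<and> (\<forall>c v. F' (c *s v) = c *s F' v))"
proof
  assume F: "holomorphic_map U F"
  then have "open U" by (simp add: holomorphic_map_def holomorphic_fun_def)
  moreover have "\<exists>F'. (F has_derivative F') (at x) \<and> (\<forall>c v. F' (c *s v) = c *s F' v)" if "x \<in> U" for x
  proof -
    have "\<exists>m. ((\<lambda>x. F x $ k) has_derivative m) (at x) \<and> (\<forall>c v. m (c *s v) = c * m v)" for k
      using F that by (simp add: holomorphic_map_def holomorphic_fun_def)
    then obtain m where m: "\<And>k. ((\<lambda>x. F x $ k) has_derivative m k) (at x)"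
      "\<And>k c v. m k (c *s v) = c * m k v" by metis
    have "((\<lambda>x. \<chi> k. F x $ k) has_derivative (\<lambda>v. \<chi> k. m k v)) (at x)"
      by (rule has_derivative_vec_lambda) (rule m(1))
    then have "(F has_derivative (\<lambda>v. \<chi> k. m k v)) (at x)" by simp
    moreover have "(\<chi> k. m k (c *s v)) = c *s (\<chi> k. m k v)" for c v
      by (simp add: vec_eq_iff m(2))
    ultimately show ?thesis by blast
  qed
  ultimately show "open U \<and>
    (\<forall>x\<in>U. \<exists>F'. (F has_derivative F') (at x) \<and> (\<forall>c v. F' (c *s v) = c *s F' v))" by blast
next
  assume F: "open U \<and> (\<forall>x\<in>U. \<exists>F'. (F has_derivative F') (at x) \<and> (\<forall>c v. F' (c *s v) = c *s F' v))"
  have "\<exists>m. ((\<lambda>x. F x $ k) has_derivative m) (at x) \<and> (\<forall>c v. m (c *s v) = c * m v)" if x: "x \<in> U" for x k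
  proof -
    obtain F' where "(F has_derivative F') (at x) \<and> (\<forall>c v. F' (c *s v) = c *s F' v)"
      using bspec[OF conjunct2[OF F] x] by (rule exE)
    then have F': "(F has_derivative F') (at x)" "\<And>c v. F' (c *s v) = c *s F' v"
      by auto
    have "((\<lambda>x. F x $ k) has_derivative (\<lambda>v. F' v $ k)) (at x)"
      by (rule bounded_linear.has_derivative[OF bounded_linear_vec_nth F'(1)])
    moreover have "F' (c *s v) $ k = c * F' v $ k" for c v
      by (simp add: F'(2))
    ultimately show ?thesis by blast
  qed
  then show "holomorphic_map U F"
    using F by (simp add: holomorphic_map_def holomorphic_fun_def)
qed

lemma holomorphic_map_compose:
  assumes F: "holomorphic_map U F" and G: "holomorphic_map V G" and "F ` U \<subseteq> V"
  shows "holomorphic_map U (\<lambda>x. G (F x))"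
  unfolding holomorphic_map_iff
proof (intro conjI ballI)
  show "open U" using F by (simp add: holomorphic_map_iff)
  fix x assume "x \<in> U"
  then obtain F' G' where F': "(F has_derivative F') (at x)" "\<And>c v. F' (c *s v) = c *s F' v"
    and G': "(G has_derivative G') (at (F x))" "\<And>c v. G' (c *s v) = c *s G' v"
    using F G assms(3) unfolding holomorphic_map_iff by blast
  show "\<exists>H. ((\<lambda>x. G (F x)) has_derivative H) (at x) \<and> (\<forall>c v. H (c *s v) = c *s H v)"
    using has_derivative_compose[OF F'(1) G'(1)] by (auto simp: F'(2) G'(2))
qed

lemma holomorphic_map_continuous_on: "holomorphic_map U F \<Longrightarrow> continuous_on U F"
  by (meson continuous_at_imp_continuous_on has_derivative_continuous holomorphic_map_iff)

lemma holomorphic_fun_eval_mpoly: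
  assumes "open U"
  shows "holomorphic_fun U (\<lambda>x. eval_mpoly p (($) x))"
  unfolding holomorphic_fun_def
proof (intro conjI ballI exI allI)
  fix x show "((\<lambda>x. eval_mpoly p (($) x)) has_derivative
    (\<lambda>v. \<Sum>i\<in>UNIV. eval_mpoly (partial_deriv i p) (($) x) * v $ i)) (at x)"
    by (rule has_derivative_eval_mpoly)
qed (simp_all add: assms sum_distrib_left algebra_simps)

text \<open>The real theorem is enough, because the inverse of a complex linear bijection is complex
  linear.\<close>

lemma holomorphic_inverse_function_theorem:
  fixes F :: "complex ^ 'm::finite \<Rightarrow> complex ^ 'm"
    and F' :: "complex ^ 'm \<Rightarrow> (complex ^ 'm) \<Rightarrow>\<^sub>L (complex ^ 'm)"
  assumes "open T" "y0 \<in> T"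
    and der: "\<And>y. y \<in> T \<Longrightarrow> (F has_derivative blinfun_apply (F' y)) (at y)"
    and cont: "continuous_on T F'"
    and scale: "\<And>y c v. y \<in> T \<Longrightarrow> blinfun_apply (F' y) (c *s v) = c *s blinfun_apply (F' y) v"
    and inverse: "J o\<^sub>L F' y0 = id_blinfun"
  obtains U V G where "U \<subseteq> T" "y0 \<in> U" "F y0 \<in> V" "homeomorphism U V F G"
    "holomorphic_map U F" "holomorphic_map V G"
proof -
  obtain U V G G' where UV: "open U" "U \<subseteq> T" "y0 \<in> U" "open V" "F y0 \<in> V" "homeomorphism U V F G"
    and G': "\<And>y. y \<in> V \<Longrightarrow> (G has_derivative G' y) (at y)"
      "\<And>y. y \<in> V \<Longrightarrow> G' y = inv_into UNIV (blinfun_apply (F' (G y)))"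
      "\<And>y. y \<in> V \<Longrightarrow> bij (blinfun_apply (F' (G y)))"
    using inverse_function_theorem[OF assms(1) der cont assms(2) inverse] by metis
  have "holomorphic_map U F"
    unfolding holomorphic_map_iff using UV(1,2) der scale by blast
  moreover have "G' y (c *s v) = c *s G' y v" if "y \<in> V" for y c v
  proof -
    have "G y \<in> T" using UV(2,6) that by (auto simp: homeomorphism_def)
    let ?A = "blinfun_apply (F' (G y))"
    have "?A (G' y w) = w" for w
      using G'(2,3)[OF that] by (simp add: bij_is_surj surj_f_inv_f)
    then have "?A (G' y (c *s v)) = ?A (c *s G' y v)"
      by (simp add: scale[OF \<open>G y \<in> T\<close>])
    then show ?thesis using G'(3)[OF that] by (metis bij_is_inj injD)
  qed
  then have "holomorphic_map V G"
    unfolding holomorphic_map_iff using UV(4) G'(1) by blast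
  ultimately show ?thesis using that UV by blast
qed

text \<open>The chart where \<open>l j0\<close> is nonzero, with the quotients of the other forms by
  \<open>l j0\<close> as coordinates. The bijection \<pi> numbers these forms by \<open>'n\<close>,
  and the translation \<open>b\<close> serves to move a given point to the origin.\<close>

locale affine_chart = hyperplane_coordinates l a c
  for l :: "'n::finite option \<Rightarrow> 'n option mpoly" and a c +
  fixes j0 :: "'n option" and \<pi> :: "'n \<Rightarrow> 'n option" and b :: "'n \<Rightarrow> complex"
  assumes \<pi>: "bij_betw \<pi> UNIV (UNIV - {j0})"
begin

abbreviation L :: "'n option \<Rightarrow> complex ^ 'n option \<Rightarrow> complex" where
  "L j x \<equiv> eval_mpoly (l j) (($) x)"

definition chart :: "complex ^ 'n option \<Rightarrow> complex ^ 'n" where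
  "chart x = (\<chi> k. L (\<pi> k) x / L j0 x - b k)"

definition point :: "complex ^ 'n \<Rightarrow> complex ^ 'n option" where
  "point y = (\<chi> i. c i j0 + (\<Sum>k\<in>UNIV. c i (\<pi> k) * (y $ k + b k)))"

lemma \<pi>_cases: obtains "j = j0" | k where "j = \<pi> k"
  using \<pi> by (auto simp: bij_betw_def)

lemma \<pi>_eq_iff [simp]: "\<pi> k = \<pi> k' \<longleftrightarrow> k = k'"
  using \<pi> by (auto simp: bij_betw_def dest: injD)

lemma \<pi>_neq [simp]: "\<pi> k \<noteq> j0" "j0 \<noteq> \<pi> k"
  using \<pi> by (auto simp: bij_betw_def)

lemma L_linear: "linear_form (\<lambda>x. L j x)"
  by (rule linear_form_l)

lemma L_injective:
  assumes "\<And>j. L j x = L j y"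
  shows "x = y"
proof -
  have "L j (x + (-1) *s y) = 0" for j
    unfolding linear_form_add[OF L_linear] linear_form_scale[OF L_linear] by (simp add: assms)
  then have "($) (x + (-1) *s y) = (\<lambda>_. 0)" by (rule eval_l_eq_0D)
  then show ?thesis by (simp add: fun_eq_iff vec_eq_iff)
qed

lemma L_sum_columns: "L j (\<chi> i. \<Sum>k\<in>K. c i (q k) * z k) = (\<Sum>k\<in>K. (if j = q k then z k else 0))"
proof -
  have "L j (\<chi> i. \<Sum>k\<in>K. c i (q k) * z k) = (\<Sum>i\<in>UNIV. a j i * (\<Sum>k\<in>K. c i (q k) * z k))"
    by (simp add: l_eq eval_hom)
  also have "\<dots> = (\<Sum>k\<in>K. (\<Sum>i\<in>UNIV. a j i * c i (q k)) * z k)"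
    unfolding sum_distrib_left sum_distrib_right by (subst sum.swap) (simp add: mult.assoc)
  also have "\<dots> = (\<Sum>k\<in>K. (if j = q k then z k else 0))"
    by (rule sum.cong) (auto simp: ac)
  finally show ?thesis .
qed

lemma L_point: "L j0 (point y) = 1" "L (\<pi> k) (point y) = y $ k + b k"
proof -
  have "point y = (\<chi> i. \<Sum>k\<in>{j0}. c i k * 1) + (\<chi> i. \<Sum>k\<in>UNIV. c i (\<pi> k) * (y $ k + b k))"
    by (simp add: point_def vec_eq_iff)
  then have L: "L j (point y) = (if j = j0 then 1 else 0) +
      (\<Sum>k\<in>UNIV. (if j = \<pi> k then y $ k + b k else 0))" for j
    by (simp only: linear_form_add[OF L_linear] L_sum_columns) simp
  show "L j0 (point y) = 1" "L (\<pi> k) (point y) = y $ k + b k"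
    by (simp_all add: L)
qed

lemma chart_point: "chart (point y) = y"
  by (simp add: chart_def L_point vec_eq_iff)

lemma point_chart: "L j0 x \<noteq> 0 \<Longrightarrow> x = L j0 x *s point (chart x)"
proof (rule L_injective)
  fix j assume "L j0 x \<noteq> 0"
  then show "L j x = L j (L j0 x *s point (chart x))"
    by (cases j rule: \<pi>_cases) (simp_all add: linear_form_scale[OF L_linear] L_point chart_def)
qed

lemma chart_scale: "s \<noteq> 0 \<Longrightarrow> chart (s *s x) = chart x"
  by (simp add: chart_def vec_eq_iff linear_form_scale[OF L_linear])

lemma eval_point_chart:
  assumes "p \<in> forms d" "L j0 x \<noteq> 0"
  shows "eval_mpoly p (($) x) = L j0 x ^ d * eval_mpoly p (($) (point (chart x)))"
proof -
  have "($) x = (\<lambda>i. L j0 x * point (chart x) $ i)"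
    by (subst (1) point_chart[OF assms(2)]) (simp add: fun_eq_iff)
  then show ?thesis
    using eval_mpoly_scale[OF assms(1), of "L j0 x" "($) (point (chart x))"] by simp
qed

lemma point_derivative:
  "(point has_derivative (\<lambda>v. \<chi> i. \<Sum>k\<in>UNIV. c i (\<pi> k) * v $ k)) (at y)"
proof -
  have "((\<lambda>y. c i j0 + (\<Sum>k\<in>UNIV. c i (\<pi> k) * (y $ k + b k))) has_derivative
      (\<lambda>v. \<Sum>k\<in>UNIV. c i (\<pi> k) * v $ k)) (at y)" for i
    by (auto intro!: derivative_eq_intros bounded_linear_imp_has_derivative bounded_linear_vec_nth)
  then show ?thesis
    unfolding point_def[abs_def] by (rule has_derivative_vec_lambda)
qed

lemma point_holomorphic: "holomorphic_map UNIV point"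
  unfolding holomorphic_map_iff using point_derivative
  by (fastforce simp: vec_eq_iff sum_distrib_left algebra_simps)

lemma open_L: "open {x. L j x \<noteq> 0}"
proof -
  have "open ((\<lambda>x. L j x) -` (- {0}))"
    by (rule open_vimage) (auto intro: continuous_on_eval_mpoly)
  moreover have "(\<lambda>x. L j x) -` (- {0}) = {x. L j x \<noteq> 0}" by auto
  ultimately show ?thesis by simp
qed

lemma chart_holomorphic: "holomorphic_map {x. L j0 x \<noteq> 0} chart"
  unfolding holomorphic_map_def holomorphic_fun_def
proof (intro allI conjI ballI)
  show "open {x. L j0 x \<noteq> 0}" by (rule open_L)
next
  fix k x assume "x \<in> {x. L j0 x \<noteq> 0}"
  then have x: "L j0 x \<noteq> 0" by simp
  let ?d = "\<lambda>j v. \<Sum>i\<in>UNIV. eval_mpoly (partial_deriv i (l j)) (($) x) * v $ i"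
  have "((\<lambda>x. L (\<pi> k) x / L j0 x - b k) has_derivative
      (\<lambda>v. (?d (\<pi> k) v * L j0 x - L (\<pi> k) x * ?d j0 v) / (L j0 x * L j0 x))) (at x)"
    by (rule derivative_eq_intros has_derivative_eval_mpoly x refl)+ (simp add: x field_simps)
  moreover have "?d j (s *s v) = s * ?d j v" for j s v
    by (simp add: sum_distrib_left algebra_simps)
  ultimately show "\<exists>h'. ((\<lambda>x. chart x $ k) has_derivative h') (at x) \<and> (\<forall>s v. h' (s *s v) = s * h' v)"
    by (intro exI conjI) (auto simp: chart_def algebra_simps diff_divide_distrib)
qed

lemma analytic_coordinates_chart:
  assumes F: "holomorphic_map U F" and G: "holomorphic_map V G" and FG: "homeomorphism U V F G"
  shows "analytic_coordinates {x. L j0 x \<noteq> 0 \<and> chart x \<in> U} (\<lambda>x. F (chart x))"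
proof -
  let ?U = "{x. L j0 x \<noteq> 0 \<and> chart x \<in> U}"
  have "open U" using F by (simp add: holomorphic_map_iff)
  have "open ({x. L j0 x \<noteq> 0} \<inter> chart -` U)"
    using holomorphic_map_continuous_on[OF chart_holomorphic] open_L \<open>open U\<close>
    by (rule continuous_open_preimage)
  moreover have "{x. L j0 x \<noteq> 0} \<inter> chart -` U = ?U" by auto
  ultimately have "open ?U" by simp
  then have chart: "holomorphic_map ?U chart"
    using chart_holomorphic by (auto simp: holomorphic_map_iff)
  have image: "(\<lambda>x. F (chart x)) ` ?U = V"
  proof (intro subset_antisym subsetI)
    fix y assume "y \<in> V"
    then have "G y \<in> U" "F (G y) = y" using FG by (auto simp: homeomorphism_def)
    then show "y \<in> (\<lambda>x. F (chart x)) ` ?U"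
      by (intro image_eqI[of _ _ "point (G y)"]) (auto simp: chart_point L_point)
  qed (use FG in \<open>auto simp: homeomorphism_def\<close>)
  have "0 \<notin> ?U" using linear_form_0[OF L_linear] by simp
  moreover have "s *s x \<in> ?U \<and> F (chart (s *s x)) = F (chart x)" if "x \<in> ?U" "s \<noteq> 0" for x s
    using that by (simp add: chart_scale linear_form_scale[OF L_linear])
  moreover have "holomorphic_map ?U (\<lambda>x. F (chart x))"
    by (rule holomorphic_map_compose[OF chart F]) auto
  \<comment> \<open>The inverse in homogeneous coordinates is \<open>point\<close> after
    \<open>G\<close>, with representatives normalised by \<open>l j0\<close> = 1.\<close>
  moreover have "holomorphic_map ((\<lambda>x. F (chart x)) ` ?U) (\<lambda>y. point (G y))"
    unfolding image by (rule holomorphic_map_compose[OF G point_holomorphic]) auto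
  moreover have "\<exists>s. s \<noteq> 0 \<and> point (G (F (chart x))) = s *s x" if "x \<in> ?U" for x
  proof -
    have "G (F (chart x)) = chart x" using FG that by (auto simp: homeomorphism_def)
    moreover have "inverse (L j0 x) *s x = inverse (L j0 x) *s (L j0 x *s point (chart x))"
      using point_chart[of x] that by simp
    ultimately have "point (G (F (chart x))) = inverse (L j0 x) *s x"
      using that by simp
    then show ?thesis using that by (intro exI[of _ "inverse (L j0 x)"]) simp
  qed
  ultimately show ?thesis
    unfolding analytic_coordinates_def by blast
qed

end

context affine_chart
begin

text \<open>The units that occur are values of polynomials, which makes their holomorphy
  automatic.\<close>

lemma local_normal_crossing:
  fixes F G :: "complex ^ 'n \<Rightarrow> complex ^ 'n"
  assumes F: "holomorphic_map U F" and G: "holomorphic_map V G" and FG: "homeomorphism U V F G"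
    and p: "L j0 p \<noteq> 0" "chart p \<in> U" "F (chart p) = 0" and R: "R \<noteq> {}"
    and f: "\<And>x. L j0 x \<noteq> 0 \<Longrightarrow> chart x \<in> U \<Longrightarrow> eval_mpoly q (($) x) \<noteq> 0 \<and>
      eval_mpoly f (($) x) = eval_mpoly q (($) x) * (\<Prod>k\<in>R. F (chart x) $ k)"
  shows "\<exists>U Y R u. p \<in> U \<and> analytic_coordinates U Y \<and> Y p = 0 \<and> R \<noteq> {} \<and>
    holomorphic_fun U u \<and> (\<forall>x\<in>U. u x \<noteq> 0) \<and>
    (\<forall>x\<in>U. eval_mpoly f (($) x) = u x * (\<Prod>k\<in>R. Y x $ k))"
proof -
  let ?U = "{x. L j0 x \<noteq> 0 \<and> chart x \<in> U}"
  have "analytic_coordinates ?U (\<lambda>x. F (chart x))"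
    by (rule analytic_coordinates_chart[OF F G FG])
  moreover from this have "open ?U"
    by (auto simp: analytic_coordinates_def holomorphic_map_def holomorphic_fun_def)
  then have "holomorphic_fun ?U (\<lambda>x. eval_mpoly q (($) x))"
    by (rule holomorphic_fun_eval_mpoly)
  ultimately show ?thesis
    using p R f
    by (intro exI[of _ ?U] exI[of _ "\<lambda>x. F (chart x)"] exI[of _ R]
        exI[of _ "\<lambda>x. eval_mpoly q (($) x)"]) auto
qed

section \<open>Coordinate systems with the equation of W as a coordinate\<close>

lemma open_point: "open {y. eval_mpoly q (($) (point y)) \<noteq> 0}"
proof -
  have "continuous_on UNIV (\<lambda>y. eval_mpoly q (($) (point y)))"
    by (rule continuous_on_compose2[OF continuous_on_eval_mpoly[of UNIV]
          holomorphic_map_continuous_on[OF point_holomorphic]]) auto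
  then have "open ((\<lambda>y. eval_mpoly q (($) (point y))) -` (- {0}))"
    by (rule open_vimage[rotated]) auto
  moreover have "(\<lambda>y. eval_mpoly q (($) (point y))) -` (- {0}) = {y. eval_mpoly q (($) (point y)) \<noteq> 0}"
    by auto
  ultimately show ?thesis by simp
qed

text \<open>Exchanges the chart coordinate \<open>k1\<close> for the dehomogenised equation of W and
  leaves the others alone, so that the hyperplanes among them remain coordinate hyperplanes.\<close>

definition graph :: "'n \<Rightarrow> 'n option mpoly \<Rightarrow> complex ^ 'n \<Rightarrow> complex ^ 'n" where
  "graph k1 g y = (\<chi> k. if k = k1 then eval_mpoly g (($) (point y)) else y $ k)"

definition graph_deriv :: "'n \<Rightarrow> 'n option mpoly \<Rightarrow> complex ^ 'n \<Rightarrow> complex ^ 'n \<Rightarrow> complex ^ 'n" where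
  "graph_deriv k1 g y v = (\<chi> k. if k = k1
     then \<Sum>k'\<in>UNIV. eval_mpoly (D (\<pi> k') g) (($) (point y)) * v $ k' else v $ k)"

lemma graph_has_derivative: "(graph k1 g has_derivative graph_deriv k1 g y) (at y)"
proof -
  have "((\<lambda>y. eval_mpoly g (($) (point y))) has_derivative
      (\<lambda>v. \<Sum>k\<in>UNIV. eval_mpoly (D (\<pi> k) g) (($) (point y)) * v $ k)) (at y)"
  proof -
    have "((\<lambda>y. eval_mpoly g (($) (point y))) has_derivative (\<lambda>v. \<Sum>i\<in>UNIV.
        eval_mpoly (partial_deriv i g) (($) (point y)) *
        (\<chi> i. \<Sum>k\<in>UNIV. c i (\<pi> k) * v $ k) $ i)) (at y)"
      by (rule has_derivative_compose[OF point_derivative has_derivative_eval_mpoly])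
    moreover have "(\<Sum>i\<in>UNIV. eval_mpoly (partial_deriv i g) (($) (point y)) *
        (\<chi> i. \<Sum>k\<in>UNIV. c i (\<pi> k) * v $ k) $ i) =
        (\<Sum>k\<in>UNIV. eval_mpoly (D (\<pi> k) g) (($) (point y)) * v $ k)" for v :: "complex ^ 'n"
      by (simp add: D_def eval_hom sum_distrib_left sum_distrib_right,
          subst sum.swap, simp add: algebra_simps)
    ultimately show ?thesis by (simp only:)
  qed
  moreover have "((\<lambda>y. y $ k) has_derivative (\<lambda>v. v $ k)) (at y)" for k :: 'n
    by (intro bounded_linear_imp_has_derivative bounded_linear_vec_nth)
  ultimately have "((\<lambda>y. if k = k1 then eval_mpoly g (($) (point y)) else y $ k) has_derivative
      (\<lambda>v. if k = k1 then \<Sum>k'\<in>UNIV. eval_mpoly (D (\<pi> k') g) (($) (point y)) * v $ k' else v $ k)) (at y)" for k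
    by (cases "k = k1") simp_all
  then show ?thesis
    unfolding graph_def[abs_def] graph_deriv_def[abs_def] by (rule has_derivative_vec_lambda)
qed

lemma graph_local_inverse:
  assumes "open T" "y0 \<in> T" and d: "eval_mpoly (D (\<pi> k1) g) (($) (point y0)) \<noteq> 0"
  obtains U V G where "U \<subseteq> T" "y0 \<in> U" "homeomorphism U V (graph k1 g) G"
    "holomorphic_map U (graph k1 g)" "holomorphic_map V G"
proof -
  let ?d = "\<lambda>k y. eval_mpoly (D (\<pi> k) g) (($) (point y))"
  define F' where "F' y = Blinfun (graph_deriv k1 g y)" for y
  have F': "blinfun_apply (F' y) = graph_deriv k1 g y" for y
    unfolding F'_def
    by (rule bounded_linear_Blinfun_apply[OF has_derivative_bounded_linear[OF graph_has_derivative]])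
  \<comment> \<open>The explicit inverse of the derivative at \<open>y0\<close>: the component
    \<open>k1\<close> is solved for, the others are unchanged.\<close>
  define J where "J w = (\<chi> k. if k = k1
    then (w $ k1 - (\<Sum>k'\<in>UNIV - {k1}. ?d k' y0 * w $ k')) / ?d k1 y0 else w $ k)" for w :: "complex ^ 'n"
  have "linear J"
    by (rule linearI) (simp_all add: J_def vec_eq_iff algebra_simps sum.distrib add_divide_distrib
        diff_divide_distrib scaleR_conv_of_real[where 'a = complex] sum_distrib_left)
  then have J: "blinfun_apply (Blinfun J) = J"
    by (intro bounded_linear_Blinfun_apply) (simp add: linear_conv_bounded_linear)
  have cont: "continuous_on T F'"
  proof (rule continuous_on_blinfun_componentwise)
    fix v :: "complex ^ 'n"
    have "continuous_on T (\<lambda>y. ?d k y)" for k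
      by (rule continuous_on_compose2[OF continuous_on_eval_mpoly[of UNIV]
            continuous_on_subset[OF holomorphic_map_continuous_on[OF point_holomorphic]]]) auto
    then have "continuous_on T (\<lambda>y. graph_deriv k1 g y v $ k)" for k
      by (cases "k = k1") (auto simp: graph_deriv_def intro!: continuous_intros)
    then have "continuous_on T (\<lambda>y. \<chi> k. graph_deriv k1 g y v $ k)"
      by (intro continuous_on_vec_lambda)
    then show "continuous_on T (\<lambda>y. blinfun_apply (F' y) v)"
      by (simp add: F')
  qed
  have scale: "graph_deriv k1 g y (s *s v) = s *s graph_deriv k1 g y v" for y s v
    by (simp add: graph_deriv_def vec_eq_iff sum_distrib_left algebra_simps)
  have "Blinfun J o\<^sub>L F' y0 = id_blinfun"
  proof (rule blinfun_eqI)
    fix v :: "complex ^ 'n"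
    have "(\<Sum>k\<in>UNIV. ?d k y0 * v $ k) = ?d k1 y0 * v $ k1 + (\<Sum>k\<in>UNIV - {k1}. ?d k y0 * v $ k)"
      by (rule sum.remove) auto
    moreover have "(\<Sum>k\<in>UNIV - {k1}. ?d k y0 * graph_deriv k1 g y0 v $ k) =
        (\<Sum>k\<in>UNIV - {k1}. ?d k y0 * v $ k)"
      by (rule sum.cong) (auto simp: graph_deriv_def)
    ultimately have "J (graph_deriv k1 g y0 v) = v"
      using d by (simp add: J_def vec_eq_iff) (simp add: graph_deriv_def)
    then show "blinfun_apply (Blinfun J o\<^sub>L F' y0) v = blinfun_apply id_blinfun v"
      by (simp add: J F')
  qed
  then show ?thesis
    using holomorphic_inverse_function_theorem[OF assms(1,2), of "graph k1 g" F' "Blinfun J"]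
      graph_has_derivative cont scale that
    unfolding F' by metis
qed

end

text \<open>At a singular point all \<open>D j g\<close> vanish, being combinations of the partial
  derivatives.\<close>

lemma (in hyperplane_coordinates) nondegenerate_smooth:
  assumes "\<And>p. (\<And>j. eval_mpoly (l j) p * eval_mpoly (D j g) p = 0) \<Longrightarrow> p = (\<lambda>_. 0)"
  shows "smooth_hypersurface g"
  unfolding smooth_hypersurface_def
proof (rule ballI, rule ccontr)
  fix x assume x: "x \<in> hypersurface g" and "\<not> (\<exists>i. eval_mpoly (partial_deriv i g) (($) x) \<noteq> 0)"
  then have "eval_mpoly (D j g) (($) x) = 0" for j
    by (simp add: D_def eval_hom)
  then have "($) x = (\<lambda>_. 0)" by (intro assms) simp
  then show False using x by (simp add: hypersurface_def vec_eq_iff fun_eq_iff)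
qed

text \<open>The task is to find a chart in which the hyperplanes through the point are coordinate
  hyperplanes and, if W passes through it, a further coordinate to be exchanged for
  \<open>g\<close>.\<close>

lemma nondegenerate_normal_crossing:
  fixes l :: "'n::finite option \<Rightarrow> 'n option mpoly"
  assumes coords: "hyperplane_coordinates l a c"
    and g: "g \<in> forms e" "0 < e"
    and nondegenerate: "\<And>p. (\<And>j. eval_mpoly (l j) p * eval_mpoly (hyperplane_coordinates.D c j g) p = 0)
      \<Longrightarrow> p = (\<lambda>_. 0)"
  shows "normal_crossing_divisor (g * (\<Prod>j\<in>UNIV. l j))"
  unfolding normal_crossing_divisor_def
proof
  interpret hyperplane_coordinates l a c by fact
  define f where "f = g * (\<Prod>j\<in>UNIV. l j)"
  let ?L = "\<lambda>j x. eval_mpoly (l j) (($) x)"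
  let ?g = "\<lambda>x. eval_mpoly g (($) x)"
  fix p assume "p \<in> hypersurface (g * (\<Prod>j\<in>UNIV. l j))"
  then have p: "p \<noteq> 0" "?g p = 0 \<or> (\<exists>j. ?L j p = 0)"
    by (auto simp: hypersurface_def eval_hom)
  define I where "I = {j. ?L j p = 0}"
  have choice: "\<exists>j0. j0 \<notin> I \<and> (?g p = 0 \<longrightarrow> (\<exists>j1. j1 \<notin> I \<and> j1 \<noteq> j0 \<and> eval_mpoly (D j1 g) (($) p) \<noteq> 0))"
  proof (cases "?g p = 0")
    case False
    have "\<exists>j0. ?L j0 p \<noteq> 0"
    proof (rule ccontr)
      assume "\<not> ?thesis"
      then have "($) p = (\<lambda>_. 0)" by (intro eval_l_eq_0D) auto
      then show False using p(1) by (simp add: fun_eq_iff vec_eq_iff)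
    qed
    then show ?thesis using False by (auto simp: I_def)
  next
    case True
    \<comment> \<open>On W the terms \<open>l j * D j g\<close> add up to 0 by Euler's identity, so
      one nonzero term entails a second. One index gives the chart, the other one the coordinate to
      be exchanged for \<open>g\<close>.\<close>
    let ?t = "\<lambda>j. ?L j p * eval_mpoly (D j g) (($) p)"
    obtain j1 where j1: "?t j1 \<noteq> 0"
      using nondegenerate[of "($) p"] p(1) by (force simp: fun_eq_iff vec_eq_iff)
    have "(\<Sum>j\<in>UNIV. ?t j) = eval_mpoly (\<Sum>j\<in>UNIV. l j * D j g) (($) p)"
      by (simp only: eval_hom)
    also have "\<dots> = 0"
      unfolding euler_identity_D[OF g(1)] using True by (simp add: eval_mpoly.hom_mult)
    finally have "?t j1 + (\<Sum>j\<in>UNIV - {j1}. ?t j) = 0"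
      using sum.remove[of UNIV j1 ?t] by simp
    then have "(\<Sum>j\<in>UNIV - {j1}. ?t j) \<noteq> 0" using j1 by auto
    then obtain j0 where "j0 \<in> UNIV - {j1}" "?t j0 \<noteq> 0" by (rule sum.not_neutral_contains_not_neutral)
    then show ?thesis using j1 by (auto simp: I_def)
  qed
  then obtain j0 where j0: "j0 \<notin> I" "?g p = 0 \<Longrightarrow> \<exists>j1. j1 \<notin> I \<and> j1 \<noteq> j0 \<and> eval_mpoly (D j1 g) (($) p) \<noteq> 0"
    by blast
  have "\<exists>\<pi> :: 'n \<Rightarrow> _. bij_betw \<pi> UNIV (UNIV - {j0})"
    by (rule finite_same_card_bij) (auto simp: card_UNIV_option)
  then obtain \<pi> :: "'n \<Rightarrow> _" where "bij_betw \<pi> UNIV (UNIV - {j0})" by blast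
  then interpret affine_chart l a c j0 \<pi> "\<lambda>k. ?L (\<pi> k) p / ?L j0 p"
    by unfold_locales
  have Lp: "?L j0 p \<noteq> 0" using j0(1) by (simp add: I_def)
  have chart_p: "chart p = 0" by (simp add: chart_def vec_eq_iff)
  define RI where "RI = {k. \<pi> k \<in> I}"
  have L_chart: "?L j x = ?L j0 x * ?L j (point (chart x))" if "?L j0 x \<noteq> 0" for j x
    using eval_point_chart[OF l_forms that, of j] by simp
  have L_RI: "?L (\<pi> k) x = ?L j0 x * chart x $ k" if "k \<in> RI" "?L j0 x \<noteq> 0" for k x
    using that by (simp add: chart_def RI_def I_def)
  have prod_I: "(\<Prod>j\<in>I. ?L j x) = ?L j0 x ^ card RI * (\<Prod>k\<in>RI. chart x $ k)" if "?L j0 x \<noteq> 0" for x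
  proof -
    have "I = \<pi> ` RI"
    proof (intro subset_antisym subsetI)
      fix j assume "j \<in> I"
      then show "j \<in> \<pi> ` RI" using j0(1) by (cases j rule: \<pi>_cases) (auto simp: RI_def)
    qed (auto simp: RI_def)
    then have "(\<Prod>j\<in>I. ?L j x) = (\<Prod>k\<in>RI. ?L (\<pi> k) x)"
      by (simp add: prod.reindex inj_on_def)
    also have "\<dots> = (\<Prod>k\<in>RI. ?L j0 x * chart x $ k)"
      by (rule prod.cong) (use L_RI that in auto)
    finally show ?thesis by (simp add: prod.distrib)
  qed
  \<comment> \<open>The unit: the forms that do not vanish at the point, and the powers of
    \<open>l j0\<close> that arise from dehomogenising those that do.\<close>
  define r where "r = (\<Prod>j\<in>-I. l j) * l j0 ^ card RI"
  have eval_r: "eval_mpoly r (($) x) = (\<Prod>j\<in>-I. ?L j x) * ?L j0 x ^ card RI" for x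
    by (simp add: r_def eval_hom)
  have eval_f: "eval_mpoly f (($) x) = ?g x * (eval_mpoly r (($) x) * (\<Prod>k\<in>RI. chart x $ k))"
    if "?L j0 x \<noteq> 0" for x
  proof -
    have "(\<Prod>j\<in>UNIV. ?L j x) = (\<Prod>j\<in>I. ?L j x) * (\<Prod>j\<in>-I. ?L j x)"
      by (subst prod.union_disjoint[symmetric]) auto
    then show ?thesis
      by (simp add: f_def eval_hom eval_r prod_I[OF that] algebra_simps)
  qed
  define T where "T = {y. eval_mpoly (\<Prod>j\<in>-I. l j) (($) (point y)) \<noteq> 0}"
  have T: "open T" unfolding T_def by (rule open_point)
  have r_nonzero: "eval_mpoly r (($) x) \<noteq> 0" if "?L j0 x \<noteq> 0" "chart x \<in> T" for x
  proof -
    have "?L j x \<noteq> 0" if "j \<notin> I" for j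
      using that \<open>chart x \<in> T\<close> L_chart[OF \<open>?L j0 x \<noteq> 0\<close>, of j] \<open>?L j0 x \<noteq> 0\<close>
      by (simp only: T_def mem_Collect_eq eval_mpoly.hom_prod) (auto simp: prod_zero_iff)
    then show ?thesis
      using that(1) by (simp add: eval_r)
  qed
  have p_T: "chart p \<in> T"
  proof -
    have "?L j (point (chart p)) \<noteq> 0" if "j \<notin> I" for j
      using that L_chart[OF Lp, of j] by (auto simp: I_def)
    then show ?thesis by (simp add: T_def eval_mpoly.hom_prod)
  qed
  have g_chart: "?g x = ?L j0 x ^ e * ?g (point (chart x))" if "?L j0 x \<noteq> 0" for x
    by (rule eval_point_chart[OF g(1) that])
  show "\<exists>U Y R u. p \<in> U \<and> analytic_coordinates U Y \<and> Y p = 0 \<and> R \<noteq> {} \<and>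
    holomorphic_fun U u \<and> (\<forall>x\<in>U. u x \<noteq> 0) \<and>
    (\<forall>x\<in>U. eval_mpoly (g * (\<Prod>j\<in>UNIV. l j)) (($) x) = u x * (\<Prod>k\<in>R. Y x $ k))"
  proof (cases "?g p = 0")
    case False
    \<comment> \<open>Off W the form \<open>g\<close> joins the unit and the chart coordinates need
      no change.\<close>
    define T' where "T' = T \<inter> {y. eval_mpoly g (($) (point y)) \<noteq> 0}"
    have "open T'" unfolding T'_def using T open_point by blast
    then have id: "holomorphic_map T' (\<lambda>y. y)"
      unfolding holomorphic_map_iff by (auto intro!: exI[of _ "\<lambda>v. v"])
    have hom: "homeomorphism T' T' (\<lambda>y. y) (\<lambda>y. y)"
      by (simp add: homeomorphism_def)
    obtain j where "j \<in> I" using p(2) False by (auto simp: I_def)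
    then have RI: "RI \<noteq> {}" using j0(1) by (cases j rule: \<pi>_cases) (auto simp: RI_def)
    have mem: "chart p \<in> T'" using p_T g_chart[OF Lp] False by (simp add: T'_def)
    have factor: "eval_mpoly (g * r) (($) x) \<noteq> 0 \<and>
        eval_mpoly f (($) x) = eval_mpoly (g * r) (($) x) * (\<Prod>k\<in>RI. chart x $ k)"
      if "?L j0 x \<noteq> 0" "chart x \<in> T'" for x
      using that r_nonzero[of x] g_chart[OF that(1)] eval_f[OF that(1)]
      by (simp add: eval_mpoly.hom_mult T'_def)
    show ?thesis
      unfolding f_def[symmetric] by (rule local_normal_crossing[OF id id hom Lp mem chart_p RI factor])
  next
    case True
    obtain j1 where j1: "j1 \<notin> I" "j1 \<noteq> j0" "eval_mpoly (D j1 g) (($) p) \<noteq> 0"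
      using j0(2)[OF True] by blast
    then obtain k1 where k1: "j1 = \<pi> k1" by (cases j1 rule: \<pi>_cases) auto
    have "eval_mpoly (D (\<pi> k1) g) (($) (point (chart p))) \<noteq> 0"
      using eval_point_chart[OF D_forms[OF g(1)] Lp, of j1] j1(3) by (auto simp: k1)
    then obtain U V G where U: "U \<subseteq> T" "chart p \<in> U" "homeomorphism U V (graph k1 g) G"
      "holomorphic_map U (graph k1 g)" "holomorphic_map V G"
      using graph_local_inverse[OF T p_T] by metis
    have "?g (point (chart p)) = 0" using g_chart[OF Lp] True Lp by simp
    then have zero: "graph k1 g (chart p) = 0"
      by (simp add: graph_def vec_eq_iff chart_p)
    \<comment> \<open>The additional power of \<open>l j0\<close> comes from dehomogenising
      \<open>g\<close>, which is now one of the coordinates.\<close>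
    have factor: "eval_mpoly (r * l j0 ^ e) (($) x) \<noteq> 0 \<and> eval_mpoly f (($) x) =
        eval_mpoly (r * l j0 ^ e) (($) x) * (\<Prod>k\<in>insert k1 RI. graph k1 g (chart x) $ k)"
      if "?L j0 x \<noteq> 0" "chart x \<in> U" for x
    proof -
      have "k1 \<notin> RI" using j1(1) by (simp add: RI_def k1)
      then have "(\<Prod>k\<in>RI. graph k1 g (chart x) $ k) = (\<Prod>k\<in>RI. chart x $ k)"
        by (intro prod.cong) (auto simp: graph_def)
      then have "(\<Prod>k\<in>insert k1 RI. graph k1 g (chart x) $ k) =
          ?g (point (chart x)) * (\<Prod>k\<in>RI. chart x $ k)"
        using \<open>k1 \<notin> RI\<close> by (simp add: graph_def)
      then show ?thesis
        using that r_nonzero[of x] U(1) eval_f[OF that(1)] g_chart[OF that(1)]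
        by (auto simp: eval_hom algebra_simps)
    qed
    show ?thesis
      unfolding f_def[symmetric] by (rule local_normal_crossing[OF U(4,5,3) Lp U(2) zero insert_not_empty factor])
  qed
qed

section \<open>Generic forms\<close>

lemma lookup_Const_mult: "lookup (Const k * p) m = k * lookup p m"
proof (induction p rule: single_add_induct)
  case (single m' k')
  show ?case by (simp add: mult_single lookup_single when_def)
qed (simp_all add: distrib_left lookup_add)

lemma mon_forms:
  assumes "\<And>i. x i \<in> forms 1"
  shows "mon x m \<in> forms (mdeg m)"
  unfolding mon_def mdeg_def
  by (rule forms_prod) (use forms_power[OF assms] in simp)

lemma forms_eqI:
  assumes "p \<in> forms d" "q \<in> forms d"
    "\<And>m. mdeg m = d \<Longrightarrow> lookup p m = lookup q m"
  shows "p = q"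
proof (rule poly_mapping_eqI)
  fix m show "lookup p m = lookup q m"
  proof (cases "mdeg m = d")
    case False
    then have "m \<notin> keys p" "m \<notin> keys q"
      using assms(1,2) by (auto simp: forms_mdeg)
    then show ?thesis by (simp add: in_keys_iff)
  qed (rule assms(3))
qed

context hyperplane_coordinates
begin

lemma D_Const_mult: "D j (Const k * p) = Const k * D j p"
  by (simp add: D_def sum_distrib_left mult.left_commute)

lemma D_sum: "D j (\<Sum>i\<in>A. p i) = (\<Sum>i\<in>A. D j (p i))"
  by (induction A rule: infinite_finite_induct) (auto simp: D_add D_def[of _ 0])

lemma D_power: "D j (p ^ k) = of_nat k * p ^ (k - 1) * D j p"
  by (simp add: D_def partial_deriv_power sum_distrib_left algebra_simps)

text \<open>\<open>q\<close> is \<open>p\<close> written in the coordinates \<open>l j\<close>: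
  substituting the forms for its variables undoes the change of variables.\<close>

lemma form_expand_l:
  assumes "p \<in> forms d"
  shows "\<exists>q\<in>forms d. p = (\<Sum>m | mdeg m = d. Const (lookup q m) * mon l m)"
proof -
  define q where "q = subst (\<lambda>i. \<Sum>j\<in>UNIV. Const (c i j) * var j) p"
  have "q \<in> forms d"
    unfolding q_def ev_def
  proof (rule forms_sum)
    fix m assume "m \<in> keys p"
    then have "mdeg m = d" using assms by (simp add: forms_mdeg)
    moreover have "mon (\<lambda>i. \<Sum>j\<in>UNIV. Const (c i j) * var j) m \<in> forms (mdeg m)"
      by (intro mon_forms forms_sum forms_mult_Const forms_var)
    ultimately show "Const (lookup p m) * mon (\<lambda>i. \<Sum>j\<in>UNIV. Const (c i j) * var j) m \<in> forms d"
      by (simp add: forms_mult_Const)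
  qed
  have "subst l q = p"
    unfolding q_def
    using mpoly_hom_eqI[OF comm_ring_hom_comp[OF subst_hom subst_hom] comm_ring_hom_id,
        of l "\<lambda>i. \<Sum>j\<in>UNIV. Const (c i j) * var j" p]
    by (simp add: subst.hom_sum subst.hom_mult var_eq[symmetric])
  moreover have "finite {m :: 'v \<Rightarrow>\<^sub>0 nat. mdeg m = d}"
    by (rule finite_subset[OF _ finite_mdeg_le[of d]]) auto
  then have "subst l q = (\<Sum>m | mdeg m = d. Const (lookup q m) * mon l m)"
    using \<open>q \<in> forms d\<close> by (intro ev_superset[OF comm_ring_hom_Const]) (auto simp: forms_mdeg)
  ultimately show ?thesis using \<open>q \<in> forms d\<close> by auto
qed

text \<open>The witness is the determinant of a square matrix of Macaulay type, whose columns are multiples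
  of the forms \<open>l j * D j g\<close> of a large degree \<open>d\<close>. If it does not vanish at \<open>g\<close>, then these
  multiples span all forms of degree \<open>d\<close>. For the Fermat form \<open>\<Sum>i. l i ^ e\<close> the columns are, up to
  the factor \<open>e\<close>, the monomials in the \<open>l i\<close>.\<close>

lemma zariski_open_nondegenerate:
  assumes e: "0 < e"
  shows "\<exists>G. zariski_open_forms e G \<and> G \<noteq> {} \<and>
    (\<forall>g\<in>G. \<forall>p. (\<forall>j. eval_mpoly (l j) p * eval_mpoly (D j g) p = 0) \<longrightarrow> p = (\<lambda>_. 0))"
proof -
  \<comment> \<open>In this degree each monomial is divisible by the e-th power of some variable, by
    the pigeonhole principle.\<close>
  define d where "d = CARD('v) * e"
  have "0 < d" using e by (simp add: d_def)
  define Md where "Md = {m :: 'v \<Rightarrow>\<^sub>0 nat. mdeg m = d}"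
  define Me where "Me = {m :: 'v \<Rightarrow>\<^sub>0 nat. mdeg m = e}"
  have fin: "finite Md" "finite Me"
    unfolding Md_def Me_def by (rule finite_subset[OF _ finite_mdeg_le[of d]], auto)
      (rule finite_subset[OF _ finite_mdeg_le[of e]], auto)
  define K where "K = card Md"
  obtain en where en: "bij_betw en {..<K} Md"
    using ex_bij_betw_nat_finite[OF fin(1)] by (auto simp: K_def atLeast0LessThan)
  have en_Md: "en i \<in> Md" "mdeg (en i) = d" if "i < K" for i
    using en that by (auto simp: bij_betw_def Md_def)
  have en_inj: "en i = en k \<longleftrightarrow> i = k" if "i < K" "k < K" for i k
    using en that by (auto simp: bij_betw_def inj_on_def)
  have en_sum: "(\<Sum>m\<in>Md. F m) = (\<Sum>k\<in>{0..<K}. F (en k))" for F :: "_ \<Rightarrow> 'v mpoly"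
    using sum.reindex_bij_betw[OF en, of F] by (simp add: atLeast0LessThan)
  have "\<exists>j. e \<le> lookup m j" if "m \<in> Md" for m
  proof (rule ccontr)
    assume "\<not> ?thesis"
    then have "(\<Sum>i\<in>UNIV. lookup m i) < (\<Sum>i\<in>(UNIV :: 'v set). e)"
      by (intro sum_strict_mono) (auto simp: not_le)
    then show False
      using that by (simp add: Md_def d_def mdeg_superset[of UNIV])
  qed
  then obtain jm where jm: "\<And>m. m \<in> Md \<Longrightarrow> e \<le> lookup m (jm m)" by metis
  define rest where "rest m = m - single (jm m) e" for m
  have rest: "m = single (jm m) e + rest m" if "m \<in> Md" for m
    unfolding rest_def
    by (rule poly_mapping_eqI) (use jm[OF that] in \<open>auto simp: lookup_add lookup_minus lookup_single when_def\<close>)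
  \<comment> \<open>The column for the monomial \<open>m\<close>: a factor \<open>l j ^ e\<close> of
    \<open>m\<close>, read in the forms \<open>l j\<close>, is replaced by
    \<open>l j * D j g\<close>, which has the same degree.\<close>
  define F where "F m g = mon l (rest m) * (l (jm m) * D (jm m) g)" for m g
  have F_forms: "F m g \<in> forms d" if "m \<in> Md" "g \<in> forms e" for m g
  proof -
    have "mdeg m = e + mdeg (rest m)"
      by (subst rest[OF that(1)]) (simp add: mdeg_add)
    then have "d = mdeg (rest m) + (1 + (e - 1))"
      using that(1) e by (simp add: Md_def)
    then show ?thesis
      unfolding F_def using forms_mult[OF mon_forms[OF l_forms] forms_mult[OF l_forms D_forms[OF that(2)]]]
      by simp
  qed
  \<comment> \<open>The columns depend linearly on \<open>g\<close>, so each matrix entry is a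
    linear polynomial in the coefficients of \<open>g\<close>, and the determinant is a polynomial
    in them.\<close>
  define Q :: "nat \<Rightarrow> nat \<Rightarrow> ('v \<Rightarrow>\<^sub>0 nat) mpoly" where
    "Q i k = (\<Sum>s\<in>Me. Const (lookup (F (en k) (single s 1)) (en i)) * var s)" for i k
  define A where "A g = Matrix.mat K K (\<lambda>(i, k). lookup (F (en k) g) (en i))" for g
  define P where "P = Determinant.det (Matrix.mat K K (\<lambda>(i, k). Q i k))"
  have eval_P: "eval_mpoly P (lookup g) = Determinant.det (A g)" if "g \<in> forms e" for g
  proof -
    have g: "g = (\<Sum>s\<in>Me. Const (lookup g s) * single s 1)"
    proof (rule poly_mapping_eqI)
      fix m
      have "lookup (\<Sum>s\<in>Me. Const (lookup g s) * single s 1) m =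
          (\<Sum>s\<in>Me. if s = m then lookup g m else 0)"
        by (auto simp: lookup_sum mult_single lookup_single when_def intro!: sum.cong)
      also have "\<dots> = lookup g m"
        using that fin(2) by (auto simp: Me_def forms_mdeg in_keys_iff)
      finally show "lookup g m =
          lookup (\<Sum>s\<in>Me. Const (lookup g s) * single s 1) m" ..
    qed
    have "F m g = (\<Sum>s\<in>Me. Const (lookup g s) * F m (single s 1))" for m
      by (subst g) (simp add: F_def D_sum D_Const_mult sum_distrib_left mult.left_commute)
    then have "lookup (F m g) m' =
        (\<Sum>s\<in>Me. lookup g s * lookup (F m (single s 1)) m')" for m m'
      by (simp add: lookup_sum lookup_Const_mult)
    then have "eval_mpoly (Q i k) (lookup g) = lookup (F (en k) g) (en i)" for i k
      by (simp add: Q_def eval_hom mult.commute)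
    then have "map_mat (\<lambda>q. eval_mpoly q (lookup g)) (Matrix.mat K K (\<lambda>(i, k). Q i k)) = A g"
      by (intro eq_matI) (auto simp: A_def)
    then show ?thesis
      unfolding P_def by (simp flip: eval_mpoly.hom_det)
  qed
  define g0 where "g0 = (\<Sum>i\<in>UNIV. l i ^ e)"
  have g0: "g0 \<in> forms e"
    unfolding g0_def using forms_power[OF l_forms, of _ e] by (intro forms_sum) simp
  have D_g0: "l j * D j g0 = of_nat e * l j ^ e" for j
  proof -
    have "D j g0 = of_nat e * l j ^ (e - 1)"
      by (simp add: g0_def D_sum D_power D_l if_distrib[of "\<lambda>p. _ * p"] cong: if_cong)
    then have "l j * D j g0 = of_nat e * (l j ^ (e - 1) * l j)" by simp
    also have "l j ^ (e - 1) * l j = l j ^ e"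
      using e by (cases e) (auto simp: mult.commute)
    finally show ?thesis .
  qed
  have F_g0: "F m g0 = Const (of_nat e) * mon l m" if "m \<in> Md" for m
  proof -
    have "mon l m = l (jm m) ^ e * mon l (rest m)"
      by (subst rest[OF that]) (simp add: mon_add)
    then show ?thesis
      by (simp add: F_def D_g0 algebra_simps)
  qed
  have "Determinant.det (A g0) \<noteq> 0"
  proof -
    \<comment> \<open>The monomials in the \<open>l j\<close> form a basis of the forms of degree
      \<open>d\<close>. Expanding the monomials in the variables in this basis yields, after
      division by e, the inverse of the matrix.\<close>
    have "\<exists>q\<in>forms d. single (en k) 1 =
        (\<Sum>m\<in>Md. Const (lookup q m) * mon l m)" if "k < K" for k
      unfolding Md_def using en_Md(2)[OF that] by (intro form_expand_l forms_single) simp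
    then obtain q where q: "\<And>k. k < K \<Longrightarrow> single (en k) 1 =
        (\<Sum>m\<in>Md. Const (lookup (q k) m) * mon l m)" by metis
    define B where "B = Matrix.mat K K (\<lambda>(i, k). lookup (q k) (en i) / of_nat e)"
    have AB: "A g0 * B = 1\<^sub>m K"
    proof (rule eq_matI)
      fix i k assume "i < dim_row (1\<^sub>m K :: complex mat)" "k < dim_col (1\<^sub>m K :: complex mat)"
      then have ik: "i < K" "k < K" by auto
      have "(A g0 * B) $$ (i, k) = (\<Sum>s\<in>{0..<K}. lookup (F (en s) g0) (en i) *
          (lookup (q k) (en s) / of_nat e))"
        using ik by (simp add: A_def B_def scalar_prod_def)
      also have "\<dots> = (\<Sum>s\<in>{0..<K}. lookup
          (Const (lookup (q k) (en s)) * mon l (en s)) (en i))"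
        by (rule sum.cong) (use e en_Md in \<open>auto simp: F_g0 lookup_Const_mult simp del: single_of_nat\<close>)
      also have "\<dots> = lookup (\<Sum>m\<in>Md. Const (lookup (q k) m) * mon l m) (en i)"
        by (simp add: en_sum lookup_sum)
      also have "\<dots> = lookup (single (en k) 1) (en i)"
        by (simp only: q[OF ik(2)])
      also have "\<dots> = 1\<^sub>m K $$ (i, k)"
        using ik by (simp add: lookup_single when_def en_inj)
      finally show "(A g0 * B) $$ (i, k) = 1\<^sub>m K $$ (i, k)" .
    qed (simp_all add: A_def B_def)
    have "Determinant.det (A g0) * Determinant.det B = 1"
      using Determinant.det_mult[of "A g0" K B] AB by (simp add: A_def B_def)
    then show ?thesis by auto
  qed
  then have "g0 \<in> {g \<in> forms e. \<exists>q\<in>{P}. eval_mpoly q (lookup g) \<noteq> 0}"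
    using g0 by (simp add: eval_P)
  moreover have "p = (\<lambda>_. 0)" if g: "g \<in> forms e" "eval_mpoly P (lookup g) \<noteq> 0"
    and p: "\<forall>j. eval_mpoly (l j) p * eval_mpoly (D j g) p = 0" for g p
  proof
    fix i
    have A: "A g \<in> carrier_mat K K" by (simp add: A_def)
    \<comment> \<open>A column of the adjugate combines the multiples of the
      \<open>l j * D j g\<close> into the determinant times the d-th power of a variable. Evaluation
      at a common zero shows that this coordinate is 0.\<close>
    define C where "C = adj_mat (A g)"
    have C: "C \<in> carrier_mat K K" "A g * C = Determinant.det (A g) \<cdot>\<^sub>m 1\<^sub>m K"
      using adj_mat[OF A] by (auto simp: C_def)
    have "single i d \<in> Md" by (simp add: Md_def)
    then obtain k where k: "k < K" "en k = single i d"
      using en by (auto simp: bij_betw_def)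
    have "(\<Sum>s\<in>{0..<K}. Const (C $$ (s, k)) * F (en s) g) =
        Const (Determinant.det (A g)) * single (en k) 1"
    proof (rule forms_eqI[of _ d])
      show "(\<Sum>s\<in>{0..<K}. Const (C $$ (s, k)) * F (en s) g) \<in> forms d"
        using en_Md(1) g(1) by (intro forms_sum forms_mult_Const F_forms) auto
      show "Const (Determinant.det (A g)) * single (en k) 1 \<in> forms d"
        using en_Md(2)[OF k(1)] by (intro forms_mult_Const forms_single) simp
      fix m :: "'v \<Rightarrow>\<^sub>0 nat" assume "mdeg m = d"
      then have "m \<in> Md" by (simp add: Md_def)
      then obtain r where r: "r < K" "m = en r"
        using en by (auto simp: bij_betw_def)
      have "(A g * C) $$ (r, k) = (\<Sum>s\<in>{0..<K}. lookup (F (en s) g) (en r) * C $$ (s, k))"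
        using r(1) k(1) C(1) by (simp add: A_def scalar_prod_def)
      then have "(\<Sum>s\<in>{0..<K}. C $$ (s, k) * lookup (F (en s) g) (en r)) =
          Determinant.det (A g) * (if r = k then 1 else 0)"
        unfolding C(2) using r(1) k(1) by (simp add: mult.commute)
      then show "lookup (\<Sum>s\<in>{0..<K}. Const (C $$ (s, k)) * F (en s) g) m =
          lookup (Const (Determinant.det (A g)) * single (en k) 1) m"
        using en_inj[OF k(1) r(1)]
        by (cases "k = r")
          (simp_all add: r(2) lookup_sum lookup_Const_mult lookup_single when_def)
    qed
    from arg_cong[OF this, of "\<lambda>q. eval_mpoly q p"]
    have "0 = Determinant.det (A g) * eval_mpoly (single (en k) 1) p"
      using p by (simp add: F_def eval_hom)
    moreover have "eval_mpoly (single (en k) 1) p = p i ^ d"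
      by (simp add: k(2) eval_mpoly_ev ev_single[OF comm_ring_hom_id])
    ultimately show "p i = 0"
      using g eval_P[OF g(1)] by auto
  qed
  ultimately show ?thesis
    by (intro exI[of _ "{g \<in> forms e. \<exists>q\<in>{P}. eval_mpoly q (lookup g) \<noteq> 0}"])
      (auto simp: zariski_open_forms_def)
qed

end

theorem theorem1p1:
  fixes n e :: nat
    and l :: "'n::finite option \<Rightarrow> 'n option mpoly"
  assumes n: "n = CARD('n)" "2 \<le> n"
    and e: "1 \<le> e"
    and l: "\<And>j. l j \<in> forms 1" "(\<Inter>j. hypersurface (l j)) = {}"
  shows "(\<forall>g \<in> forms e. \<forall>f.
            smooth_hypersurface g \<and> f = g * (\<Prod>j\<in>UNIV. l j) \<and> normal_crossing_divisor f \<longrightarrow>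
              (\<exists>\<epsilon> \<delta>. minimal_graded_free_resolution (jacobian_ideal f)
                 (\<lambda>k. replicate ((n + 1) choose k) (shift n e k)) \<epsilon> \<delta>) \<and>
              syzygy_hypersurface f (replicate ((n + 1) choose 2) (e + 1))) \<and>
         (\<exists>G. zariski_open_forms e G \<and> G \<noteq> {} \<and>
            (\<forall>g\<in>G. smooth_hypersurface g \<and> normal_crossing_divisor (g * (\<Prod>j\<in>UNIV. l j))))"
proof (intro conjI ballI allI impI)
  obtain a c where coords: "hyperplane_coordinates l a c"
    using hyperplane_coordinates_exist[OF l] by blast
  interpret hyperplane_coordinates l a c by (rule coords)
  have card_v: "CARD('n option) = n + 1" using n(1) by (simp add: card_UNIV_option)
  {
    fix g f assume g: "g \<in> forms e"
      and f: "smooth_hypersurface g \<and> f = g * (\<Prod>j\<in>UNIV. l j) \<and> normal_crossing_divisor f"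
    interpret nondegenerate_form l a c g e
    proof
      show "2 \<le> CARD('n option)" "g \<in> forms e" "0 < e" using n e g card_v by auto
      show "p = (\<lambda>_. 0)" if "\<And>j. eval_mpoly (l j) p * eval_mpoly (D j g) p = 0" for p
        using f e that by (intro normal_crossing_nondegenerate[OF coords g, of p]) auto
    qed
    have f_eq: "f = local.f" using f by (simp add: f_def)
    show "\<exists>\<epsilon> \<delta>. minimal_graded_free_resolution (jacobian_ideal f)
        (\<lambda>k. replicate ((n + 1) choose k) (shift n e k)) \<epsilon> \<delta>"
      using minimal_resolution unfolding card_v f_eq by simp
    show "syzygy_hypersurface f (replicate ((n + 1) choose 2) (e + 1))"
      using syzygies unfolding card_v f_eq .
  }
  obtain G where G: "zariski_open_forms e G" "G \<noteq> {}"
    "\<And>g p. g \<in> G \<Longrightarrow> (\<And>j. eval_mpoly (l j) p * eval_mpoly (D j g) p = 0) \<Longrightarrow> p = (\<lambda>_. 0)"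
    using zariski_open_nondegenerate[of e] e by fastforce
  have "G \<subseteq> forms e" using G(1) by (auto simp: zariski_open_forms_def)
  then have "smooth_hypersurface g \<and> normal_crossing_divisor (g * (\<Prod>j\<in>UNIV. l j))" if "g \<in> G" for g
    using nondegenerate_smooth[OF G(3)[OF that]] nondegenerate_normal_crossing[OF coords _ _ G(3)[OF that]]
      that e by auto
  then show "\<exists>G. zariski_open_forms e G \<and> G \<noteq> {} \<and>
      (\<forall>g\<in>G. smooth_hypersurface g \<and> normal_crossing_divisor (g * (\<Prod>j\<in>UNIV. l j)))"
    using G(1,2) by blast
qed

end
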